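(* Let $G$ be a finite group. The functor $$-\times_G-:\mathrm{Fin}_G\times{}^{G}\mathrm{Fin}\to\mathrm{Fin}$$ is a perfect pairing.
   Context: $\mathrm{Fin}$ is the category of finite sets, $\mathrm{Fin}_G$ the category of finite right $G$-sets (not necessarily free), and ${}^{G}\mathrm{Fin}$ the category of finite free left $G$-sets. For $X\in\mathrm{Fin}_G$ and $Y\in{}^{G}\mathrm{Fin}$, $X\times_G Y=(X\times Y)/\sim$ with $(xg,y)\sim(x,gy)$ for $g\in G$. For categories $\mathcal{C},\mathcal{D}$ admitting pullbacks and finite coproducts, $\mathrm{Fun}_{\mathrm{pce}}(\mathcal{C},\mathcal{D})$ is the full subcategory of $\mathrm{Fun}(\mathcal{C},\mathcal{D})$ spanned by the functors preserving pullbacks, finite coproducts, and epimorphisms. A functor $F:\mathcal{C}\times\mathcal{D}\to\mathrm{Fin}$ which preserves pullbacks, finite coproducts, and epimorphisms in each variable separately is called a perfect pairing if the induced functors $\mathcal{C}\to\mathrm{Fun}_{\mathrm{pce}}(\mathcal{D},\mathrm{Fin})$ and $\mathcal{D}\to\mathrm{Fun}_{\mathrm{pce}}(\mathcal{C},\mathrm{Fin})$ are both equivalences of categories. *)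

theory Defs
  imports "HOL-Algebra.Group_Action"
begin

section \<open>Categories\<close>

record ('o, 'm) cat =
  Obj :: "'o set"
  Arr :: "'m set"
  Dom :: "'m \<Rightarrow> 'o"
  Cod :: "'m \<Rightarrow> 'o"
  Id :: "'o \<Rightarrow> 'm"
  Comp :: "'m \<Rightarrow> 'm \<Rightarrow> 'm"

text \<open>
  \<open>Comp C g f\<close> is \<open>g\<close> after \<open>f\<close>. It is only meaningful when \<open>Cod C f = Dom C g\<close>.
\<close>

definition arrows :: "('o, 'm) cat \<Rightarrow> 'o \<Rightarrow> 'o \<Rightarrow> 'm set" where
  "arrows C A B = {f \<in> Arr C. Dom C f = A \<and> Cod C f = B}"

locale category =
  fixes C :: "('o, 'm) cat"
  assumes Dom_in_Obj: "f \<in> Arr C \<Longrightarrow> Dom C f \<in> Obj C"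
    and Cod_in_Obj: "f \<in> Arr C \<Longrightarrow> Cod C f \<in> Obj C"
    and Id_in_arrows: "A \<in> Obj C \<Longrightarrow> Id C A \<in> arrows C A A"
    and Comp_in_arrows:
      "f \<in> arrows C A B \<Longrightarrow> g \<in> arrows C B D \<Longrightarrow> Comp C g f \<in> arrows C A D"
    and Comp_Id: "f \<in> arrows C A B \<Longrightarrow> Comp C f (Id C A) = f"
    and Id_Comp: "f \<in> arrows C A B \<Longrightarrow> Comp C (Id C B) f = f"
    and Comp_assoc:
      "f \<in> arrows C A B \<Longrightarrow> g \<in> arrows C B D \<Longrightarrow> h \<in> arrows C D E \<Longrightarrow>
        Comp C (Comp C h g) f = Comp C h (Comp C g f)"

text \<open>
  Arrows of the concrete categories below carry their source and target, so that every arrow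
  has a unique domain and codomain.
\<close>

datatype ('o, 'f) arrow = Arrow (src: 'o) (mor: 'f) (tgt: 'o)

definition prod_category ::
    "('o, 'm) cat \<Rightarrow> ('p, 'n) cat \<Rightarrow> ('o \<times> 'p, 'm \<times> 'n) cat" where
  "prod_category C D =
    \<lparr>Obj = Obj C \<times> Obj D,
     Arr = Arr C \<times> Arr D,
     Dom = map_prod (Dom C) (Dom D),
     Cod = map_prod (Cod C) (Cod D),
     Id = map_prod (Id C) (Id D),
     Comp = (\<lambda>(g, g') (f, f'). (Comp C g f, Comp D g' f'))\<rparr>"

definition full_subcategory :: "('o, 'm) cat \<Rightarrow> 'o set \<Rightarrow> ('o, 'm) cat" where
  "full_subcategory C S =
    C\<lparr>Obj := Obj C \<inter> S, Arr := {f \<in> Arr C. Dom C f \<in> S \<and> Cod C f \<in> S}\<rparr>"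

definition is_iso :: "('o, 'm) cat \<Rightarrow> 'm \<Rightarrow> bool" where
  "is_iso C f \<longleftrightarrow> f \<in> Arr C \<and>
    (\<exists>g \<in> arrows C (Cod C f) (Dom C f).
      Comp C g f = Id C (Dom C f) \<and> Comp C f g = Id C (Cod C f))"

definition is_epi :: "('o, 'm) cat \<Rightarrow> 'm \<Rightarrow> bool" where
  "is_epi C f \<longleftrightarrow> f \<in> Arr C \<and>
    (\<forall>T. \<forall>g \<in> arrows C (Cod C f) T. \<forall>h \<in> arrows C (Cod C f) T.
      Comp C g f = Comp C h f \<longrightarrow> g = h)"

text \<open>
  \<open>is_pullback C p q f g\<close> states that the square with \<open>f \<circ> p = g \<circ> q\<close> is cartesian.
\<close>

definition is_pullback :: "('o, 'm) cat \<Rightarrow> 'm \<Rightarrow> 'm \<Rightarrow> 'm \<Rightarrow> 'm \<Rightarrow> bool" where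
  "is_pullback C p q f g \<longleftrightarrow>
    p \<in> Arr C \<and> q \<in> Arr C \<and> f \<in> Arr C \<and> g \<in> Arr C \<and>
    Dom C p = Dom C q \<and> Cod C p = Dom C f \<and> Cod C q = Dom C g \<and> Cod C f = Cod C g \<and>
    Comp C f p = Comp C g q \<and>
    (\<forall>T. \<forall>u \<in> arrows C T (Dom C f). \<forall>v \<in> arrows C T (Dom C g).
      Comp C f u = Comp C g v \<longrightarrow>
        (\<exists>!h. h \<in> arrows C T (Dom C p) \<and> Comp C p h = u \<and> Comp C q h = v))"

definition has_pullbacks :: "('o, 'm) cat \<Rightarrow> bool" where
  "has_pullbacks C \<longleftrightarrow>
    (\<forall>f \<in> Arr C. \<forall>g \<in> Arr C. Cod C f = Cod C g \<longrightarrow> (\<exists>p q. is_pullback C p q f g))"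

definition is_coproduct ::
    "('o, 'm) cat \<Rightarrow> 'i set \<Rightarrow> ('i \<Rightarrow> 'o) \<Rightarrow> 'o \<Rightarrow> ('i \<Rightarrow> 'm) \<Rightarrow> bool" where
  "is_coproduct C I X S \<iota> \<longleftrightarrow>
    S \<in> Obj C \<and> (\<forall>i \<in> I. X i \<in> Obj C \<and> \<iota> i \<in> arrows C (X i) S) \<and>
    (\<forall>T \<in> Obj C. \<forall>u. (\<forall>i \<in> I. u i \<in> arrows C (X i) T) \<longrightarrow>
      (\<exists>!h. h \<in> arrows C S T \<and> (\<forall>i \<in> I. Comp C h (\<iota> i) = u i)))"

text \<open>
  Finite families, including the empty one, are indexed by finite subsets of \<^typ>\<open>nat\<close>.
\<close>

definition has_finite_coproducts :: "('o, 'm) cat \<Rightarrow> bool" where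
  "has_finite_coproducts C \<longleftrightarrow>
    (\<forall>I :: nat set. \<forall>X. finite I \<and> X \<in> I \<rightarrow> Obj C \<longrightarrow> (\<exists>S \<iota>. is_coproduct C I X S \<iota>))"


section \<open>Functors and natural transformations\<close>

record ('o, 'm, 'p, 'n) ftor =
  OMap :: "'o \<Rightarrow> 'p"
  AMap :: "'m \<Rightarrow> 'n"

text \<open>
  The two maps of a functor, and the components of a natural transformation, are extensional
  functions. Equality in HOL is therefore the usual equality of functors and of natural
  transformations, and these can serve as objects and arrows of functor categories.
\<close>

definition is_functor ::
    "('o, 'm) cat \<Rightarrow> ('p, 'n) cat \<Rightarrow> ('o, 'm, 'p, 'n) ftor \<Rightarrow> bool" where
  "is_functor C D F \<longleftrightarrow>
    category C \<and> category D \<and>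
    OMap F \<in> Obj C \<rightarrow>\<^sub>E Obj D \<and> AMap F \<in> Arr C \<rightarrow>\<^sub>E Arr D \<and>
    (\<forall>f \<in> Arr C. Dom D (AMap F f) = OMap F (Dom C f) \<and> Cod D (AMap F f) = OMap F (Cod C f)) \<and>
    (\<forall>A \<in> Obj C. AMap F (Id C A) = Id D (OMap F A)) \<and>
    (\<forall>f \<in> Arr C. \<forall>g \<in> Arr C. Cod C f = Dom C g \<longrightarrow>
      AMap F (Comp C g f) = Comp D (AMap F g) (AMap F f))"

definition id_functor :: "('o, 'm) cat \<Rightarrow> ('o, 'm, 'o, 'm) ftor" where
  "id_functor C = \<lparr>OMap = (\<lambda>A \<in> Obj C. A), AMap = (\<lambda>f \<in> Arr C. f)\<rparr>"

definition comp_functor ::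
    "('o, 'm) cat \<Rightarrow> ('p, 'n, 'q, 'k) ftor \<Rightarrow> ('o, 'm, 'p, 'n) ftor \<Rightarrow> ('o, 'm, 'q, 'k) ftor" where
  "comp_functor C G F =
    \<lparr>OMap = compose (Obj C) (OMap G) (OMap F), AMap = compose (Arr C) (AMap G) (AMap F)\<rparr>"

definition nat_trans ::
    "('o, 'm) cat \<Rightarrow> ('p, 'n) cat \<Rightarrow> ('o, 'm, 'p, 'n) ftor \<Rightarrow> ('o, 'm, 'p, 'n) ftor \<Rightarrow>
      ('o \<Rightarrow> 'n) \<Rightarrow> bool" where
  "nat_trans C D F G \<eta> \<longleftrightarrow>
    is_functor C D F \<and> is_functor C D G \<and>
    \<eta> \<in> (\<Pi>\<^sub>E A \<in> Obj C. arrows D (OMap F A) (OMap G A)) \<and>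
    (\<forall>f \<in> Arr C. Comp D (\<eta> (Cod C f)) (AMap F f) = Comp D (AMap G f) (\<eta> (Dom C f)))"

definition nat_isomorphic ::
    "('o, 'm) cat \<Rightarrow> ('p, 'n) cat \<Rightarrow> ('o, 'm, 'p, 'n) ftor \<Rightarrow> ('o, 'm, 'p, 'n) ftor \<Rightarrow>
      bool" where
  "nat_isomorphic C D F G \<longleftrightarrow>
    (\<exists>\<eta>. nat_trans C D F G \<eta> \<and> (\<forall>A \<in> Obj C. is_iso D (\<eta> A)))"

definition is_equivalence ::
    "('o, 'm) cat \<Rightarrow> ('p, 'n) cat \<Rightarrow> ('o, 'm, 'p, 'n) ftor \<Rightarrow> bool" where
  "is_equivalence C D F \<longleftrightarrow>
    is_functor C D F \<and>
    (\<exists>G. is_functor D C G \<and>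
      nat_isomorphic C C (comp_functor C G F) (id_functor C) \<and>
      nat_isomorphic D D (comp_functor D F G) (id_functor D))"

type_synonym ('o, 'm, 'p, 'n) fun_arrow = "(('o, 'm, 'p, 'n) ftor, 'o \<Rightarrow> 'n) arrow"

definition functor_category ::
    "('o, 'm) cat \<Rightarrow> ('p, 'n) cat \<Rightarrow>
      (('o, 'm, 'p, 'n) ftor, ('o, 'm, 'p, 'n) fun_arrow) cat" where
  "functor_category C D =
    \<lparr>Obj = {F. is_functor C D F},
     Arr = {\<alpha>. nat_trans C D (src \<alpha>) (tgt \<alpha>) (mor \<alpha>)},
     Dom = src,
     Cod = tgt,
     Id = (\<lambda>F. Arrow F (\<lambda>A \<in> Obj C. Id D (OMap F A)) F),
     Comp = (\<lambda>\<beta> \<alpha>. Arrow (src \<alpha>) (\<lambda>A \<in> Obj C. Comp D (mor \<beta> A) (mor \<alpha> A)) (tgt \<beta>))\<rparr>"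

definition preserves_pullbacks ::
    "('o, 'm) cat \<Rightarrow> ('p, 'n) cat \<Rightarrow> ('o, 'm, 'p, 'n) ftor \<Rightarrow> bool" where
  "preserves_pullbacks C D F \<longleftrightarrow>
    (\<forall>p q f g. is_pullback C p q f g \<longrightarrow>
      is_pullback D (AMap F p) (AMap F q) (AMap F f) (AMap F g))"

definition preserves_finite_coproducts ::
    "('o, 'm) cat \<Rightarrow> ('p, 'n) cat \<Rightarrow> ('o, 'm, 'p, 'n) ftor \<Rightarrow> bool" where
  "preserves_finite_coproducts C D F \<longleftrightarrow>
    (\<forall>I :: nat set. \<forall>X S \<iota>. finite I \<and> is_coproduct C I X S \<iota> \<longrightarrow>
      is_coproduct D I (\<lambda>i. OMap F (X i)) (OMap F S) (\<lambda>i. AMap F (\<iota> i)))"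

definition preserves_epis ::
    "('o, 'm) cat \<Rightarrow> ('p, 'n) cat \<Rightarrow> ('o, 'm, 'p, 'n) ftor \<Rightarrow> bool" where
  "preserves_epis C D F \<longleftrightarrow> (\<forall>f. is_epi C f \<longrightarrow> is_epi D (AMap F f))"

definition pce_functor ::
    "('o, 'm) cat \<Rightarrow> ('p, 'n) cat \<Rightarrow> ('o, 'm, 'p, 'n) ftor \<Rightarrow> bool" where
  "pce_functor C D F \<longleftrightarrow>
    is_functor C D F \<and> preserves_pullbacks C D F \<and> preserves_finite_coproducts C D F \<and>
    preserves_epis C D F"

definition Fun_pce ::
    "('o, 'm) cat \<Rightarrow> ('p, 'n) cat \<Rightarrow>
      (('o, 'm, 'p, 'n) ftor, ('o, 'm, 'p, 'n) fun_arrow) cat" where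
  "Fun_pce C D = full_subcategory (functor_category C D) {F. pce_functor C D F}"


section \<open>Finite sets and perfect pairings\<close>

text \<open>
  The finite subsets of a type \<^typ>\<open>'a\<close>, with all maps between them. For infinite \<^typ>\<open>'a\<close>
  every finite set is in bijection with an object, so this is a small model of the category of
  finite sets.
\<close>

definition Fin_cat :: "('a set, ('a set, 'a \<Rightarrow> 'a) arrow) cat" where
  "Fin_cat =
    \<lparr>Obj = {X. finite X},
     Arr = {f. finite (src f) \<and> finite (tgt f) \<and> mor f \<in> src f \<rightarrow>\<^sub>E tgt f},
     Dom = src,
     Cod = tgt,
     Id = (\<lambda>X. Arrow X (\<lambda>x \<in> X. x) X),
     Comp = (\<lambda>g f. Arrow (src f) (compose (src f) (mor g) (mor f)) (tgt g))\<rparr>"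

text \<open>
  For a functor \<open>F\<close> on \<open>C \<times> D\<close>: the functors \<open>F(c, -)\<close> and \<open>F(-, d)\<close>, and the two induced
  functors \<open>c \<mapsto> F(c, -)\<close> and \<open>d \<mapsto> F(-, d)\<close>.
\<close>

definition fix_left ::
    "('o, 'm) cat \<Rightarrow> ('p, 'n) cat \<Rightarrow> ('o \<times> 'p, 'm \<times> 'n, 'q, 'k) ftor \<Rightarrow> 'o \<Rightarrow>
      ('p, 'n, 'q, 'k) ftor" where
  "fix_left C D F c =
    \<lparr>OMap = (\<lambda>d \<in> Obj D. OMap F (c, d)), AMap = (\<lambda>g \<in> Arr D. AMap F (Id C c, g))\<rparr>"

definition fix_right ::
    "('o, 'm) cat \<Rightarrow> ('p, 'n) cat \<Rightarrow> ('o \<times> 'p, 'm \<times> 'n, 'q, 'k) ftor \<Rightarrow> 'p \<Rightarrow>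
      ('o, 'm, 'q, 'k) ftor" where
  "fix_right C D F d =
    \<lparr>OMap = (\<lambda>c \<in> Obj C. OMap F (c, d)), AMap = (\<lambda>f \<in> Arr C. AMap F (f, Id D d))\<rparr>"

definition curry_left ::
    "('o, 'm) cat \<Rightarrow> ('p, 'n) cat \<Rightarrow> ('o \<times> 'p, 'm \<times> 'n, 'q, 'k) ftor \<Rightarrow>
      ('o, 'm, ('p, 'n, 'q, 'k) ftor, ('p, 'n, 'q, 'k) fun_arrow) ftor" where
  "curry_left C D F =
    \<lparr>OMap = (\<lambda>c \<in> Obj C. fix_left C D F c),
     AMap = (\<lambda>f \<in> Arr C.
       Arrow (fix_left C D F (Dom C f))
         (\<lambda>d \<in> Obj D. AMap F (f, Id D d))
         (fix_left C D F (Cod C f)))\<rparr>"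

definition curry_right ::
    "('o, 'm) cat \<Rightarrow> ('p, 'n) cat \<Rightarrow> ('o \<times> 'p, 'm \<times> 'n, 'q, 'k) ftor \<Rightarrow>
      ('p, 'n, ('o, 'm, 'q, 'k) ftor, ('o, 'm, 'q, 'k) fun_arrow) ftor" where
  "curry_right C D F =
    \<lparr>OMap = (\<lambda>d \<in> Obj D. fix_right C D F d),
     AMap = (\<lambda>g \<in> Arr D.
       Arrow (fix_right C D F (Dom D g))
         (\<lambda>c \<in> Obj C. AMap F (Id C c, g))
         (fix_right C D F (Cod D g)))\<rparr>"

text \<open>
  The conjuncts on pullbacks and finite coproducts are the standing assumptions under which
  \<^const>\<open>Fun_pce\<close> is considered. For \<^const>\<open>Fin_cat\<close> the one on coproducts excludes
  target categories over a finite type.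
\<close>

definition perfect_pairing ::
    "('o, 'm) cat \<Rightarrow> ('p, 'n) cat \<Rightarrow>
      ('o \<times> 'p, 'm \<times> 'n, 'c set, ('c set, 'c \<Rightarrow> 'c) arrow) ftor \<Rightarrow> bool" where
  "perfect_pairing C D F \<longleftrightarrow>
    has_pullbacks C \<and> has_finite_coproducts C \<and>
    has_pullbacks D \<and> has_finite_coproducts D \<and>
    has_pullbacks (Fin_cat :: ('c set, ('c set, 'c \<Rightarrow> 'c) arrow) cat) \<and>
    has_finite_coproducts (Fin_cat :: ('c set, ('c set, 'c \<Rightarrow> 'c) arrow) cat) \<and>
    category C \<and> category D \<and>
    is_functor (prod_category C D) Fin_cat F \<and>
    (\<forall>c \<in> Obj C. pce_functor D Fin_cat (fix_left C D F c)) \<and>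
    (\<forall>d \<in> Obj D. pce_functor C Fin_cat (fix_right C D F d)) \<and>
    is_equivalence C (Fun_pce D Fin_cat) (curry_left C D F) \<and>
    is_equivalence D (Fun_pce C Fin_cat) (curry_right C D F)"


section \<open>Finite \<open>G\<close>-sets and the balanced product\<close>

record ('g, 'a) gset =
  points :: "'a set"
  act :: "'g \<Rightarrow> 'a \<Rightarrow> 'a"

definition opposite_group :: "('g, 'z) monoid_scheme \<Rightarrow> ('g, 'z) monoid_scheme" where
  "opposite_group G = G\<lparr>mult := (\<lambda>g h. h \<otimes>\<^bsub>G\<^esub> g)\<rparr>"

text \<open>
  The value \<open>act Y g y\<close> stands for \<open>g y\<close> if \<open>Y\<close> is a left \<open>G\<close>-set and for \<open>y g\<close> if \<open>Y\<close> is a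
  right \<open>G\<close>-set. A right \<open>G\<close>-set is a left action of the opposite group, that is,
  \<open>act X (g h) x = act X h (act X g x)\<close>. The action is extensional in the group element; that
  it is extensional in the point is part of \<^const>\<open>group_action\<close>.
\<close>

definition left_gset :: "('g, 'z) monoid_scheme \<Rightarrow> ('g, 'a) gset \<Rightarrow> bool" where
  "left_gset G Y \<longleftrightarrow> group_action G (points Y) (act Y) \<and> act Y \<in> extensional (carrier G)"

definition right_gset :: "('g, 'z) monoid_scheme \<Rightarrow> ('g, 'a) gset \<Rightarrow> bool" where
  "right_gset G X \<longleftrightarrow>
    group_action (opposite_group G) (points X) (act X) \<and> act X \<in> extensional (carrier G)"

definition free_gset :: "('g, 'z) monoid_scheme \<Rightarrow> ('g, 'a) gset \<Rightarrow> bool" where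
  "free_gset G Y \<longleftrightarrow> (\<forall>y \<in> points Y. stabilizer G (act Y) y = {\<one>\<^bsub>G\<^esub>})"

definition equivariant ::
    "('g, 'z) monoid_scheme \<Rightarrow> ('g, 'a) gset \<Rightarrow> ('g, 'a) gset \<Rightarrow> ('a \<Rightarrow> 'a) \<Rightarrow> bool" where
  "equivariant G X Y f \<longleftrightarrow>
    (\<forall>g \<in> carrier G. \<forall>x \<in> points X. f (act X g x) = act Y g (f x))"

type_synonym ('g, 'a) gset_arrow = "(('g, 'a) gset, 'a \<Rightarrow> 'a) arrow"

text \<open>The category of all \<open>G\<close>-sets in a given class, with equivariant maps.\<close>

definition gset_category ::
    "('g, 'z) monoid_scheme \<Rightarrow> ('g, 'a) gset set \<Rightarrow> (('g, 'a) gset, ('g, 'a) gset_arrow) cat" where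
  "gset_category G S =
    \<lparr>Obj = S,
     Arr = {f. src f \<in> S \<and> tgt f \<in> S \<and>
       mor f \<in> points (src f) \<rightarrow>\<^sub>E points (tgt f) \<and> equivariant G (src f) (tgt f) (mor f)},
     Dom = src,
     Cod = tgt,
     Id = (\<lambda>X. Arrow X (\<lambda>x \<in> points X. x) X),
     Comp = (\<lambda>g f. Arrow (src f) (compose (points (src f)) (mor g) (mor f)) (tgt g))\<rparr>"

definition Fin_right ::
    "('g, 'z) monoid_scheme \<Rightarrow> (('g, 'a) gset, ('g, 'a) gset_arrow) cat" where
  "Fin_right G = gset_category G {X. finite (points X) \<and> right_gset G X}"

definition Fin_free_left ::
    "('g, 'z) monoid_scheme \<Rightarrow> (('g, 'a) gset, ('g, 'a) gset_arrow) cat" where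
  "Fin_free_left G =
    gset_category G {Y. finite (points Y) \<and> left_gset G Y \<and> free_gset G Y}"

text \<open>The relation \<open>(x g, y) \<sim> (x, g y)\<close>, which is already an equivalence relation (see below).\<close>

definition balanced_rel ::
    "('g, 'z) monoid_scheme \<Rightarrow> ('g, 'a) gset \<Rightarrow> ('g, 'b) gset \<Rightarrow> (('a \<times> 'b) \<times> ('a \<times> 'b)) set" where
  "balanced_rel G X Y =
    {((act X g x, y), (x, act Y g y)) | x g y. x \<in> points X \<and> g \<in> carrier G \<and> y \<in> points Y}"

definition balanced_prod ::
    "('g, 'z) monoid_scheme \<Rightarrow> ('g, 'a) gset \<Rightarrow> ('g, 'b) gset \<Rightarrow> ('a \<times> 'b) set set" where
  "balanced_prod G X Y = (points X \<times> points Y) // balanced_rel G X Y"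

text \<open>
  On arrows the functor sends the class of \<open>(x, y)\<close> to the class of \<open>(f x, h y)\<close>; the latter is
  obtained as the saturation of the image of the former.
\<close>

definition balanced_map ::
    "('g, 'z) monoid_scheme \<Rightarrow> ('g, 'a) gset_arrow \<Rightarrow> ('g, 'b) gset_arrow \<Rightarrow>
      ('a \<times> 'b) set \<Rightarrow> ('a \<times> 'b) set" where
  "balanced_map G f h =
    (\<lambda>c \<in> balanced_prod G (src f) (src h).
      balanced_rel G (tgt f) (tgt h) `` (map_prod (mor f) (mor h) ` c))"

definition balanced_prod_functor ::
    "('g, 'z) monoid_scheme \<Rightarrow>
      (('g, 'a) gset \<times> ('g, 'b) gset, ('g, 'a) gset_arrow \<times> ('g, 'b) gset_arrow,
       ('a \<times> 'b) set set, (('a \<times> 'b) set set, ('a \<times> 'b) set \<Rightarrow> ('a \<times> 'b) set) arrow) ftor" where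
  "balanced_prod_functor G =
    \<lparr>OMap = (\<lambda>(X, Y) \<in> Obj (prod_category (Fin_right G) (Fin_free_left G)).
       balanced_prod G X Y),
     AMap = (\<lambda>(f, h) \<in> Arr (prod_category (Fin_right G) (Fin_free_left G)).
       Arrow (balanced_prod G (src f) (src h))
         (balanced_map G f h)
         (balanced_prod G (tgt f) (tgt h)))\<rparr>"

lemma left_gset_simps:
  assumes "left_gset G Y" "y \<in> points Y"
  shows "act Y \<one>\<^bsub>G\<^esub> y = y"
    and "g \<in> carrier G \<Longrightarrow> act Y g y \<in> points Y"
    and "g \<in> carrier G \<Longrightarrow> h \<in> carrier G \<Longrightarrow> act Y (g \<otimes>\<^bsub>G\<^esub> h) y = act Y g (act Y h y)"
proof -
  interpret group_action G "points Y" "act Y"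
    using assms(1) by (simp add: left_gset_def)
  show "act Y \<one>\<^bsub>G\<^esub> y = y"
    using id_eq_one assms(2) by (metis restrict_apply)
  show "act Y g y \<in> points Y" if "g \<in> carrier G"
    using that assms(2) surj_prop by blast
  show "act Y (g \<otimes>\<^bsub>G\<^esub> h) y = act Y g (act Y h y)" if "g \<in> carrier G" "h \<in> carrier G"
    using that assms(2) composition_rule by blast
qed

lemma right_gset_simps:
  assumes "right_gset G X" "x \<in> points X"
  shows "act X \<one>\<^bsub>G\<^esub> x = x"
    and "g \<in> carrier G \<Longrightarrow> act X g x \<in> points X"
    and "g \<in> carrier G \<Longrightarrow> h \<in> carrier G \<Longrightarrow> act X (g \<otimes>\<^bsub>G\<^esub> h) x = act X h (act X g x)"
proof -
  have *: "left_gset (opposite_group G) X"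
    using assms(1) by (simp add: left_gset_def right_gset_def opposite_group_def)
  show "act X \<one>\<^bsub>G\<^esub> x = x"
    using left_gset_simps(1)[OF * assms(2)] by (simp add: opposite_group_def)
  show "act X g x \<in> points X" if "g \<in> carrier G"
    using left_gset_simps(2)[OF * assms(2)] that by (simp add: opposite_group_def)
  show "act X (g \<otimes>\<^bsub>G\<^esub> h) x = act X h (act X g x)" if "g \<in> carrier G" "h \<in> carrier G"
    using left_gset_simps(3)[OF * assms(2), of h g] that by (simp add: opposite_group_def)
qed

lemma balanced_rel_iff:
  assumes "group G" "right_gset G X" "left_gset G Y"
  shows "(p, q) \<in> balanced_rel G X Y \<longleftrightarrow>
    p \<in> points X \<times> points Y \<and>
    (\<exists>g \<in> carrier G. q = (act X (inv\<^bsub>G\<^esub> g) (fst p), act Y g (snd p)))" (is "?L \<longleftrightarrow> ?R")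
proof -
  interpret group G by fact
  note s = left_gset_simps[OF assms(3)] right_gset_simps[OF assms(2)]
  show ?thesis
  proof
    assume ?L
    then obtain x g y where *: "p = (act X g x, y)" "q = (x, act Y g y)"
      "x \<in> points X" "g \<in> carrier G" "y \<in> points Y"
      by (auto simp: balanced_rel_def)
    have "act X (inv\<^bsub>G\<^esub> g) (act X g x) = x"
      using * s(4) s(6)[of x g "inv\<^bsub>G\<^esub> g"] by simp
    then show ?R
      using * s(5)[of x g] by (intro conjI bexI[of _ g]) auto
  next
    assume ?R
    then obtain g where *: "p \<in> points X \<times> points Y" "g \<in> carrier G"
      "q = (act X (inv\<^bsub>G\<^esub> g) (fst p), act Y g (snd p))" by auto
    have "act X g (act X (inv\<^bsub>G\<^esub> g) (fst p)) = fst p"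
      using * s(4)[of "fst p"] s(6)[of "fst p" "inv\<^bsub>G\<^esub> g" g] by auto
    then have "p = (act X g (act X (inv\<^bsub>G\<^esub> g) (fst p)), snd p)" by simp
    then show ?L
      using * s(5)[of "fst p" "inv\<^bsub>G\<^esub> g"] unfolding balanced_rel_def by fastforce
  qed
qed

lemma equiv_balanced_rel:
  assumes "group G" "right_gset G X" "left_gset G Y"
  shows "equiv (points X \<times> points Y) (balanced_rel G X Y)"
proof -
  interpret group G by fact
  note s = left_gset_simps[OF assms(3)] right_gset_simps[OF assms(2)]
  note iff = balanced_rel_iff[OF assms]
  show ?thesis
  proof (rule equivI)
    show "balanced_rel G X Y \<subseteq> (points X \<times> points Y) \<times> (points X \<times> points Y)"
      using s by (auto simp: balanced_rel_def)
    show "refl_on (points X \<times> points Y) (balanced_rel G X Y)"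
    proof (rule refl_onI)
      fix p assume "p \<in> points X \<times> points Y"
      then show "(p, p) \<in> balanced_rel G X Y"
        using s unfolding iff by (intro conjI bexI[of _ "\<one>\<^bsub>G\<^esub>"]) auto
    qed
    show "sym (balanced_rel G X Y)"
    proof (rule symI)
      fix p q assume "(p, q) \<in> balanced_rel G X Y"
      then obtain g where *: "p \<in> points X \<times> points Y" "g \<in> carrier G"
        "q = (act X (inv\<^bsub>G\<^esub> g) (fst p), act Y g (snd p))" unfolding iff by auto
      have "act X g (act X (inv\<^bsub>G\<^esub> g) (fst p)) = fst p"
        using * s(4)[of "fst p"] s(6)[of "fst p" "inv\<^bsub>G\<^esub> g" g] by auto
      moreover have "act Y (inv\<^bsub>G\<^esub> g) (act Y g (snd p)) = snd p"
        using * s(1)[of "snd p"] s(3)[of "snd p" "inv\<^bsub>G\<^esub> g" g] by auto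
      ultimately show "(q, p) \<in> balanced_rel G X Y"
        using * s unfolding iff by (intro conjI bexI[of _ "inv\<^bsub>G\<^esub> g"]) auto
    qed
    show "trans (balanced_rel G X Y)"
    proof (rule transI)
      fix p q r assume a: "(p, q) \<in> balanced_rel G X Y" "(q, r) \<in> balanced_rel G X Y"
      then obtain g h where *: "p \<in> points X \<times> points Y" "g \<in> carrier G" "h \<in> carrier G"
        "q = (act X (inv\<^bsub>G\<^esub> g) (fst p), act Y g (snd p))"
        "r = (act X (inv\<^bsub>G\<^esub> h) (fst q), act Y h (snd q))" unfolding iff by auto
      then have "r = (act X (inv\<^bsub>G\<^esub> (h \<otimes>\<^bsub>G\<^esub> g)) (fst p), act Y (h \<otimes>\<^bsub>G\<^esub> g) (snd p))"
        using s by (auto simp: inv_mult_group)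
      then show "(p, r) \<in> balanced_rel G X Y"
        using * unfolding iff by (intro conjI bexI[of _ "h \<otimes>\<^bsub>G\<^esub> g"]) auto
    qed
  qed
qed

end

theory Submission
  imports Defs
begin

text \<open>
  Both halves of the perfect pairing are one and the same theorem. A right \<open>G\<close>-set is a left action
  of the opposite group, so each of the two categories consists of finite left \<open>H\<close>-sets, either all
  of them or only the free ones. Exchanging the two variables replaces \<open>H\<close> by the opposite group and
  exchanges ``all'' with ``free''. The locale \<open>gset_model\<close> describes such a category, with a boolean
  \<open>r\<close> for freeness, and \<open>tensor_pairing\<close> describes a bifunctor \<open>X \<otimes> Y\<close> on two of them which behaves
  like the balanced product. The theorem \<open>curry_equivalence\<close> is proved in that locale and used
  twice, once for the balanced product and once for the balanced product with its arguments swapped.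
  The category of finite sets is itself a \<open>gset_model\<close>, for the trivial group, and this gives
  pullbacks, coproducts and epimorphisms in all three categories at once.

  The tool throughout is the regular \<open>H\<close>-set \<open>R\<close>, with base point \<open>e\<close>. Equivariant maps \<open>R \<rightarrow> X\<close>
  correspond to points of \<open>X\<close>; write \<open>ev x\<close> for the map with \<open>e \<mapsto> x\<close>. Testing universal
  properties with \<open>R\<close> and comparing with explicit constructions shows that squares are pullbacks,
  cocones are coproducts and maps are epimorphisms exactly when they are so on points
  (\<open>is_pullbackI\<close>, \<open>is_pullbackE\<close>, \<open>is_coproductI\<close>, \<open>is_coproduct_bij\<close>, \<open>is_epiI\<close>, \<open>is_epi_surj\<close>).
  A computation with tensors \<open>x \<otimes> y\<close> then shows that \<open>X \<otimes> -\<close> preserves all three. For pullbacks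
  it needs that a group element is determined by how it moves a pair of points, and this holds
  because in one of the two variables all objects are free.

  The functor \<open>X \<mapsto> X \<otimes> -\<close> is fully faithful because \<open>x \<mapsto> x \<otimes> e\<close> identifies \<open>X\<close> with \<open>X \<otimes> R\<close>:
  a natural transformation is determined by its component at \<open>R\<close>, and naturality for the right
  multiplications of \<open>R\<close> makes that component equivariant.

  It is essentially surjective for the following reason. Let \<open>F\<close> preserve pullbacks, finite
  coproducts and epimorphisms. The right multiplications of \<open>R\<close> make \<open>U = F R\<close> a set with an action
  of the opposite group, and \<open>u \<otimes> y \<mapsto> F (ev y) u\<close> is a natural map \<open>U \<otimes> Y \<rightarrow> F Y\<close>. It is onto,
  since \<open>Y\<close> is a quotient of a finite sum of copies of \<open>R\<close> and \<open>F\<close> preserves sums and epimorphisms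
  (\<open>elements\<close>). It is injective: if \<open>F (ev y) t = F (ev y') t'\<close>, then \<open>t\<close> and \<open>t'\<close> come from an
  element of \<open>F E\<close>, where \<open>E\<close> is the pullback of \<open>ev y\<close> and \<open>ev y'\<close>, and surjectivity for
  \<open>E\<close> exhibits \<open>t\<close> and \<open>t'\<close> as translates of one element of \<open>U\<close> (\<open>eq_translates\<close>). If \<open>F\<close> is defined
  on all \<open>H\<close>-sets, then \<open>U\<close> must moreover be free, which follows by applying the same facts
  to \<open>R \<times> R\<close> (\<open>rmul_free\<close>).
\<close>

section \<open>Equivalences and functor categories\<close>

context category
begin

declare Dom_in_Obj [simp] Cod_in_Obj [simp]

lemma seq_simps [simp]:
  assumes "f \<in> Arr C" "g \<in> Arr C" "Cod C f = Dom C g"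
  shows "Comp C g f \<in> Arr C" "Dom C (Comp C g f) = Dom C f" "Cod C (Comp C g f) = Cod C g"
  using Comp_in_arrows[of f "Dom C f" "Cod C f" g "Cod C g"] assms
  by (auto simp: arrows_def)

lemma Id_simps [simp]:
  assumes "A \<in> Obj C"
  shows "Id C A \<in> Arr C" "Dom C (Id C A) = A" "Cod C (Id C A) = A"
  using Id_in_arrows[OF assms] by (auto simp: arrows_def)

lemma Comp_Id_simps [simp]:
  assumes "f \<in> Arr C"
  shows "Dom C f = A \<Longrightarrow> Comp C f (Id C A) = f" "Cod C f = B \<Longrightarrow> Comp C (Id C B) f = f"
  using Comp_Id Id_Comp assms by (auto simp: arrows_def)

lemma assoc:
  assumes "f \<in> Arr C" "g \<in> Arr C" "h \<in> Arr C" "Cod C f = Dom C g" "Cod C g = Dom C h"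
  shows "Comp C (Comp C h g) f = Comp C h (Comp C g f)"
  using Comp_assoc[of f "Dom C f" "Dom C g" g "Dom C h" h "Cod C h"] assms
  by (auto simp: arrows_def)

text \<open>
  Composition is rewritten to the right-nested form by \<open>assoc\<close>; this is how an inverse pair at the
  head of such a composite is removed.
\<close>

lemma cancel_left:
  assumes "Comp C i j = Id C B" "i \<in> Arr C" "j \<in> Arr C" "f \<in> Arr C"
    "Cod C f = Dom C j" "Cod C j = Dom C i" "Cod C f = B"
  shows "Comp C i (Comp C j f) = f"
  using assms assoc[of f j i] by simp

end

lemma is_functorD:
  assumes "is_functor C D F"
  shows "category C" "category D"
    and "OMap F \<in> Obj C \<rightarrow>\<^sub>E Obj D" "AMap F \<in> Arr C \<rightarrow>\<^sub>E Arr D"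
    and "A \<in> Obj C \<Longrightarrow> OMap F A \<in> Obj D"
    and "f \<in> Arr C \<Longrightarrow> AMap F f \<in> Arr D"
    and "f \<in> Arr C \<Longrightarrow> Dom D (AMap F f) = OMap F (Dom C f)"
    and "f \<in> Arr C \<Longrightarrow> Cod D (AMap F f) = OMap F (Cod C f)"
    and "A \<in> Obj C \<Longrightarrow> AMap F (Id C A) = Id D (OMap F A)"
    and "f \<in> Arr C \<Longrightarrow> g \<in> Arr C \<Longrightarrow> Cod C f = Dom C g \<Longrightarrow>
      AMap F (Comp C g f) = Comp D (AMap F g) (AMap F f)"
  using assms unfolding is_functor_def by (auto dest: PiE_mem)

lemma is_functor_arrows:
  assumes "is_functor C D F" "f \<in> arrows C A B"
  shows "AMap F f \<in> arrows D (OMap F A) (OMap F B)"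
  using assms(2) is_functorD[OF assms(1)] by (auto simp: arrows_def)

lemma is_functor_comp_functor:
  assumes F: "is_functor A B F" and G: "is_functor B C G"
  shows "is_functor A C (comp_functor A G F)"
proof -
  interpret A: category A using is_functorD(1)[OF F] .
  interpret B: category B using is_functorD(2)[OF F] .
  interpret C: category C using is_functorD(2)[OF G] .
  note s = is_functorD(5-)[OF F] is_functorD(5-)[OF G]
  show ?thesis
    unfolding is_functor_def comp_functor_def
    by (auto simp: compose_def s intro: A.category_axioms C.category_axioms)
qed

lemma is_functor_id_functor:
  assumes "category C"
  shows "is_functor C C (id_functor C)"
proof -
  interpret category C by fact
  show ?thesis
    unfolding is_functor_def id_functor_def by (auto intro: category_axioms)
qed

text \<open>
  A quasi-inverse chooses for every \<open>Y\<close> an object \<open>X Y\<close> with an isomorphism \<open>i Y : F (X Y) \<rightarrow> Y\<close> and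
  conjugates arrows with these. All required equations hold because they hold after applying \<open>F\<close>,
  which is injective on parallel arrows.
\<close>

theorem fully_faithful_essentially_surjective_imp_equivalence:
  assumes F: "is_functor C D F"
    and ff: "\<And>A B. A \<in> Obj C \<Longrightarrow> B \<in> Obj C \<Longrightarrow>
      bij_betw (AMap F) (arrows C A B) (arrows D (OMap F A) (OMap F B))"
    and es: "\<And>Y. Y \<in> Obj D \<Longrightarrow> \<exists>X \<in> Obj C. \<exists>i \<in> arrows D (OMap F X) Y. is_iso D i"
  shows "is_equivalence C D F"
proof -
  interpret C: category C using is_functorD(1)[OF F] .
  interpret D: category D using is_functorD(2)[OF F] .
  note [simp] = is_functorD(5-)[OF F]
  have "\<forall>Y \<in> Obj D. \<exists>X i j. X \<in> Obj C \<and> i \<in> arrows D (OMap F X) Y \<and> j \<in> arrows D Y (OMap F X) \<and>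
      Comp D j i = Id D (OMap F X) \<and> Comp D i j = Id D Y"
  proof
    fix Y assume Y: "Y \<in> Obj D"
    obtain X i where Xi: "X \<in> Obj C" "i \<in> arrows D (OMap F X) Y" "is_iso D i"
      using es[OF Y] by blast
    from Xi(2) have *: "Dom D i = OMap F X" "Cod D i = Y" by (simp_all add: arrows_def)
    from Xi(3) obtain j where "j \<in> arrows D Y (OMap F X)"
      "Comp D j i = Id D (OMap F X)" "Comp D i j = Id D Y"
      unfolding is_iso_def * by blast
    with Xi show "\<exists>X i j. X \<in> Obj C \<and> i \<in> arrows D (OMap F X) Y \<and> j \<in> arrows D Y (OMap F X) \<and>
      Comp D j i = Id D (OMap F X) \<and> Comp D i j = Id D Y" by blast
  qed
  then obtain X where "\<forall>Y \<in> Obj D. \<exists>i j. X Y \<in> Obj C \<and> i \<in> arrows D (OMap F (X Y)) Y \<and>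
      j \<in> arrows D Y (OMap F (X Y)) \<and>
      Comp D j i = Id D (OMap F (X Y)) \<and> Comp D i j = Id D Y"
    by (rule bchoice[THEN exE])
  then obtain i where "\<forall>Y \<in> Obj D. \<exists>j. X Y \<in> Obj C \<and> i Y \<in> arrows D (OMap F (X Y)) Y \<and>
      j \<in> arrows D Y (OMap F (X Y)) \<and>
      Comp D j (i Y) = Id D (OMap F (X Y)) \<and> Comp D (i Y) j = Id D Y"
    by (rule bchoice[THEN exE])
  then obtain j where Xij: "\<forall>Y \<in> Obj D. X Y \<in> Obj C \<and> i Y \<in> arrows D (OMap F (X Y)) Y \<and>
      j Y \<in> arrows D Y (OMap F (X Y)) \<and>
      Comp D (j Y) (i Y) = Id D (OMap F (X Y)) \<and> Comp D (i Y) (j Y) = Id D Y"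
    by (rule bchoice[THEN exE])
  have ij [simp]: "X Y \<in> Obj C"
    "i Y \<in> Arr D" "Dom D (i Y) = OMap F (X Y)" "Cod D (i Y) = Y"
    "j Y \<in> Arr D" "Cod D (j Y) = OMap F (X Y)" "Dom D (j Y) = Y"
    "Comp D (j Y) (i Y) = Id D (OMap F (X Y))" "Comp D (i Y) (j Y) = Id D Y"
    if "Y \<in> Obj D" for Y using bspec[OF Xij that] by (auto simp: arrows_def)
  have ij_cancel [simp]: "Comp D (i Y) (Comp D (j Y) f) = f"
    if "Y \<in> Obj D" "f \<in> Arr D" "Cod D f = Y" for Y f
    using that by (intro D.cancel_left) auto
  have ji_cancel [simp]: "Comp D (j Y) (Comp D (i Y) f) = f"
    if "Y \<in> Obj D" "f \<in> Arr D" "Cod D f = OMap F (X Y)" for Y f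
    using that by (intro D.cancel_left) auto
  define L where "L A B k = inv_into (arrows C A B) (AMap F) k" for A B k
  have L: "L A B k \<in> arrows C A B" "AMap F (L A B k) = k"
    if "A \<in> Obj C" "B \<in> Obj C" "k \<in> Arr D" "Dom D k = OMap F A" "Cod D k = OMap F B" for A B k
  proof -
    have "k \<in> AMap F ` arrows C A B"
      using ff[OF that(1,2)] that by (auto simp: bij_betw_def arrows_def)
    then show "L A B k \<in> arrows C A B" "AMap F (L A B k) = k"
      unfolding L_def by (simp_all add: inv_into_into f_inv_into_f)
  qed
  have L' [simp]: "L A B k \<in> Arr C" "Dom C (L A B k) = A" "Cod C (L A B k) = B"
    "AMap F (L A B k) = k"
    if "A \<in> Obj C" "B \<in> Obj C" "k \<in> Arr D" "Dom D k = OMap F A" "Cod D k = OMap F B" for A B k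
    using L[OF that] by (auto simp: arrows_def)
  have faithful: "f = f'" if "f \<in> Arr C" "f' \<in> Arr C" "Dom C f = Dom C f'" "Cod C f = Cod C f'"
    "AMap F f = AMap F f'" for f f'
  proof -
    have "inj_on (AMap F) (arrows C (Dom C f') (Cod C f'))"
      using ff[of "Dom C f'" "Cod C f'"] that by (auto simp: bij_betw_def)
    then show ?thesis using that by (auto simp: inj_on_def arrows_def)
  qed
  define G where "G = \<lparr>OMap = (\<lambda>Y \<in> Obj D. X Y),
    AMap = (\<lambda>k \<in> Arr D. L (X (Dom D k)) (X (Cod D k)) (Comp D (j (Cod D k)) (Comp D k (i (Dom D k)))))\<rparr>"
  have G_simps [simp]: "Y \<in> Obj D \<Longrightarrow> OMap G Y = X Y"
    "k \<in> Arr D \<Longrightarrow>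
      AMap G k = L (X (Dom D k)) (X (Cod D k)) (Comp D (j (Cod D k)) (Comp D k (i (Dom D k))))"
    for Y k by (simp_all add: G_def)
  have G: "is_functor D C G"
    unfolding is_functor_def
  proof (intro conjI ballI impI)
    show "OMap G \<in> Obj D \<rightarrow>\<^sub>E Obj C" "AMap G \<in> Arr D \<rightarrow>\<^sub>E Arr C" by (auto simp: G_def)
    fix A assume A: "A \<in> Obj D"
    show "AMap G (Id D A) = Id C (OMap G A)" using A by (intro faithful) auto
  next
    fix f g assume "f \<in> Arr D" "g \<in> Arr D" "Cod D f = Dom D g"
    then show "AMap G (Comp D g f) = Comp C (AMap G g) (AMap G f)"
      by (intro faithful) (auto simp: D.assoc)
  qed (auto intro: C.category_axioms D.category_axioms)
  have 1: "nat_isomorphic C C (comp_functor C G F) (id_functor C)"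
    unfolding nat_isomorphic_def
  proof (intro exI conjI ballI)
    let ?\<eta> = "\<lambda>A \<in> Obj C. L (X (OMap F A)) A (i (OMap F A))"
    show "nat_trans C C (comp_functor C G F) (id_functor C) ?\<eta>"
      unfolding nat_trans_def
    proof (intro conjI ballI)
      show "?\<eta> \<in> (\<Pi>\<^sub>E A\<in>Obj C. arrows C (OMap (comp_functor C G F) A) (OMap (id_functor C) A))"
        by (auto simp: comp_functor_def id_functor_def compose_def intro!: L)
      fix f assume "f \<in> Arr C"
      then show "Comp C (?\<eta> (Cod C f)) (AMap (comp_functor C G F) f) =
         Comp C (AMap (id_functor C) f) (?\<eta> (Dom C f))"
        by (intro faithful) (auto simp: comp_functor_def id_functor_def compose_def)
    qed (rule is_functor_comp_functor[OF F G] is_functor_id_functor[OF C.category_axioms])+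
    fix A assume A: "A \<in> Obj C"
    then show "is_iso C (?\<eta> A)" unfolding is_iso_def
      by (intro conjI bexI[of _ "L A (X (OMap F A)) (j (OMap F A))"])
         (auto intro!: faithful simp: arrows_def)
  qed
  have 2: "nat_isomorphic D D (comp_functor D F G) (id_functor D)"
    unfolding nat_isomorphic_def
  proof (intro exI conjI ballI)
    let ?\<eta> = "\<lambda>A \<in> Obj D. i A"
    show "nat_trans D D (comp_functor D F G) (id_functor D) ?\<eta>"
      unfolding nat_trans_def
    proof (intro conjI ballI)
      show "?\<eta> \<in> (\<Pi>\<^sub>E A\<in>Obj D. arrows D (OMap (comp_functor D F G) A) (OMap (id_functor D) A))"
        by (auto simp: comp_functor_def id_functor_def compose_def arrows_def)
      fix f assume "f \<in> Arr D"
      then show "Comp D (?\<eta> (Cod D f)) (AMap (comp_functor D F G) f) =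
         Comp D (AMap (id_functor D) f) (?\<eta> (Dom D f))"
        by (auto simp: comp_functor_def id_functor_def compose_def)
    qed (rule is_functor_comp_functor[OF G F] is_functor_id_functor[OF D.category_axioms])+
    fix A assume A: "A \<in> Obj D"
    then show "is_iso D (?\<eta> A)" unfolding is_iso_def
      by (intro conjI bexI[of _ "j A"]) (auto simp: arrows_def)
  qed
  show ?thesis using F G 1 2 unfolding is_equivalence_def by blast
qed

lemma full_subcategory_simps [simp]:
  "Obj (full_subcategory C S) = Obj C \<inter> S"
  "Arr (full_subcategory C S) = {f \<in> Arr C. Dom C f \<in> S \<and> Cod C f \<in> S}"
  "Dom (full_subcategory C S) = Dom C" "Cod (full_subcategory C S) = Cod C"
  "Id (full_subcategory C S) = Id C" "Comp (full_subcategory C S) = Comp C"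
  by (simp_all add: full_subcategory_def)

lemma category_full_subcategory:
  assumes "category C"
  shows "category (full_subcategory C S)"
proof -
  interpret category C by fact
  show ?thesis
    by unfold_locales (auto simp: arrows_def assoc)
qed

lemma functor_category_simps [simp]:
  "Obj (functor_category C D) = {F. is_functor C D F}"
  "Arr (functor_category C D) = {\<alpha>. nat_trans C D (src \<alpha>) (tgt \<alpha>) (mor \<alpha>)}"
  "Dom (functor_category C D) = src" "Cod (functor_category C D) = tgt"
  "Id (functor_category C D) F = Arrow F (\<lambda>A \<in> Obj C. Id D (OMap F A)) F"
  "Comp (functor_category C D) \<beta> \<alpha> = Arrow (src \<alpha>) (\<lambda>A \<in> Obj C. Comp D (mor \<beta> A) (mor \<alpha> A)) (tgt \<beta>)"
  by (simp_all add: functor_category_def)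

lemma nat_transD:
  assumes "nat_trans C D F G \<eta>"
  shows "is_functor C D F" "is_functor C D G"
    and "A \<in> Obj C \<Longrightarrow> \<eta> A \<in> Arr D" "A \<in> Obj C \<Longrightarrow> Dom D (\<eta> A) = OMap F A"
    and "A \<in> Obj C \<Longrightarrow> Cod D (\<eta> A) = OMap G A"
    and "f \<in> Arr C \<Longrightarrow> Comp D (\<eta> (Cod C f)) (AMap F f) = Comp D (AMap G f) (\<eta> (Dom C f))"
    and "\<eta> \<in> extensional (Obj C)"
  using assms unfolding nat_trans_def
  by (auto dest: PiE_mem simp: arrows_def PiE_def Pi_def)

lemma nat_transI:
  assumes "is_functor C D F" "is_functor C D G" "\<eta> \<in> extensional (Obj C)"
    and "\<And>A. A \<in> Obj C \<Longrightarrow> \<eta> A \<in> arrows D (OMap F A) (OMap G A)"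
    and "\<And>f. f \<in> Arr C \<Longrightarrow> Comp D (\<eta> (Cod C f)) (AMap F f) = Comp D (AMap G f) (\<eta> (Dom C f))"
  shows "nat_trans C D F G \<eta>"
  using assms unfolding nat_trans_def PiE_def by blast

lemma nat_trans_Comp:
  assumes a: "nat_trans C D F G \<alpha>" and b: "nat_trans C D G K \<beta>"
  shows "nat_trans C D F K (\<lambda>A \<in> Obj C. Comp D (\<beta> A) (\<alpha> A))"
proof (rule nat_transI)
  note [simp] = nat_transD[OF a] nat_transD[OF b]
  interpret C: category C using is_functorD(1)[of C D F] by simp
  interpret D: category D using is_functorD(2)[of C D F] by simp
  note [simp] = is_functorD(5-8)[of C D]
  show "is_functor C D F" "is_functor C D K" by simp_all
  fix A assume "A \<in> Obj C"
  then show "(\<lambda>A\<in>Obj C. Comp D (\<beta> A) (\<alpha> A)) A \<in> arrows D (OMap F A) (OMap K A)"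
    by (auto simp: arrows_def)
next
  note sa = nat_transD[OF a] and sb = nat_transD[OF b]
  interpret C: category C using is_functorD(1)[OF sa(1)] .
  interpret D: category D using is_functorD(2)[OF sa(1)] .
  note fs = is_functorD(5-8)[OF sa(1)] is_functorD(5-8)[OF sa(2)] is_functorD(5-8)[OF sb(2)]
  fix f assume f: "f \<in> Arr C"
  have "Comp D (Comp D (\<beta> (Cod C f)) (\<alpha> (Cod C f))) (AMap F f)
      = Comp D (\<beta> (Cod C f)) (Comp D (AMap G f) (\<alpha> (Dom C f)))"
    using f by (simp add: D.assoc sa sb fs)
  also have "\<dots> = Comp D (Comp D (\<beta> (Cod C f)) (AMap G f)) (\<alpha> (Dom C f))"
    using f by (subst D.assoc) (simp_all add: sa sb fs)
  also have "\<dots> = Comp D (Comp D (AMap K f) (\<beta> (Dom C f))) (\<alpha> (Dom C f))"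
    using f by (simp add: sb)
  also have "\<dots> = Comp D (AMap K f) (Comp D (\<beta> (Dom C f)) (\<alpha> (Dom C f)))"
    using f by (subst D.assoc) (simp_all add: sa sb fs)
  finally show "Comp D ((\<lambda>A\<in>Obj C. Comp D (\<beta> A) (\<alpha> A)) (Cod C f)) (AMap F f) =
      Comp D (AMap K f) ((\<lambda>A\<in>Obj C. Comp D (\<beta> A) (\<alpha> A)) (Dom C f))"
    using f by simp
qed auto

lemma nat_trans_Id:
  assumes F: "is_functor C D F"
  shows "nat_trans C D F F (\<lambda>A \<in> Obj C. Id D (OMap F A))"
proof -
  interpret C: category C using is_functorD(1)[OF F] .
  interpret D: category D using is_functorD(2)[OF F] .
  show ?thesis
    using is_functorD(5-8)[OF F] by (intro nat_transI F) (auto simp: arrows_def)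
qed

lemma category_functor_category:
  assumes "category C" "category D"
  shows "category (functor_category C D)"
proof -
  interpret C: category C by fact
  interpret D: category D by fact
  have 1: "mor \<alpha> = (\<lambda>A \<in> Obj C. m A) \<longleftrightarrow> (\<forall>A \<in> Obj C. mor \<alpha> A = m A)"
    if "nat_trans C D (src \<alpha>) (tgt \<alpha>) (mor \<alpha>)"
    for \<alpha> :: "('a,'b,'c,'d) fun_arrow" and m
    using nat_transD(7)[OF that] by (auto simp: extensional_def fun_eq_iff)
  show ?thesis
  proof
    fix f assume "f \<in> Arr (functor_category C D)"
    then show "Dom (functor_category C D) f \<in> Obj (functor_category C D)"
      "Cod (functor_category C D) f \<in> Obj (functor_category C D)"
      by (auto dest: nat_transD)
  next
    fix F assume "F \<in> Obj (functor_category C D)"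
    then show "Id (functor_category C D) F \<in> arrows (functor_category C D) F F"
      by (simp add: arrows_def nat_trans_Id)
  next
    fix f g F G K assume "f \<in> arrows (functor_category C D) F G"
      "g \<in> arrows (functor_category C D) G K"
    then show "Comp (functor_category C D) g f \<in> arrows (functor_category C D) F K"
      by (auto simp: arrows_def intro: nat_trans_Comp)
  next
    fix f F G assume f: "f \<in> arrows (functor_category C D) F G"
    note s = nat_transD[of C D "src f" "tgt f" "mor f"]
    have "nat_trans C D (src f) (tgt f) (mor f)" "src f = F" "tgt f = G"
      using f by (auto simp: arrows_def)
    then show "Comp (functor_category C D) f (Id (functor_category C D) F) = f"
      "Comp (functor_category C D) (Id (functor_category C D) G) f = f"
      by (auto intro!: arrow.expand simp: 1[THEN iffD2, symmetric] s)
  next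
    fix f g h F G K M assume "f \<in> arrows (functor_category C D) F G" 
      "g \<in> arrows (functor_category C D) G K" "h \<in> arrows (functor_category C D) K M"
    then show "Comp (functor_category C D) (Comp (functor_category C D) h g) f =
       Comp (functor_category C D) h (Comp (functor_category C D) g f)"
      by (auto simp: arrows_def intro!: restrict_ext D.assoc
           dest: nat_transD[of C D "src f"] nat_transD[of C D "src g"] nat_transD[of C D "src h"])
        (metis nat_transD(3-5))+
  qed
qed

lemma category_Fun_pce:
  assumes "category C" "category D"
  shows "category (Fun_pce C D)"
  unfolding Fun_pce_def using assms by (intro category_full_subcategory category_functor_category)

section \<open>Bifunctors and their currying\<close>

lemma prod_category_simps [simp]:
  "Obj (prod_category C D) = Obj C \<times> Obj D" "Arr (prod_category C D) = Arr C \<times> Arr D"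
  "Dom (prod_category C D) (f, h) = (Dom C f, Dom D h)"
  "Cod (prod_category C D) (f, h) = (Cod C f, Cod D h)"
  "Id (prod_category C D) (A, B) = (Id C A, Id D B)"
  "Comp (prod_category C D) (g, k) (f, h) = (Comp C g f, Comp D k h)"
  by (simp_all add: prod_category_def)

lemma category_prod_category:
  assumes "category C" "category D"
  shows "category (prod_category C D)"
proof -
  interpret C: category C by fact
  interpret D: category D by fact
  show ?thesis
    by unfold_locales (auto simp: arrows_def C.assoc D.assoc)
qed

lemma bifunctorD:
  assumes "is_functor (prod_category C D) E P"
  shows "c \<in> Obj C \<Longrightarrow> d \<in> Obj D \<Longrightarrow> OMap P (c, d) \<in> Obj E"
    and "f \<in> Arr C \<Longrightarrow> h \<in> Arr D \<Longrightarrow> AMap P (f, h) \<in> Arr E"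
    and "f \<in> Arr C \<Longrightarrow> h \<in> Arr D \<Longrightarrow> Dom E (AMap P (f, h)) = OMap P (Dom C f, Dom D h)"
    and "f \<in> Arr C \<Longrightarrow> h \<in> Arr D \<Longrightarrow> Cod E (AMap P (f, h)) = OMap P (Cod C f, Cod D h)"
    and "c \<in> Obj C \<Longrightarrow> d \<in> Obj D \<Longrightarrow> AMap P (Id C c, Id D d) = Id E (OMap P (c, d))"
    and "f \<in> Arr C \<Longrightarrow> g \<in> Arr C \<Longrightarrow> Cod C f = Dom C g \<Longrightarrow>
      h \<in> Arr D \<Longrightarrow> k \<in> Arr D \<Longrightarrow> Cod D h = Dom D k \<Longrightarrow>
      Comp E (AMap P (g, k)) (AMap P (f, h)) = AMap P (Comp C g f, Comp D k h)"
  using is_functorD(5)[OF assms, of "(c, d)"] is_functorD(6-8)[OF assms, of "(f, h)"]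
    is_functorD(9)[OF assms, of "(c, d)"] is_functorD(10)[OF assms, of "(f, h)" "(g, k)"]
  by simp_all

lemma fix_left_simps [simp]:
  "d \<in> Obj D \<Longrightarrow> OMap (fix_left C D P c) d = OMap P (c, d)"
  "h \<in> Arr D \<Longrightarrow> AMap (fix_left C D P c) h = AMap P (Id C c, h)"
  by (simp_all add: fix_left_def)

lemma is_functor_fix_left:
  assumes P: "is_functor (prod_category C D) E P" and "category C" "category D" and c: "c \<in> Obj C"
  shows "is_functor D E (fix_left C D P c)"
proof -
  interpret C: category C by fact
  interpret D: category D by fact
  interpret E: category E using is_functorD(2)[OF P] .
  show ?thesis
    using c D.category_axioms E.category_axioms
    unfolding is_functor_def
    by (auto simp: bifunctorD[OF P]) (auto simp: fix_left_def bifunctorD[OF P])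
qed

lemma curry_left_simps [simp]:
  "c \<in> Obj C \<Longrightarrow> OMap (curry_left C D P) c = fix_left C D P c"
  "f \<in> Arr C \<Longrightarrow> AMap (curry_left C D P) f =
    Arrow (fix_left C D P (Dom C f)) (\<lambda>d \<in> Obj D. AMap P (f, Id D d)) (fix_left C D P (Cod C f))"
  by (simp_all add: curry_left_def)

lemma is_functor_curry_left:
  assumes P: "is_functor (prod_category C D) E P" and "category C" "category D"
    and pce: "\<And>c. c \<in> Obj C \<Longrightarrow> pce_functor D E (fix_left C D P c)"
  shows "is_functor C (Fun_pce D E) (curry_left C D P)"
proof -
  interpret C: category C by fact
  interpret D: category D by fact
  interpret E: category E using is_functorD(2)[OF P] .
  note s = bifunctorD[OF P]
  note fl = is_functor_fix_left[OF P C.category_axioms D.category_axioms]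
  have nt: "nat_trans D E (fix_left C D P (Dom C f)) (fix_left C D P (Cod C f))
      (\<lambda>d \<in> Obj D. AMap P (f, Id D d))" if "f \<in> Arr C" for f
    using that by (intro nat_transI fl) (auto simp: s arrows_def)
  show ?thesis
    unfolding is_functor_def
  proof (intro conjI ballI impI)
    show "category (Fun_pce D E)" by (intro category_Fun_pce D.category_axioms E.category_axioms)
    show "OMap (curry_left C D P) \<in> Obj C \<rightarrow>\<^sub>E Obj (Fun_pce D E)"
      by (auto simp: curry_left_def Fun_pce_def intro: fl pce)
    show "AMap (curry_left C D P) \<in> Arr C \<rightarrow>\<^sub>E Arr (Fun_pce D E)"
      by (auto simp: curry_left_def Fun_pce_def intro!: nt pce C.Dom_in_Obj C.Cod_in_Obj)
  qed (auto simp: Fun_pce_def s C.category_axioms intro!: restrict_ext)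
qed

text \<open>
  The pointwise inverses of a natural transformation are natural.
\<close>

lemma is_iso_Fun_pce:
  assumes n: "nat_trans C D F G \<eta>" and iso: "\<And>A. A \<in> Obj C \<Longrightarrow> is_iso D (\<eta> A)"
    and "pce_functor C D F" "pce_functor C D G"
  shows "is_iso (Fun_pce C D) (Arrow F \<eta> G)"
proof -
  note s = nat_transD[OF n]
  note fs = is_functorD(5-8)[OF s(1)] is_functorD(5-8)[OF s(2)]
  interpret C: category C using is_functorD(1)[OF s(1)] .
  interpret D: category D using is_functorD(2)[OF s(1)] .
  have "\<forall>A \<in> Obj C. \<exists>\<theta>. \<theta> \<in> arrows D (OMap G A) (OMap F A) \<and>
      Comp D \<theta> (\<eta> A) = Id D (OMap F A) \<and> Comp D (\<eta> A) \<theta> = Id D (OMap G A)"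
    using iso s(4,5) unfolding is_iso_def by fastforce
  then obtain \<theta> where "\<forall>A \<in> Obj C. \<theta> A \<in> arrows D (OMap G A) (OMap F A) \<and>
      Comp D (\<theta> A) (\<eta> A) = Id D (OMap F A) \<and> Comp D (\<eta> A) (\<theta> A) = Id D (OMap G A)"
    by (rule bchoice[THEN exE])
  then have t: "\<theta> A \<in> Arr D" "Dom D (\<theta> A) = OMap G A" "Cod D (\<theta> A) = OMap F A"
      "Comp D (\<theta> A) (\<eta> A) = Id D (OMap F A)" "Comp D (\<eta> A) (\<theta> A) = Id D (OMap G A)"
    if "A \<in> Obj C" for A using that by (auto simp: arrows_def)
  have nat: "Comp D (\<theta> (Cod C f)) (AMap G f) = Comp D (AMap F f) (\<theta> (Dom C f))"
    if f: "f \<in> Arr C" for f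
  proof -
    have "Comp D (\<theta> (Cod C f)) (AMap G f)
        = Comp D (\<theta> (Cod C f)) (Comp D (Comp D (AMap G f) (\<eta> (Dom C f))) (\<theta> (Dom C f)))"
      using f by (simp add: D.assoc s(3-5) fs t)
    also have "\<dots> = Comp D (\<theta> (Cod C f)) (Comp D (Comp D (\<eta> (Cod C f)) (AMap F f)) (\<theta> (Dom C f)))"
      using f by (simp add: s(6))
    also have "\<dots> = Comp D (\<theta> (Cod C f)) (Comp D (\<eta> (Cod C f)) (Comp D (AMap F f) (\<theta> (Dom C f))))"
      using f by (simp add: D.assoc s(3-5) fs t)
    also have "\<dots> = Comp D (AMap F f) (\<theta> (Dom C f))"
      using f by (intro D.cancel_left) (simp_all add: s(3-5) fs t)
    finally show ?thesis .
  qed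
  have n': "nat_trans C D G F (\<lambda>A \<in> Obj C. \<theta> A)"
    by (rule nat_transI) (auto simp: s(1,2) nat t arrows_def)
  show ?thesis
    unfolding is_iso_def
    by (intro conjI bexI[of _ "Arrow G (\<lambda>A \<in> Obj C. \<theta> A) F"])
       (auto simp: Fun_pce_def n n' assms(3,4) t arrows_def intro!: restrict_ext)
qed

text \<open>
  Swapping the arguments turns the functors \<open>F(-, d)\<close> into functors \<open>F(c, -)\<close>, so that only the
  latter need to be studied.
\<close>

definition swap_functor ::
    "('o \<times> 'p, 'm \<times> 'n, 'q, 'k) ftor \<Rightarrow> ('p \<times> 'o, 'n \<times> 'm, 'q, 'k) ftor" where
  "swap_functor P =
    \<lparr>OMap = (\<lambda>(d, c). OMap P (c, d)), AMap = (\<lambda>(h, f). AMap P (f, h))\<rparr>"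

lemma swap_functor_simps [simp]:
  "OMap (swap_functor P) (d, c) = OMap P (c, d)" "AMap (swap_functor P) (h, f) = AMap P (f, h)"
  by (simp_all add: swap_functor_def)

lemma is_functor_swap_functor:
  assumes P: "is_functor (prod_category C D) E P" and "category C" "category D"
  shows "is_functor (prod_category D C) E (swap_functor P)"
proof -
  note s = bifunctorD[OF P]
  have ext: "OMap P \<in> extensional (Obj C \<times> Obj D)" "AMap P \<in> extensional (Arr C \<times> Arr D)"
    using is_functorD(3,4)[OF P] by (auto simp: PiE_def)
  show ?thesis
    unfolding is_functor_def
  proof (intro conjI)
    show "category (prod_category D C)" by (intro category_prod_category assms)
    show "category E" using is_functorD(2)[OF P] .
    show "OMap (swap_functor P) \<in> Obj (prod_category D C) \<rightarrow>\<^sub>E Obj E"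
      "AMap (swap_functor P) \<in> Arr (prod_category D C) \<rightarrow>\<^sub>E Arr E"
      using ext s(1,2) by (auto simp: PiE_def extensional_def)
  qed (auto simp: s)
qed

lemma fix_right_eq_fix_left: "fix_right C D P d = fix_left D C (swap_functor P) d"
  by (simp add: fix_right_def fix_left_def)

lemma curry_right_eq_curry_left: "curry_right C D P = curry_left D C (swap_functor P)"
  by (simp add: curry_right_def curry_left_def fix_right_eq_fix_left)

section \<open>Categories of finite sets with a group action\<close>

lemma ex1_unique: "\<exists>!x. Q x \<Longrightarrow> Q a \<Longrightarrow> Q b \<Longrightarrow> a = b"
  by blast

text \<open>
  The set \<open>Z\<close> is allowed to live in any type, since pullbacks and coproducts are first built on
  sets of pairs.
\<close>

definition finite_action ::
    "('g, 'z) monoid_scheme \<Rightarrow> bool \<Rightarrow> 'x set \<Rightarrow> ('g \<Rightarrow> 'x \<Rightarrow> 'x) \<Rightarrow> bool" where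
  "finite_action H r Z \<alpha> \<longleftrightarrow> finite Z \<and>
    (\<forall>g \<in> carrier H. \<forall>z \<in> Z. \<alpha> g z \<in> Z) \<and>
    (\<forall>z \<in> Z. \<alpha> \<one>\<^bsub>H\<^esub> z = z) \<and>
    (\<forall>g \<in> carrier H. \<forall>h \<in> carrier H. \<forall>z \<in> Z. \<alpha> (g \<otimes>\<^bsub>H\<^esub> h) z = \<alpha> g (\<alpha> h z)) \<and>
    (r \<longrightarrow> (\<forall>g \<in> carrier H. \<forall>z \<in> Z. \<alpha> g z = z \<longrightarrow> g = \<one>\<^bsub>H\<^esub>))"

text \<open>
  A model \<open>C\<close> of the category of all finite left \<open>H\<close>-sets (\<open>\<not> r\<close>) or all finite free ones (\<open>r\<close>)
  with points in an infinite type. Objects are of an arbitrary type with an underlying set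
  \<open>pts\<close> and an action \<open>gact\<close>, so that plain finite sets are covered as well, as objects with an
  action of the trivial group.
\<close>

locale gset_model = group H for H :: "('g, 'z) monoid_scheme" (structure) +
  fixes r :: bool and C :: "('o, ('o, 'a \<Rightarrow> 'a) arrow) cat"
    and pts :: "'o \<Rightarrow> 'a set" and gact :: "'o \<Rightarrow> 'g \<Rightarrow> 'a \<Rightarrow> 'a"
  assumes fin_H: "finite (carrier H)" and inf_points: "infinite (UNIV :: 'a set)"
    and actions: "X \<in> Obj C \<Longrightarrow> finite_action H r (pts X) (gact X)"
    and realize: "finite_action H r Z \<alpha> \<Longrightarrow>
      \<exists>X \<in> Obj C. pts X = Z \<and> (\<forall>g \<in> carrier H. \<forall>z \<in> Z. gact X g z = \<alpha> g z)"
    and Arr_eq: "Arr C = {f. src f \<in> Obj C \<and> tgt f \<in> Obj C \<and>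
      mor f \<in> pts (src f) \<rightarrow>\<^sub>E pts (tgt f) \<and>
      (\<forall>g \<in> carrier H. \<forall>x \<in> pts (src f). mor f (gact (src f) g x) = gact (tgt f) g (mor f x))}"
    and Dom_eq [simp]: "Dom C = src" and Cod_eq [simp]: "Cod C = tgt"
    and Id_eq: "Id C = (\<lambda>X. Arrow X (\<lambda>x \<in> pts X. x) X)"
    and Comp_eq:
      "Comp C = (\<lambda>g f. Arrow (src f) (compose (pts (src f)) (mor g) (mor f)) (tgt g))"
begin

lemma act_simps [simp]:
  assumes "X \<in> Obj C"
  shows "finite (pts X)" "x \<in> pts X \<Longrightarrow> gact X \<one> x = x"
    and "x \<in> pts X \<Longrightarrow> g \<in> carrier H \<Longrightarrow> gact X g x \<in> pts X"
    and "x \<in> pts X \<Longrightarrow> g \<in> carrier H \<Longrightarrow> h \<in> carrier H \<Longrightarrow>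
      gact X (g \<otimes> h) x = gact X g (gact X h x)"
  using actions[OF assms] by (auto simp: finite_action_def)

lemma act_free:
  assumes "X \<in> Obj C" "x \<in> pts X" "r" "g \<in> carrier H" "gact X g x = x"
  shows "g = \<one>"
  using actions[OF assms(1)] assms by (auto simp: finite_action_def)

lemma act_inv [simp]:
  assumes "X \<in> Obj C" "x \<in> pts X" "g \<in> carrier H"
  shows "gact X g (gact X (inv g) x) = x" "gact X (inv g) (gact X g x) = x"
  using assms by (simp_all flip: act_simps(4))

definition eqv :: "'o \<Rightarrow> 'o \<Rightarrow> ('a \<Rightarrow> 'a) \<Rightarrow> bool" where
  "eqv X Y m \<longleftrightarrow> m \<in> pts X \<rightarrow>\<^sub>E pts Y \<and>
    (\<forall>g \<in> carrier H. \<forall>x \<in> pts X. m (gact X g x) = gact Y g (m x))"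

lemma eqvD:
  assumes "eqv X Y m" "x \<in> pts X"
  shows "m x \<in> pts Y" "g \<in> carrier H \<Longrightarrow> m (gact X g x) = gact Y g (m x)"
  using assms by (auto simp: eqv_def)

lemma eqv_eqI:
  assumes "eqv X Y m" "eqv X Y n" "\<And>x. x \<in> pts X \<Longrightarrow> m x = n x"
  shows "m = n"
  using assms by (auto simp: eqv_def intro: PiE_ext)

lemma Arr_iff: "f \<in> Arr C \<longleftrightarrow> src f \<in> Obj C \<and> tgt f \<in> Obj C \<and> eqv (src f) (tgt f) (mor f)"
  by (auto simp: Arr_eq eqv_def)

lemma arrows_iff:
  "f \<in> arrows C X Y \<longleftrightarrow> X \<in> Obj C \<and> Y \<in> Obj C \<and> src f = X \<and> tgt f = Y \<and> eqv X Y (mor f)"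
  by (auto simp: arrows_def Arr_iff)

lemma Comp_Arrow [simp]:
  "Comp C (Arrow Y n Z) (Arrow X m Y') = Arrow X (compose (pts X) n m) Z"
  by (simp add: Comp_eq)

lemma eqv_id [simp]: "X \<in> Obj C \<Longrightarrow> eqv X X (\<lambda>x \<in> pts X. x)"
  by (auto simp: eqv_def)

lemma eqv_compose:
  assumes "X \<in> Obj C" "eqv X Y m" "eqv Y Z n"
  shows "eqv X Z (compose (pts X) n m)"
  unfolding eqv_def using assms(1) eqvD[OF assms(2)] eqvD[OF assms(3)] by (auto simp: compose_def)

lemma eqv_compose_id:
  assumes "eqv A B m"
  shows "compose (pts A) m (\<lambda>x \<in> pts A. x) = m" "compose (pts A) (\<lambda>x \<in> pts B. x) m = m"
proof -
  have m: "m \<in> pts A \<rightarrow>\<^sub>E pts B" using assms by (simp add: eqv_def)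
  have "compose (pts A) m (\<lambda>x \<in> pts A. x) x = m x" "compose (pts A) (\<lambda>x \<in> pts B. x) m x = m x" for x
    using PiE_mem[OF m, of x] PiE_arb[OF m, of x] by (cases "x \<in> pts A"; simp add: compose_def)+
  then show "compose (pts A) m (\<lambda>x \<in> pts A. x) = m" "compose (pts A) (\<lambda>x \<in> pts B. x) m = m"
    by (simp_all add: fun_eq_iff)
qed

lemma category: "category C"
proof
  fix f A B assume f: "f \<in> arrows C A B"
  show "Comp C f (Id C A) = f" "Comp C (Id C B) f = f"
    using f eqv_compose_id[of A B "mor f"] by (simp_all add: arrows_iff Comp_eq Id_eq arrow.expand)
next
  fix f g h A B D E
  assume "f \<in> arrows C A B" "g \<in> arrows C B D" "h \<in> arrows C D E"
  then show "Comp C (Comp C h g) f = Comp C h (Comp C g f)"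
    using compose_assoc[of "mor f" "pts A" "pts B" "mor h" "mor g"]
    by (auto simp: arrows_iff Comp_eq eqv_def PiE_def)
next
  fix f g A B D assume "f \<in> arrows C A B" "g \<in> arrows C B D"
  then show "Comp C g f \<in> arrows C A D" by (auto simp: arrows_iff Comp_eq intro: eqv_compose)
qed (auto simp: Arr_iff arrows_iff Id_eq)

sublocale category C by (rule category)

text \<open>
  Because the type of points is infinite, a finite action on a set of any type is isomorphic to an
  object of \<open>C\<close>.
\<close>

lemma realize_on:
  fixes Z :: "'x set"
  assumes "finite_action H r Z \<alpha>"
  obtains X j where "X \<in> Obj C" "bij_betw j Z (pts X)"
    "\<And>g z. g \<in> carrier H \<Longrightarrow> z \<in> Z \<Longrightarrow> gact X g (j z) = j (\<alpha> g z)"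
proof -
  have "finite Z" using assms by (simp add: finite_action_def)
  obtain Z' :: "'a set" where Z': "finite Z'" "card Z' = card Z"
    using infinite_arbitrarily_large[OF inf_points] by blast
  then obtain j where j: "bij_betw j Z Z'"
    using finite_same_card_bij[OF \<open>finite Z\<close>] by metis
  let ?k = "inv_into Z j"
  have k: "z \<in> Z' \<Longrightarrow> ?k z \<in> Z" "z \<in> Z' \<Longrightarrow> j (?k z) = z" "x \<in> Z \<Longrightarrow> ?k (j x) = x"
    "x \<in> Z \<Longrightarrow> j x \<in> Z'" for z x
    using j by (auto simp: bij_betw_def inv_into_into f_inv_into_f)
  have *: "j a = z \<longleftrightarrow> a = ?k z" if "a \<in> Z" "z \<in> Z'" for a z using that k by metis
  have "finite_action H r Z' (\<lambda>g z. j (\<alpha> g (?k z)))"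
    using assms Z' unfolding finite_action_def by (auto simp: k *)
  from realize[OF this] obtain X where "X \<in> Obj C" "pts X = Z'"
    "\<forall>g \<in> carrier H. \<forall>z \<in> Z'. gact X g z = j (\<alpha> g (?k z))" by blast
  with j k show thesis by (intro that[of X j]) auto
qed

lemma is_isoI:
  assumes "X \<in> Obj C" "Y \<in> Obj C" "eqv X Y m" "bij_betw m (pts X) (pts Y)"
  shows "is_iso C (Arrow X m Y)"
proof -
  let ?n = "\<lambda>y \<in> pts Y. inv_into (pts X) m y"
  have n: "y \<in> pts Y \<Longrightarrow> inv_into (pts X) m y \<in> pts X"
    "y \<in> pts Y \<Longrightarrow> m (inv_into (pts X) m y) = y" "x \<in> pts X \<Longrightarrow> inv_into (pts X) m (m x) = x" for x y
    using assms(4) by (auto simp: bij_betw_def inv_into_into f_inv_into_f)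
  have "gact X g (inv_into (pts X) m y) = inv_into (pts X) m (gact Y g y)"
    if "g \<in> carrier H" "y \<in> pts Y" for g y
    using n(3)[of "gact X g (inv_into (pts X) m y)"] that assms(1,2) n eqvD[OF assms(3)] by simp
  then have "eqv Y X ?n" using assms(1,2) n by (auto simp: eqv_def)
  then show ?thesis unfolding is_iso_def
    using assms n by (intro conjI bexI[of _ "Arrow Y ?n X"])
      (auto simp: Arr_iff arrows_iff Id_eq compose_def eqvD(1)[OF assms(3)])
qed

lemma ex_regular:
  "\<exists>R e. R \<in> Obj C \<and> e \<in> pts R \<and> bij_betw (\<lambda>g. gact R g e) (carrier H) (pts R)"
proof -
  have "finite_action H r (carrier H) (\<lambda>g h. g \<otimes> h)"
    using fin_H by (auto simp: finite_action_def m_assoc)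
  then obtain R j where R: "R \<in> Obj C" "bij_betw j (carrier H) (pts R)"
    "\<And>g h. g \<in> carrier H \<Longrightarrow> h \<in> carrier H \<Longrightarrow> gact R g (j h) = j (g \<otimes> h)"
    by (rule realize_on) (rule that; assumption)
  have eq: "j g = gact R g (j \<one>)" if "g \<in> carrier H" for g
    using R(3)[OF that one_closed] that by simp
  have "bij_betw (\<lambda>g. gact R g (j \<one>)) (carrier H) (pts R)"
    using R(2) bij_betw_cong[of "carrier H" j "\<lambda>g. gact R g (j \<one>)" "pts R", OF eq] by blast
  moreover have "j \<one> \<in> pts R" using bij_betwE[OF R(2)] by simp
  ultimately show ?thesis using R(1) by (intro exI[of _ R] exI[of _ "j \<one>"] conjI)
qed

text \<open>
  The regular \<open>H\<close>-set and its base point. Only its isomorphism type is available, so both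
  are chosen.
\<close>

definition reg :: 'o where
  "reg = (SOME R. \<exists>e. R \<in> Obj C \<and> e \<in> pts R \<and> bij_betw (\<lambda>g. gact R g e) (carrier H) (pts R))"

definition base :: 'a where
  "base = (SOME e. e \<in> pts reg \<and> bij_betw (\<lambda>g. gact reg g e) (carrier H) (pts reg))"

lemma reg_base [simp]: "reg \<in> Obj C" "base \<in> pts reg"
  and bij_reg: "bij_betw (\<lambda>g. gact reg g base) (carrier H) (pts reg)"
proof -
  have 1: "\<exists>e. reg \<in> Obj C \<and> e \<in> pts reg \<and> bij_betw (\<lambda>g. gact reg g e) (carrier H) (pts reg)"
    unfolding reg_def by (rule someI_ex) (rule ex_regular)
  then show "reg \<in> Obj C" by blast
  have "base \<in> pts reg \<and> bij_betw (\<lambda>g. gact reg g base) (carrier H) (pts reg)"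
    unfolding base_def by (rule someI_ex) (use 1 in blast)
  then show "base \<in> pts reg" "bij_betw (\<lambda>g. gact reg g base) (carrier H) (pts reg)" by auto
qed

lemma regE:
  assumes "s \<in> pts reg"
  obtains g where "g \<in> carrier H" "s = gact reg g base"
  using assms bij_reg by (auto simp: bij_betw_def)

lemma reg_inj:
  assumes "g \<in> carrier H" "h \<in> carrier H" "gact reg g base = gact reg h base"
  shows "g = h"
  using assms bij_reg by (auto simp: bij_betw_def inj_on_def)

text \<open>
  The equivariant map from the regular \<open>H\<close>-set with \<open>base \<mapsto> x\<close>. By \<open>eqv_reg_eq_ev\<close> these are
  all the maps out of it, so that it represents the functor of points.
\<close>

definition ev :: "'o \<Rightarrow> 'a \<Rightarrow> 'a \<Rightarrow> 'a" where
  "ev X x = (\<lambda>s \<in> pts reg. gact X (the_inv_into (carrier H) (\<lambda>g. gact reg g base) s) x)"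

lemma ev_act [simp]:
  assumes "g \<in> carrier H"
  shows "ev X x (gact reg g base) = gact X g x"
  using assms bij_reg the_inv_into_f_f[of "\<lambda>g. gact reg g base" "carrier H" g]
  by (auto simp: ev_def bij_betw_def)

lemma ev_base [simp]: "X \<in> Obj C \<Longrightarrow> x \<in> pts X \<Longrightarrow> ev X x base = x"
  using ev_act[of \<one> X x] by simp

lemma eqv_ev [simp]:
  assumes "X \<in> Obj C" "x \<in> pts X"
  shows "eqv reg X (ev X x)"
  unfolding eqv_def
proof (intro conjI ballI)
  have "ev X x s \<in> pts X" if "s \<in> pts reg" for s
    using that by (rule regE) (simp add: assms)
  then show "ev X x \<in> pts reg \<rightarrow>\<^sub>E pts X"
    by (auto simp: ev_def)
  fix g s assume g: "g \<in> carrier H" and "s \<in> pts reg"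
  then obtain h where "h \<in> carrier H" "s = gact reg h base" by (elim regE)
  then show "ev X x (gact reg g s) = gact X g (ev X x s)"
    using g assms by (simp flip: act_simps(4))
qed

lemma eqv_reg_eq_ev:
  assumes "X \<in> Obj C" "eqv reg X m"
  shows "m = ev X (m base)"
proof (rule eqv_eqI[OF assms(2)])
  show "eqv reg X (ev X (m base))" using assms(1) by (simp add: eqvD[OF assms(2)])
  fix s assume "s \<in> pts reg"
  then show "m s = ev X (m base) s" by (auto elim!: regE simp: eqvD[OF assms(2)])
qed

lemma eqv_comp_ev:
  assumes "X \<in> Obj C" "Y \<in> Obj C" "eqv X Y m" "x \<in> pts X"
  shows "compose (pts reg) m (ev X x) = ev Y (m x)"
  using assms eqv_compose[OF reg_base(1) eqv_ev assms(3)]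
  by (subst eqv_reg_eq_ev[of Y "compose (pts reg) m (ev X x)"]) (simp_all add: compose_eq)

definition set_pullback :: "'o \<Rightarrow> 'o \<Rightarrow> 'o \<Rightarrow> ('a \<Rightarrow> 'a) \<Rightarrow> ('a \<Rightarrow> 'a) \<Rightarrow> ('a \<Rightarrow> 'a) \<Rightarrow> ('a \<Rightarrow> 'a) \<Rightarrow> bool" where
  "set_pullback P Y Z p q f g \<longleftrightarrow> (\<forall>x \<in> pts P. f (p x) = g (q x)) \<and>
    (\<forall>y \<in> pts Y. \<forall>z \<in> pts Z. f y = g z \<longrightarrow> (\<exists>!x. x \<in> pts P \<and> p x = y \<and> q x = z))"

text \<open>
  The map into \<open>P\<close> demanded by the universal property is determined on points; it is equivariant
  because points of \<open>P\<close> are determined by their two projections.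
\<close>

lemma is_pullbackI:
  assumes o: "P \<in> Obj C" "Y \<in> Obj C" "Z \<in> Obj C" "W \<in> Obj C"
    and m: "eqv P Y p" "eqv P Z q" "eqv Y W f" "eqv Z W g"
    and sp: "set_pullback P Y Z p q f g"
  shows "is_pullback C (Arrow P p Y) (Arrow P q Z) (Arrow Y f W) (Arrow Z g W)"
  unfolding is_pullback_def
proof (intro conjI allI ballI impI)
  show "Comp C (Arrow Y f W) (Arrow P p Y) = Comp C (Arrow Z g W) (Arrow P q Z)"
    using sp by (auto simp: set_pullback_def compose_def)
  fix T u v
  assume "u \<in> arrows C T (Dom C (Arrow Y f W))" "v \<in> arrows C T (Dom C (Arrow Z g W))"
    and c: "Comp C (Arrow Y f W) u = Comp C (Arrow Z g W) v"
  then have T: "T \<in> Obj C" and uv: "src u = T" "src v = T" "tgt u = Y" "tgt v = Z" "eqv T Y (mor u)"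
    "eqv T Z (mor v)"
    by (auto simp: arrows_iff)
  have "f (mor u t) = g (mor v t)" if "t \<in> pts T" for t
    using c uv that by (auto simp: Comp_eq compose_def fun_eq_iff) metis
  then have ex: "\<exists>!x. x \<in> pts P \<and> p x = mor u t \<and> q x = mor v t" if "t \<in> pts T" for t
    using sp eqvD(1)[OF uv(5) that] eqvD(1)[OF uv(6) that] that unfolding set_pullback_def by simp
  define h where "h = (\<lambda>t \<in> pts T. THE x. x \<in> pts P \<and> p x = mor u t \<and> q x = mor v t)"
  have h: "h t \<in> pts P" "p (h t) = mor u t" "q (h t) = mor v t" if "t \<in> pts T" for t
    using theI'[OF ex[OF that]] that by (auto simp: h_def)
  note me = eqvD[OF m(1)] eqvD[OF m(2)] eqvD[OF uv(5)] eqvD[OF uv(6)]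
  have "h (gact T a t) = gact P a (h t)" if a: "a \<in> carrier H" and t: "t \<in> pts T" for a t
  proof -
    have "p (gact P a (h t)) = mor u (gact T a t)" "q (gact P a (h t)) = mor v (gact T a t)"
      "gact P a (h t) \<in> pts P" "gact T a t \<in> pts T"
      using a t o T h by (simp_all add: me)
    then show ?thesis using ex[of "gact T a t"] h[of "gact T a t"] by blast
  qed
  then have he: "eqv T P h" using h by (auto simp: eqv_def h_def)
  show "\<exists>!h. h \<in> arrows C T (Dom C (Arrow P p Y)) \<and> Comp C (Arrow P p Y) h = u \<and>
    Comp C (Arrow P q Z) h = v"
  proof (rule ex1I[of _ "Arrow T h P"])
    show "Arrow T h P \<in> arrows C T (Dom C (Arrow P p Y)) \<and> Comp C (Arrow P p Y) (Arrow T h P) = u \<and>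
      Comp C (Arrow P q Z) (Arrow T h P) = v"
      using he T o uv h eqv_compose[OF T he m(1)] eqv_compose[OF T he m(2)]
      by (auto simp: arrows_iff compose_eq intro!: arrow.expand intro: eqv_eqI[of T])
    fix k assume k: "k \<in> arrows C T (Dom C (Arrow P p Y)) \<and> Comp C (Arrow P p Y) k = u \<and>
      Comp C (Arrow P q Z) k = v"
    then have ke: "src k = T" "tgt k = P" "eqv T P (mor k)" by (auto simp: arrows_iff)
    have "mor k t = h t" if t: "t \<in> pts T" for t
    proof -
      have "p (mor k t) = mor u t" "q (mor k t) = mor v t"
        using k ke t by (auto simp: Comp_eq compose_eq)
      then show ?thesis using ex[OF t] h[OF t] eqvD(1)[OF ke(3) t] by blast
    qed
    then have "mor k = h" using ke he by (intro eqv_eqI) auto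
    then show "k = Arrow T h P" using ke by (auto intro: arrow.expand)
  qed
qed (use o m in \<open>auto simp: Arr_iff\<close>)

text \<open>
  A point of \<open>Y\<close> and a point of \<open>Z\<close> with the same image are a commuting pair of maps out of the
  regular \<open>H\<close>-set. The universal property for this pair is the required statement about points.
\<close>

lemma is_pullbackE:
  assumes "is_pullback C p' q' f' g'"
  obtains P Y Z W p q f g where
    "p' = Arrow P p Y" "q' = Arrow P q Z" "f' = Arrow Y f W" "g' = Arrow Z g W"
    "P \<in> Obj C" "Y \<in> Obj C" "Z \<in> Obj C" "W \<in> Obj C"
    "eqv P Y p" "eqv P Z q" "eqv Y W f" "eqv Z W g" "set_pullback P Y Z p q f g"
proof -
  obtain P p Y where p': "p' = Arrow P p Y" by (cases p')
  obtain Q q Z where q': "q' = Arrow Q q Z" by (cases q')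
  obtain f Y' W where f': "f' = Arrow Y' f W" by (cases f')
  obtain g Z' W' where g': "g' = Arrow Z' g W'" by (cases g')
  note a = assms[unfolded is_pullback_def p' q' f' g']
  have eqs: "Q = P" "Y' = Y" "Z' = Z" "W' = W" using a by auto
  note a = a[unfolded eqs]
  have o: "P \<in> Obj C" "Y \<in> Obj C" "Z \<in> Obj C" "W \<in> Obj C"
    and m: "eqv P Y p" "eqv P Z q" "eqv Y W f" "eqv Z W g"
    using a by (auto simp: Arr_iff)
  have ex1: "\<exists>!h. h \<in> arrows C reg P \<and> Comp C (Arrow P p Y) h = Arrow reg (ev Y y) Y \<and>
    Comp C (Arrow P q Z) h = Arrow reg (ev Z z) Z"
    if "y \<in> pts Y" "z \<in> pts Z" "f y = g z" for y z
  proof -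
    have "Arrow reg (ev Y y) Y \<in> arrows C reg Y" "Arrow reg (ev Z z) Z \<in> arrows C reg Z"
      "Comp C (Arrow Y f W) (Arrow reg (ev Y y) Y) = Comp C (Arrow Z g W) (Arrow reg (ev Z z) Z)"
      using that o m by (auto simp: arrows_iff eqv_comp_ev)
    then show ?thesis using a by auto
  qed
  have "set_pullback P Y Z p q f g"
    unfolding set_pullback_def
  proof (intro conjI ballI impI)
    fix x assume x: "x \<in> pts P"
    have "compose (pts P) f p x = compose (pts P) g q x" using a by simp
    with x show "f (p x) = g (q x)" by (simp add: compose_eq)
  next
    fix y z assume yz: "y \<in> pts Y" "z \<in> pts Z" "f y = g z"
    obtain h where h: "h \<in> arrows C reg P" "Comp C (Arrow P p Y) h = Arrow reg (ev Y y) Y"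
      "Comp C (Arrow P q Z) h = Arrow reg (ev Z z) Z"
      using ex1[OF yz] by blast
    have he: "eqv reg P (mor h)" using h(1) by (simp add: arrows_iff)
    have x: "mor h base \<in> pts P" using eqvD(1)[OF he] by simp
    have "compose (pts reg) p (mor h) base = y" "compose (pts reg) q (mor h) base = z"
      using h yz o by (simp_all add: Comp_eq arrows_iff)
    then have "p (mor h base) = y" "q (mor h base) = z"
      by (simp_all add: compose_eq)
    moreover have "x = x'" if "x \<in> pts P" "p x = y" "q x = z" "x' \<in> pts P" "p x' = y" "q x' = z"
      for x x'
    proof -
      have "Arrow reg (ev P t) P \<in> arrows C reg P \<and>
          Comp C (Arrow P p Y) (Arrow reg (ev P t) P) = Arrow reg (ev Y y) Y \<and>
          Comp C (Arrow P q Z) (Arrow reg (ev P t) P) = Arrow reg (ev Z z) Z"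
        if "t \<in> pts P \<and> p t = y \<and> q t = z" for t
        using that o eqv_comp_ev[OF o(1,2) m(1), of t] eqv_comp_ev[OF o(1,3) m(2), of t]
        by (simp add: arrows_iff)
      then have "Arrow reg (ev P x) P = Arrow reg (ev P x') P"
        using that by (intro ex1_unique[OF ex1[OF yz]]) simp_all
      then have "ev P x base = ev P x' base" by simp
      then show ?thesis using that o by simp
    qed
    ultimately show "\<exists>!x. x \<in> pts P \<and> p x = y \<and> q x = z" using x by blast
  qed
  with o m p' q' f' g' eqs show thesis by (intro that) auto
qed

end

context gset_model
begin

lemma arrowsD:
  assumes "f \<in> arrows C X Y"
  shows "X \<in> Obj C" "Y \<in> Obj C" "src f = X" "tgt f = Y" "eqv X Y (mor f)"
    "Arrow X (mor f) Y = f"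
  using assms by (auto simp: arrows_iff)

lemma mor_Comp_apply:
  assumes "f \<in> arrows C X Y" "x \<in> pts X"
  shows "mor (Comp C g f) x = mor g (mor f x)"
  using assms by (simp add: Comp_eq arrows_iff compose_eq)

lemma arrows_eqI:
  assumes "f \<in> arrows C X Y" "g \<in> arrows C X Y" "\<And>x. x \<in> pts X \<Longrightarrow> mor f x = mor g x"
  shows "f = g"
  using eqv_eqI[OF arrowsD(5)[OF assms(1)] arrowsD(5)[OF assms(2)] assms(3)]
    arrowsD(3,4)[OF assms(1)] arrowsD(3,4)[OF assms(2)]
  by (simp add: arrow.expand)

text \<open>
  The fibre product of the underlying sets carries the diagonal action. It is free if the
  factors are, so it can be realized even in a category of free sets.
\<close>

lemma ex_set_pullback:
  assumes o: "Y \<in> Obj C" "Z \<in> Obj C" and m: "eqv Y W f" "eqv Z W g"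
  obtains P p q where "P \<in> Obj C" "eqv P Y p" "eqv P Z q" "set_pullback P Y Z p q f g"
proof -
  define Q where "Q = {w \<in> pts Y \<times> pts Z. f (fst w) = g (snd w)}"
  have "finite_action H r Q (\<lambda>a (y, z). (gact Y a y, gact Z a z))"
    using o eqvD[OF m(1)] eqvD[OF m(2)] by (auto simp: finite_action_def Q_def dest: act_free)
  then obtain P j where P: "P \<in> Obj C" "bij_betw j Q (pts P)"
    "\<And>a w. a \<in> carrier H \<Longrightarrow> w \<in> Q \<Longrightarrow> gact P a (j w) = j (case w of (y, z) \<Rightarrow> (gact Y a y, gact Z a z))"
    by (rule realize_on) (rule that; assumption)
  define k where "k = inv_into Q j"
  have k: "x \<in> pts P \<Longrightarrow> k x \<in> Q" "x \<in> pts P \<Longrightarrow> j (k x) = x" "w \<in> Q \<Longrightarrow> k (j w) = w"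
    "w \<in> Q \<Longrightarrow> j w \<in> pts P" for x w
    using P(2) by (auto simp: k_def bij_betw_def inv_into_into f_inv_into_f)
  have kQ: "fst (k x) \<in> pts Y" "snd (k x) \<in> pts Z" "f (fst (k x)) = g (snd (k x))"
    if "x \<in> pts P" for x
    using k(1)[OF that] by (auto simp: Q_def)
  have kact: "k (gact P a x) = (gact Y a (fst (k x)), gact Z a (snd (k x)))"
    if a: "a \<in> carrier H" and x: "x \<in> pts P" for a x
  proof -
    have "gact P a x = j (gact Y a (fst (k x)), gact Z a (snd (k x)))"
      using P(3)[OF a k(1)[OF x]] k(2)[OF x] by (simp add: case_prod_beta)
    moreover have "(gact Y a (fst (k x)), gact Z a (snd (k x))) \<in> Q"
      using k(1)[OF x] a o eqvD[OF m(1)] eqvD[OF m(2)] by (auto simp: Q_def)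
    ultimately show ?thesis by (simp add: k(3))
  qed
  show thesis
  proof (rule that)
    show "P \<in> Obj C" by fact
    show "eqv P Y (\<lambda>x \<in> pts P. fst (k x))" "eqv P Z (\<lambda>x \<in> pts P. snd (k x))"
      using P(1) by (auto simp: eqv_def kact kQ)
    show "set_pullback P Y Z (\<lambda>x \<in> pts P. fst (k x)) (\<lambda>x \<in> pts P. snd (k x)) f g"
      unfolding set_pullback_def
    proof (intro conjI ballI impI)
      fix x assume "x \<in> pts P"
      then show "f ((\<lambda>x \<in> pts P. fst (k x)) x) = g ((\<lambda>x \<in> pts P. snd (k x)) x)"
        using k(1)[of x] by (simp add: Q_def)
    next
      fix y z assume "y \<in> pts Y" "z \<in> pts Z" "f y = g z"
      then have w: "(y, z) \<in> Q" by (simp add: Q_def)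
      show "\<exists>!x. x \<in> pts P \<and> (\<lambda>x \<in> pts P. fst (k x)) x = y \<and> (\<lambda>x \<in> pts P. snd (k x)) x = z"
      proof (rule ex1I[of _ "j (y, z)"])
        show "j (y, z) \<in> pts P \<and> (\<lambda>x \<in> pts P. fst (k x)) (j (y, z)) = y \<and>
          (\<lambda>x \<in> pts P. snd (k x)) (j (y, z)) = z"
          using k(3,4)[OF w] by simp
        fix x assume x: "x \<in> pts P \<and> (\<lambda>x \<in> pts P. fst (k x)) x = y \<and> (\<lambda>x \<in> pts P. snd (k x)) x = z"
        then have "k x = (y, z)" by (auto simp: prod_eq_iff)
        then show "x = j (y, z)" using x k(2)[of x] by simp
      qed
    qed
  qed
qed

lemma has_pullbacks: "has_pullbacks C"
  unfolding has_pullbacks_def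
proof (intro ballI impI)
  fix f g assume "f \<in> Arr C" "g \<in> Arr C" "Cod C f = Cod C g"
  then have fg: "f \<in> arrows C (src f) (tgt f)" "g \<in> arrows C (src g) (tgt f)"
    by (auto simp: arrows_iff Arr_iff)
  note f = arrowsD[OF fg(1)] and g = arrowsD[OF fg(2)]
  obtain P p q where *: "P \<in> Obj C" "eqv P (src f) p" "eqv P (src g) q"
    "set_pullback P (src f) (src g) p q (mor f) (mor g)"
    by (rule ex_set_pullback[OF f(1) g(1) f(5) g(5)])
  from is_pullbackI[OF *(1) f(1) g(1) f(2) *(2,3) f(5) g(5) *(4)]
  show "\<exists>p q. is_pullback C p q f g" unfolding f(6) g(6) by blast
qed

lemma is_coproductI:
  assumes S: "S \<in> Obj C" and \<iota>: "\<And>i. i \<in> I \<Longrightarrow> \<iota> i \<in> arrows C (X i) S"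
    and bij: "bij_betw (\<lambda>(i, x). mor (\<iota> i) x) (SIGMA i:I. pts (X i)) (pts S)"
  shows "is_coproduct C I X S \<iota>"
  unfolding is_coproduct_def
proof (intro conjI ballI allI impI)
  show "S \<in> Obj C" by fact
  show "X i \<in> Obj C" "\<iota> i \<in> arrows C (X i) S" if "i \<in> I" for i
    using \<iota>[OF that] by (auto simp: arrows_iff)
  fix T u assume T: "T \<in> Obj C" and u: "\<forall>i \<in> I. u i \<in> arrows C (X i) T"
  note \<iota>D = arrowsD[OF \<iota>] and uD = arrowsD[OF bspec[OF u]]
  define k where "k = inv_into (SIGMA i:I. pts (X i)) (\<lambda>(i, x). mor (\<iota> i) x)"
  have k: "k (mor (\<iota> i) x) = (i, x)" if "i \<in> I" "x \<in> pts (X i)" for i x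
    using bij_betw_inv_into_left[OF bij, of "(i, x)"] that by (simp add: k_def)
  define h where "h = (\<lambda>s \<in> pts S. case k s of (i, x) \<Rightarrow> mor (u i) x)"
  have h: "h (mor (\<iota> i) x) = mor (u i) x" if "i \<in> I" "x \<in> pts (X i)" for i x
    using k[OF that] eqvD(1)[OF \<iota>D(5)] that by (simp add: h_def)
  have split: "\<exists>i \<in> I. \<exists>x \<in> pts (X i). s = mor (\<iota> i) x" if "s \<in> pts S" for s
    using bij that by (fastforce simp: bij_betw_def)
  have he: "eqv S T h"
    unfolding eqv_def
  proof (intro conjI ballI)
    have "h s \<in> pts T" if s: "s \<in> pts S" for s
    proof -
      from split[OF s] obtain i x where ix: "i \<in> I" "x \<in> pts (X i)" "s = mor (\<iota> i) x" by blast
      then show ?thesis using eqvD(1)[OF uD(5)[OF ix(1)] ix(2)] by (simp add: h)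
    qed
    then show "h \<in> pts S \<rightarrow>\<^sub>E pts T" by (auto simp: h_def)
    fix g s assume g: "g \<in> carrier H" and s: "s \<in> pts S"
    from split[OF s] obtain i x where ix: "i \<in> I" "x \<in> pts (X i)" "s = mor (\<iota> i) x" by blast
    have "gact S g s = mor (\<iota> i) (gact (X i) g x)"
      using eqvD(2)[OF \<iota>D(5)[OF ix(1)] ix(2) g] ix by simp
    then show "h (gact S g s) = gact T g (h s)"
      using eqvD(2)[OF uD(5)[OF ix(1)] ix(2) g] \<iota>D(1)[OF ix(1)] g ix by (simp add: h)
  qed
  show "\<exists>!h. h \<in> arrows C S T \<and> (\<forall>i \<in> I. Comp C h (\<iota> i) = u i)"
  proof (rule ex1I[of _ "Arrow S h T"], intro conjI ballI)
    show hA: "Arrow S h T \<in> arrows C S T" using he S T by (simp add: arrows_iff)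
    fix i assume i: "i \<in> I"
    show "Comp C (Arrow S h T) (\<iota> i) = u i"
      by (rule arrows_eqI[OF Comp_in_arrows[OF \<iota>[OF i] hA] bspec[OF u i]])
         (simp add: mor_Comp_apply[OF \<iota>[OF i]] h i)
  next
    fix h' assume h': "h' \<in> arrows C S T \<and> (\<forall>i \<in> I. Comp C h' (\<iota> i) = u i)"
    show "h' = Arrow S h T"
    proof (rule arrows_eqI[OF conjunct1[OF h']])
      show "Arrow S h T \<in> arrows C S T" using he S T by (simp add: arrows_iff)
      fix s assume "s \<in> pts S"
      from split[OF this] obtain i x where ix: "i \<in> I" "x \<in> pts (X i)" "s = mor (\<iota> i) x" by blast
      have "mor (Comp C h' (\<iota> i)) x = mor (u i) x" using h' ix by simp
      then show "mor h' s = mor (Arrow S h T) s"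
        using ix by (simp add: mor_Comp_apply[OF \<iota>[OF ix(1)] ix(2)] h)
    qed
  qed
qed

lemma ex_set_coproduct:
  assumes "finite I" and X: "\<And>i. i \<in> I \<Longrightarrow> X i \<in> Obj C"
  obtains S \<iota> where "S \<in> Obj C" "\<And>i. i \<in> I \<Longrightarrow> \<iota> i \<in> arrows C (X i) S"
    "bij_betw (\<lambda>(i, x). mor (\<iota> i) x) (SIGMA i:I. pts (X i)) (pts S)"
proof -
  let ?Z = "SIGMA i:I. pts (X i)"
  have "finite_action H r ?Z (\<lambda>g (i, x). (i, gact (X i) g x))"
    using assms by (auto simp: finite_action_def dest: act_free)
  then obtain S j where S: "S \<in> Obj C" "bij_betw j ?Z (pts S)"
    "\<And>g w. g \<in> carrier H \<Longrightarrow> w \<in> ?Z \<Longrightarrow> gact S g (j w) = j (case w of (i, x) \<Rightarrow> (i, gact (X i) g x))"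
    by (rule realize_on) (rule that; assumption)
  let ?\<iota> = "\<lambda>i. Arrow (X i) (\<lambda>x \<in> pts (X i). j (i, x)) S"
  have "j (i, x) \<in> pts S" if "i \<in> I" "x \<in> pts (X i)" for i x
    using that bij_betwE[OF S(2)] by blast
  moreover have "gact S g (j (i, x)) = j (i, gact (X i) g x)"
    if "g \<in> carrier H" "i \<in> I" "x \<in> pts (X i)" for g i x
    using that S(3)[of g "(i, x)"] by simp
  ultimately have "?\<iota> i \<in> arrows C (X i) S" if "i \<in> I" for i
    using that S(1) X[OF that] by (auto simp: arrows_iff eqv_def)
  moreover have "bij_betw (\<lambda>(i, x). mor (?\<iota> i) x) ?Z (pts S)"
    by (rule bij_betw_cong[THEN iffD1, OF _ S(2)]) auto
  ultimately show thesis using S(1) by (intro that[of S ?\<iota>])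
qed

lemma has_finite_coproducts: "has_finite_coproducts C"
  unfolding has_finite_coproducts_def
proof (intro allI impI)
  fix I :: "nat set" and X assume "finite I \<and> X \<in> I \<rightarrow> Obj C"
  then have IX: "finite I" "\<And>i. i \<in> I \<Longrightarrow> X i \<in> Obj C" by auto
  obtain S \<iota> where "S \<in> Obj C" "\<And>i. i \<in> I \<Longrightarrow> \<iota> i \<in> arrows C (X i) S"
    "bij_betw (\<lambda>(i, x). mor (\<iota> i) x) (SIGMA i:I. pts (X i)) (pts S)"
    by (rule ex_set_coproduct[of I X, OF IX], assumption) (rule that; assumption)
  from is_coproductI[where S = S and I = I and \<iota> = \<iota> and X = X, OF this]
    show "\<exists>S \<iota>. is_coproduct C I X S \<iota>" by blast
qed

lemma is_coproductD:
  assumes "is_coproduct C I X S \<iota>"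
  shows "S \<in> Obj C" "i \<in> I \<Longrightarrow> X i \<in> Obj C" "i \<in> I \<Longrightarrow> \<iota> i \<in> arrows C (X i) S"
    "T \<in> Obj C \<Longrightarrow> \<forall>i \<in> I. u i \<in> arrows C (X i) T \<Longrightarrow>
      \<exists>!h. h \<in> arrows C S T \<and> (\<forall>i \<in> I. Comp C h (\<iota> i) = u i)"
  using assms unfolding is_coproduct_def by auto

lemma is_coproduct_comp_eq_Id:
  assumes S: "is_coproduct C I X S \<iota>" and h: "h \<in> arrows C S T" "k \<in> arrows C T S"
    and hk: "\<And>i. i \<in> I \<Longrightarrow> Comp C h (\<iota> i) = \<iota>' i" "\<And>i. i \<in> I \<Longrightarrow> Comp C k (\<iota>' i) = \<iota> i"
  shows "Comp C k h = Id C S"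
proof -
  note D = is_coproductD[OF S]
  have "Comp C k h \<in> arrows C S S \<and> (\<forall>i \<in> I. Comp C (Comp C k h) (\<iota> i) = \<iota> i)"
    using h D(3) hk by (auto intro: Comp_in_arrows simp: Comp_assoc[OF D(3) h])
  moreover have "Id C S \<in> arrows C S S \<and> (\<forall>i \<in> I. Comp C (Id C S) (\<iota> i) = \<iota> i)"
    using D(1,3) by (auto intro: Id_in_arrows Id_Comp)
  moreover have "\<exists>!h. h \<in> arrows C S S \<and> (\<forall>i \<in> I. Comp C h (\<iota> i) = \<iota> i)"
    using D by blast
  ultimately show ?thesis by blast
qed

text \<open>
  Any two coproducts of the same family are isomorphic, and for the one built on the disjoint union
  the claim holds by construction.
\<close>

lemma is_coproduct_bij:
  assumes S: "is_coproduct C I X S \<iota>" and "finite I"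
  shows "bij_betw (\<lambda>(i, x). mor (\<iota> i) x) (SIGMA i:I. pts (X i)) (pts S)"
proof -
  note D = is_coproductD[OF S]
  obtain S' \<iota>' where S': "S' \<in> Obj C" "\<And>i. i \<in> I \<Longrightarrow> \<iota>' i \<in> arrows C (X i) S'"
    and bij: "bij_betw (\<lambda>(i, x). mor (\<iota>' i) x) (SIGMA i:I. pts (X i)) (pts S')"
    by (rule ex_set_coproduct[of I X, OF assms(2) D(2)], assumption) (rule that; assumption)
  have co': "is_coproduct C I X S' \<iota>'"
    by (rule is_coproductI[where S = S' and I = I and \<iota> = \<iota>' and X = X, OF S' bij])
  obtain h where h: "h \<in> arrows C S S'" "\<And>i. i \<in> I \<Longrightarrow> Comp C h (\<iota> i) = \<iota>' i"
    using D(4)[OF S'(1), of \<iota>'] S'(2) by blast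
  obtain k where k: "k \<in> arrows C S' S" "\<And>i. i \<in> I \<Longrightarrow> Comp C k (\<iota>' i) = \<iota> i"
    using is_coproductD(4)[OF co' D(1), of \<iota>] D(3) by blast
  have id: "Comp C k h = Id C S" "Comp C h k = Id C S'"
    using is_coproduct_comp_eq_Id[where \<iota>' = \<iota>', OF S h(1) k(1) h(2) k(2)]
      is_coproduct_comp_eq_Id[where \<iota>' = \<iota>, OF co' k(1) h(1) k(2) h(2)] by blast+
  have "bij_betw (mor k) (pts S') (pts S)"
  proof (rule bij_betw_byWitness[of _ "mor h"])
    show "\<forall>a \<in> pts S'. mor h (mor k a) = a" "\<forall>a \<in> pts S. mor k (mor h a) = a"
      using id by (auto simp: Id_eq simp flip: mor_Comp_apply[OF k(1)] mor_Comp_apply[OF h(1)])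
    show "mor k ` pts S' \<subseteq> pts S" "mor h ` pts S \<subseteq> pts S'"
      using eqvD(1)[OF arrowsD(5)[OF k(1)]] eqvD(1)[OF arrowsD(5)[OF h(1)]] by auto
  qed
  from bij_betw_trans[OF bij this]
  have "bij_betw (mor k \<circ> (\<lambda>(i, x). mor (\<iota>' i) x)) (SIGMA i:I. pts (X i)) (pts S)" .
  moreover have "(mor k \<circ> (\<lambda>(i, x). mor (\<iota>' i) x)) w = (\<lambda>(i, x). mor (\<iota> i) x) w"
    if w: "w \<in> (SIGMA i:I. pts (X i))" for w
  proof (cases w)
    case (Pair i x)
    then have i: "i \<in> I" "x \<in> pts (X i)" using w by auto
    show ?thesis using k(2)[OF i(1)] mor_Comp_apply[OF S'(2)[OF i(1)] i(2), of k] Pair by simp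
  qed
  ultimately show ?thesis
    using bij_betw_cong[of "SIGMA i:I. pts (X i)" "mor k \<circ> (\<lambda>(i, x). mor (\<iota>' i) x)"
      "\<lambda>(i, x). mor (\<iota> i) x" "pts S"] by simp
qed

lemma is_epiI:
  assumes f: "f \<in> arrows C Y W" and surj: "mor f ` pts Y = pts W"
  shows "is_epi C f"
  unfolding is_epi_def
proof (intro conjI allI ballI impI)
  show "f \<in> Arr C" using f by (simp add: arrows_def)
  fix T g h assume gh: "g \<in> arrows C (Cod C f) T" "h \<in> arrows C (Cod C f) T"
    and eq: "Comp C g f = Comp C h f"
  then have gh': "g \<in> arrows C W T" "h \<in> arrows C W T" using arrowsD[OF f] by auto
  show "g = h"
  proof (rule arrows_eqI[OF gh'])
    fix w assume "w \<in> pts W"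
    then obtain y where y: "y \<in> pts Y" "w = mor f y" using surj by blast
    then show "mor g w = mor h w" using eq by (simp flip: mor_Comp_apply[OF f])
  qed
qed

text \<open>
  If \<open>f\<close> misses points of \<open>W\<close>, then two maps from \<open>W\<close> to the sum of two copies of \<open>W\<close>
  agree on the image of \<open>f\<close> and differ elsewhere. This is equivariant since the complement of
  the image is stable, and it stays within the free sets.
\<close>

lemma is_epi_surj:
  assumes "is_epi C f" and f: "f \<in> arrows C Y W"
  shows "mor f ` pts Y = pts W"
proof
  note fD = arrowsD[OF f]
  show "mor f ` pts Y \<subseteq> pts W" using eqvD(1)[OF fD(5)] by auto
  show "pts W \<subseteq> mor f ` pts Y"
  proof
    obtain S \<iota> where S: "S \<in> Obj C" "\<And>i. i \<in> {0, 1::nat} \<Longrightarrow> \<iota> i \<in> arrows C W S"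
      and bij: "bij_betw (\<lambda>(i, x). mor (\<iota> i) x) (SIGMA i:{0, 1}. pts W) (pts S)"
      using fD(2) by (elim ex_set_coproduct[of "{0, 1::nat}" "\<lambda>_. W", rotated 2]) auto
    have a: "\<iota> 0 \<in> arrows C W S" and b: "\<iota> 1 \<in> arrows C W S" using S(2) by auto
    define m where "m = (\<lambda>w \<in> pts W. if w \<in> mor f ` pts Y then mor (\<iota> 0) w else mor (\<iota> 1) w)"
    have im: "gact W g w \<in> mor f ` pts Y" if "g \<in> carrier H" "w \<in> mor f ` pts Y" for g w
      using that eqvD(2)[OF fD(5)] act_simps(3)[OF fD(1)] by (force simp flip: eqvD(2)[OF fD(5)])
    have im_iff: "gact W g w \<in> mor f ` pts Y \<longleftrightarrow> w \<in> mor f ` pts Y"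
      if "g \<in> carrier H" "w \<in> pts W" for g w
      using im[OF that(1), of w] im[of "inv g" "gact W g w"] that fD(2) by auto
    have "eqv W S m"
      unfolding eqv_def m_def
      using fD(2) eqvD[OF arrowsD(5)[OF a]] eqvD[OF arrowsD(5)[OF b]] by (auto simp: im_iff)
    then have m: "Arrow W m S \<in> arrows C W S" using fD(2) S(1) by (simp add: arrows_iff)
    have "Comp C (Arrow W m S) f = Comp C (\<iota> 0) f"
    proof (rule arrows_eqI[OF Comp_in_arrows[OF f m] Comp_in_arrows[OF f a]])
      fix y assume y: "y \<in> pts Y"
      then show "mor (Comp C (Arrow W m S) f) y = mor (Comp C (\<iota> 0) f) y"
        using eqvD(1)[OF fD(5) y] by (simp add: mor_Comp_apply[OF f] m_def)
    qed
    then have eq: "Arrow W m S = \<iota> 0"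
      using assms(1) m a fD unfolding is_epi_def by auto
    fix w assume w: "w \<in> pts W"
    show "w \<in> mor f ` pts Y"
    proof (rule ccontr)
      assume "w \<notin> mor f ` pts Y"
      then have "m w = mor (\<iota> 1) w" using w by (simp add: m_def)
      moreover have "m w = mor (\<iota> 0) w" using eq by (metis arrow.sel(2))
      ultimately have "mor (\<iota> 1) w = mor (\<iota> 0) w" by simp
      then have "(1::nat, w) = (0, w)"
        using bij w by (intro inj_onD[OF bij_betw_imp_inj_on[OF bij]]) auto
      then show False by simp
    qed
  qed
qed

text \<open>
  A finite coproduct of copies of the regular set, one for each point \<open>y\<close> of \<open>Y\<close>, maps onto \<open>Y\<close> by
  the maps \<open>ev Y y\<close>. Thus a functor that preserves finite coproducts and epimorphisms is controlled
  by its value at the regular set. The index set consists of natural numbers because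
  preservation of coproducts is stated for such families.
\<close>

lemma ex_regular_cover:
  assumes Y: "Y \<in> Obj C"
  obtains I :: "nat set" and S \<iota> x c where "finite I" "is_coproduct C I (\<lambda>_. reg) S \<iota>"
    "c \<in> arrows C S Y" "is_epi C c" "\<And>i. i \<in> I \<Longrightarrow> x i \<in> pts Y"
    "\<And>i. i \<in> I \<Longrightarrow> Comp C c (\<iota> i) = Arrow reg (ev Y (x i)) Y"
proof -
  define I where "I = {..<card (pts Y)}"
  have "finite I" by (simp add: I_def)
  obtain x where x: "bij_betw x I (pts Y)"
    using ex_bij_betw_nat_finite[of "pts Y"] Y by (auto simp: I_def atLeast0LessThan)
  then have xY: "x i \<in> pts Y" if "i \<in> I" for i using that by (auto dest: bij_betwE)
  obtain S \<iota> where S: "S \<in> Obj C" "\<And>i. i \<in> I \<Longrightarrow> \<iota> i \<in> arrows C reg S"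
    and bij: "bij_betw (\<lambda>(i, x). mor (\<iota> i) x) (SIGMA i:I. pts reg) (pts S)"
    by (rule ex_set_coproduct[OF \<open>finite I\<close> reg_base(1)]) (rule that; assumption)
  have co: "is_coproduct C I (\<lambda>_. reg) S \<iota>"
    by (rule is_coproductI[where S = S and I = I and \<iota> = \<iota> and X = "\<lambda>_. reg", OF S bij])
  have "\<forall>i \<in> I. Arrow reg (ev Y (x i)) Y \<in> arrows C reg Y" using xY Y by (simp add: arrows_iff)
  then obtain c where c: "c \<in> arrows C S Y"
    "\<And>i. i \<in> I \<Longrightarrow> Comp C c (\<iota> i) = Arrow reg (ev Y (x i)) Y"
    using is_coproductD(4)[OF co Y, of "\<lambda>i. Arrow reg (ev Y (x i)) Y"] by blast
  have "y \<in> mor c ` pts S" if y: "y \<in> pts Y" for y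
  proof -
    obtain i where i: "i \<in> I" "y = x i" using y x by (auto simp: bij_betw_def)
    then have "mor c (mor (\<iota> i) base) = y"
      using arg_cong[OF c(2)[OF i(1)], of "\<lambda>f. mor f base"] Y xY
      by (simp add: mor_Comp_apply[OF S(2)[OF i(1)]])
    moreover have "mor (\<iota> i) base \<in> pts S" using eqvD(1)[OF arrowsD(5)[OF S(2)[OF i(1)]]] by simp
    ultimately show ?thesis by blast
  qed
  then have "is_epi C c"
    using eqvD(1)[OF arrowsD(5)[OF c(1)]] by (intro is_epiI[OF c(1)]) blast
  from that[OF \<open>finite I\<close> co c(1) this xY c(2)] show thesis .
qed

end

section \<open>Functors to finite sets\<close>

definition trivial_group :: "unit monoid" where
  "trivial_group = \<lparr>carrier = UNIV, mult = (\<lambda>_ _. ()), one = ()\<rparr>"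

text \<open>
  With this instance, the preservation properties of a functor to finite sets can be read off on
  elements.
\<close>

lemma gset_model_Fin_cat:
  assumes "infinite (UNIV :: 'c set)"
  shows "gset_model trivial_group False
    (Fin_cat :: ('c set, ('c set, 'c \<Rightarrow> 'c) arrow) cat) (\<lambda>X. X) (\<lambda>X g x. x)"
proof -
  interpret group trivial_group
    by (rule groupI) (simp_all add: trivial_group_def)
  show ?thesis
    by unfold_locales
       (auto simp: trivial_group_def Fin_cat_def finite_action_def assms)
qed

context gset_model
begin

definition pt :: "'o \<Rightarrow> 'a \<Rightarrow> ('o, 'a \<Rightarrow> 'a) arrow" where
  "pt X x = Arrow reg (ev X x) X"

lemma pt_arrow: "X \<in> Obj C \<Longrightarrow> x \<in> pts X \<Longrightarrow> pt X x \<in> arrows C reg X"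
  by (simp add: pt_def arrows_iff)

lemma mor_pt: "mor (pt X x) = ev X x"
  by (simp add: pt_def)

lemma Comp_pt:
  assumes "f \<in> arrows C X Y" "x \<in> pts X"
  shows "Comp C f (pt X x) = pt Y (mor f x)"
  using arrowsD[OF assms(1)] eqv_comp_ev[of X Y "mor f" x] assms(2)
  by (simp add: pt_def Comp_eq)

text \<open>
  The arrows \<open>pt reg (gact reg g base)\<close> are the right multiplications of the regular set.
  Precomposing with them moves the point.
\<close>

lemma Comp_pt_pt:
  assumes "X \<in> Obj C" "x \<in> pts X" "g \<in> carrier H"
  shows "Comp C (pt X x) (pt reg (gact reg g base)) = pt X (gact X g x)"
  using assms by (simp add: Comp_pt[OF pt_arrow] mor_pt)

lemma pt_base: "pt reg base = Id C reg"
  using eqv_reg_eq_ev[OF reg_base(1) eqv_id[OF reg_base(1)]] by (simp add: pt_def Id_eq)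

end

locale pce_functor_to_Fin = gset_model H r C pts gact +
    Fin: gset_model trivial_group False "Fin_cat :: ('c set, ('c set, 'c \<Rightarrow> 'c) arrow) cat"
      "\<lambda>X. X" "\<lambda>X g x. x"
  for H :: "('g, 'z) monoid_scheme" (structure) and r
    and C :: "('o, ('o, 'a \<Rightarrow> 'a) arrow) cat" and pts gact +
  fixes F :: "('o, ('o, 'a \<Rightarrow> 'a) arrow, 'c set, ('c set, 'c \<Rightarrow> 'c) arrow) ftor"
  assumes pce: "pce_functor C Fin_cat F"
begin

lemma F: "is_functor C Fin_cat F"
  using pce by (simp add: pce_functor_def)

definition app :: "('o, 'a \<Rightarrow> 'a) arrow \<Rightarrow> 'c \<Rightarrow> 'c" where
  "app f = mor (AMap F f)"

lemma app_in: "f \<in> arrows C X Y \<Longrightarrow> t \<in> OMap F X \<Longrightarrow> app f t \<in> OMap F Y"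
  unfolding app_def
  using Fin.eqvD(1)[OF Fin.arrowsD(5)[OF is_functor_arrows[OF F]]] .

lemma app_Comp:
  assumes "f \<in> arrows C X Y" "g \<in> arrows C Y Z" "t \<in> OMap F X"
  shows "app (Comp C g f) t = app g (app f t)"
  unfolding app_def using assms is_functorD(10)[OF F, of f g]
    Fin.mor_Comp_apply[OF is_functor_arrows[OF F assms(1)] assms(3)]
  by (simp add: arrows_def)

lemma app_Id:
  assumes "X \<in> Obj C" "t \<in> OMap F X"
  shows "app (Id C X) t = t"
  unfolding app_def using assms is_functorD(9)[OF F assms(1)] by (simp add: Fin.Id_eq)

lemma app_pullback:
  assumes pb: "is_pullback C p q f g"
  shows "t \<in> OMap F (src f) \<Longrightarrow> t' \<in> OMap F (src g) \<Longrightarrow> app f t = app g t' \<Longrightarrow>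
      \<exists>s \<in> OMap F (src p). app p s = t \<and> app q s = t'"
    and "s \<in> OMap F (src p) \<Longrightarrow> s' \<in> OMap F (src p) \<Longrightarrow> app p s = app p s' \<Longrightarrow>
      app q s = app q s' \<Longrightarrow> s = s'"
proof -
  have "is_pullback Fin_cat (AMap F p) (AMap F q) (AMap F f) (AMap F g)"
    using pce pb by (auto simp: pce_functor_def preserves_pullbacks_def)
  then obtain P Y Z W p' q' f' g' where e:
    "AMap F p = Arrow P p' Y" "AMap F q = Arrow P q' Z" "AMap F f = Arrow Y f' W"
      "AMap F g = Arrow Z g' W"
    and m: "Fin.eqv P Y p'" "Fin.eqv P Z q'"
    and sp: "Fin.set_pullback P Y Z p' q' f' g'"
    by (rule Fin.is_pullbackE)
  have "p \<in> Arr C" "f \<in> Arr C" "g \<in> Arr C" using pb by (auto simp: is_pullback_def)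
  then have o: "OMap F (src p) = P" "OMap F (src f) = Y" "OMap F (src g) = Z"
    using is_functorD(7)[OF F, of p] is_functorD(7)[OF F, of f] is_functorD(7)[OF F, of g] e
    by (simp_all add: Arr_iff)
  note sp' = sp[unfolded Fin.set_pullback_def]
  show "\<exists>s \<in> OMap F (src p). app p s = t \<and> app q s = t'"
    if "t \<in> OMap F (src f)" "t' \<in> OMap F (src g)" "app f t = app g t'"
    using that sp' unfolding app_def o e arrow.sel by blast
  show "s = s'"
    if s: "s \<in> OMap F (src p)" "s' \<in> OMap F (src p)" "app p s = app p s'" "app q s = app q s'"
  proof -
    have s': "s \<in> P" "s' \<in> P" "p' s = p' s'" "q' s = q' s'" using s
      unfolding app_def o e arrow.sel by auto
    have "p' s \<in> Y" "q' s \<in> Z" using Fin.eqvD(1)[OF m(1)] Fin.eqvD(1)[OF m(2)] s' by auto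
    moreover have "f' (p' s) = g' (q' s)" using sp' s'(1) by blast
    ultimately have "\<exists>!x. x \<in> P \<and> p' x = p' s \<and> q' x = q' s" using sp' by blast
    then show ?thesis using s' by (metis (no_types))
  qed
qed

lemma app_coproduct:
  assumes co: "is_coproduct C I X S \<iota>" and "finite (I :: nat set)"
  shows "bij_betw (\<lambda>(i, t). app (\<iota> i) t) (SIGMA i:I. OMap F (X i)) (OMap F S)"
proof -
  have "is_coproduct Fin_cat I (\<lambda>i. OMap F (X i)) (OMap F S) (\<lambda>i. AMap F (\<iota> i))"
    using pce assms by (auto simp: pce_functor_def preserves_finite_coproducts_def)
  from Fin.is_coproduct_bij[OF this assms(2)] show ?thesis by (simp add: app_def)
qed

lemma app_epi:
  assumes "is_epi C f" "f \<in> arrows C X Y"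
  shows "app f ` OMap F X = OMap F Y"
proof -
  have "is_epi Fin_cat (AMap F f)"
    using pce assms by (auto simp: pce_functor_def preserves_epis_def)
  from Fin.is_epi_surj[OF this is_functor_arrows[OF F assms(2)]] show ?thesis
    by (simp add: app_def)
qed

text \<open>
  A regular cover of \<open>Y\<close> is an epimorphism from a coproduct, and \<open>F\<close> turns this into a family of
  maps out of \<open>F reg\<close> that are jointly onto.
\<close>

lemma elements:
  assumes Y: "Y \<in> Obj C" and t: "t \<in> OMap F Y"
  obtains y u where "y \<in> pts Y" "u \<in> OMap F reg" "t = app (pt Y y) u"
proof -
  obtain I :: "nat set" and S \<iota> x c where cov: "finite I" "is_coproduct C I (\<lambda>_. reg) S \<iota>"
    "c \<in> arrows C S Y" "is_epi C c" "\<And>i. i \<in> I \<Longrightarrow> x i \<in> pts Y"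
    "\<And>i. i \<in> I \<Longrightarrow> Comp C c (\<iota> i) = Arrow reg (ev Y (x i)) Y"
    by (rule ex_regular_cover[OF Y]) (rule that; assumption)
  obtain s where s: "s \<in> OMap F S" "t = app c s"
    using app_epi[OF cov(4,3)] t by blast
  obtain i u where iu: "i \<in> I" "u \<in> OMap F reg" "s = app (\<iota> i) u"
    using app_coproduct[OF cov(2,1)] s(1) by (fastforce simp: bij_betw_def)
  have "t = app (pt Y (x i)) u"
    using app_Comp[OF is_coproductD(3)[OF cov(2) iu(1)] cov(3) iu(2)] cov(6)[OF iu(1)] s iu
    by (simp add: pt_def)
  with cov(5) iu show thesis using that by blast
qed

text \<open>
  The action of the opposite group on \<open>F reg\<close>, induced by right multiplications.
\<close>

definition rmul :: "'g \<Rightarrow> 'c \<Rightarrow> 'c" where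
  "rmul g = app (pt reg (gact reg g base))"

lemma app_pt_rmul:
  assumes "X \<in> Obj C" "x \<in> pts X" "g \<in> carrier H" "u \<in> OMap F reg"
  shows "app (pt X x) (rmul g u) = app (pt X (gact X g x)) u"
  using assms app_Comp[OF pt_arrow[of reg "gact reg g base"] pt_arrow[of X x], of u]
  by (simp add: rmul_def Comp_pt_pt)

lemma app_app_pt:
  assumes "f \<in> arrows C X Y" "x \<in> pts X" "u \<in> OMap F reg"
  shows "app f (app (pt X x) u) = app (pt Y (mor f x)) u"
  using assms arrowsD(1)[OF assms(1)] app_Comp[OF pt_arrow[of X x] assms(1), of u]
  by (simp add: Comp_pt)

text \<open>
  The elements \<open>t\<close> and \<open>t'\<close> are the projections of an element of \<open>F E\<close>, where \<open>E\<close> is the pullback of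
  \<open>ev Y y\<close> and \<open>ev Y y'\<close>. By \<open>elements\<close> that element comes from some \<open>u\<close> and a point of \<open>E\<close>, which
  is a pair \<open>(g, h)\<close> with \<open>g y = h y'\<close>.
\<close>

lemma eq_translates:
  assumes Y: "Y \<in> Obj C" and y: "y \<in> pts Y" "y' \<in> pts Y" and t: "t \<in> OMap F reg" "t' \<in> OMap F reg"
    and eq: "app (pt Y y) t = app (pt Y y') t'"
  obtains g h u where "g \<in> carrier H" "h \<in> carrier H" "u \<in> OMap F reg"
    "t = rmul g u" "t' = rmul h u" "gact Y g y = gact Y h y'"
proof -
  have "Cod C (pt Y y) = Cod C (pt Y y')" "pt Y y \<in> Arr C" "pt Y y' \<in> Arr C"
    using pt_arrow[OF Y y(1)] pt_arrow[OF Y y(2)] by (auto simp: arrows_def)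
  then obtain p q where pb: "is_pullback C p q (pt Y y) (pt Y y')"
    using has_pullbacks unfolding has_pullbacks_def by blast
  define E where "E = src p"
  have pq: "p \<in> arrows C E reg" "q \<in> arrows C E reg"
    and comm: "Comp C (pt Y y) p = Comp C (pt Y y') q"
    using pb by (auto simp: is_pullback_def arrows_def E_def pt_def)
  obtain s where s: "s \<in> OMap F E" "app p s = t" "app q s = t'"
    using app_pullback(1)[OF pb, of t t'] t eq by (auto simp: E_def pt_def)
  have E: "E \<in> Obj C" using arrowsD(1)[OF pq(1)] .
  obtain w u where w: "w \<in> pts E" "u \<in> OMap F reg" "s = app (pt E w) u"
    by (rule elements[OF E s(1)])
  have "mor p w \<in> pts reg" "mor q w \<in> pts reg"
    using eqvD(1)[OF arrowsD(5)[OF pq(1)]] eqvD(1)[OF arrowsD(5)[OF pq(2)]] w(1) by auto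
  then obtain g h where gh: "g \<in> carrier H" "mor p w = gact reg g base"
      "h \<in> carrier H" "mor q w = gact reg h base"
    by (auto elim!: regE)
  have "ev Y y (mor p w) = ev Y y' (mor q w)"
    using arg_cong[OF comm, of "\<lambda>f. mor f w"] pq w(1)
    by (simp add: mor_Comp_apply[OF pq(1)] mor_Comp_apply[OF pq(2)] mor_pt)
  then have "gact Y g y = gact Y h y'" using gh by simp
  moreover have "t = rmul g u" "t' = rmul h u"
    using s(2,3) w gh app_app_pt[OF pq(1) w(1,2)] app_app_pt[OF pq(2) w(1,2)]
      by (simp_all add: rmul_def)
  ultimately show thesis using that gh w(2) by blast
qed

text \<open>
  Let \<open>g\<close> fix \<open>u\<close>. The points \<open>c = (g, 1)\<close> and \<open>d = (1, 1)\<close> of \<open>R \<times> R\<close> give two elements of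
  \<open>F (R \<times> R)\<close> whose projections are both \<open>u\<close>, so these elements coincide, and \<open>eq_translates\<close> gives
  \<open>a c = b d\<close> for some group elements. The second coordinates show \<open>a = b\<close>, hence \<open>c = d\<close> and \<open>g = 1\<close>.
  The product is formed as the pullback over a one-point set, and this is why all \<open>H\<close>-sets have
  to be available.
\<close>

lemma rmul_free:
  assumes r: "\<not> r" and g: "g \<in> carrier H" and u: "u \<in> OMap F reg" and fixed: "rmul g u = u"
  shows "g = \<one>"
proof (rule ccontr)
  assume g1: "g \<noteq> \<one>"
  \<comment> \<open>The point \<open>base\<close> merely names the element of the one-point set.\<close>
  have "finite_action H r {base} (\<lambda>_ z. z)" using r by (auto simp: finite_action_def)
  from realize[OF this] obtain T where T: "T \<in> Obj C" "pts T = {base}"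
    "\<forall>g \<in> carrier H. \<forall>z \<in> {base}. gact T g z = z" by blast
  define t where "t = (\<lambda>x \<in> pts reg. base)"
  have t: "eqv reg T t" using T by (auto simp: eqv_def t_def)
  obtain P p q where P: "P \<in> Obj C" "eqv P reg p" "eqv P reg q" "set_pullback P reg reg p q t t"
    by (rule ex_set_pullback[OF reg_base(1) reg_base(1) t t])
  have pb: "is_pullback C (Arrow P p reg) (Arrow P q reg) (Arrow reg t T) (Arrow reg t T)"
    by (rule is_pullbackI[OF P(1) reg_base(1) reg_base(1) T(1) P(2,3) t t P(4)])
  have pA: "Arrow P p reg \<in> arrows C P reg" "Arrow P q reg \<in> arrows C P reg"
    using P by (simp_all add: arrows_iff)
  have ge: "gact reg g base \<in> pts reg" using g by simp
  have "\<exists>!x. x \<in> pts P \<and> p x = y \<and> q x = z" if "y \<in> pts reg" "z \<in> pts reg" for y z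
    using P(4) that unfolding set_pullback_def by (simp add: t_def)
  then obtain c d where c: "c \<in> pts P" "p c = gact reg g base" "q c = base"
    and d: "d \<in> pts P" "p d = base" "q d = base"
    using ge reg_base(2) by meson
  have u': "app (pt reg base) u = u" using app_Id[OF reg_base(1) u] by (simp add: pt_base)
  have "app (pt P c) u = app (pt P d) u"
  proof (rule app_pullback(2)[OF pb])
    show "app (pt P c) u \<in> OMap F (src (Arrow P p reg))"
      "app (pt P d) u \<in> OMap F (src (Arrow P p reg))"
      using app_in[OF pt_arrow[of P c] u] app_in[OF pt_arrow[of P d] u] P(1) c(1) d(1) by simp_all
    show "app (Arrow P p reg) (app (pt P c) u) = app (Arrow P p reg) (app (pt P d) u)"
      using fixed u' c d u by (simp add: app_app_pt[OF pA(1)] rmul_def)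
    show "app (Arrow P q reg) (app (pt P c) u) = app (Arrow P q reg) (app (pt P d) u)"
      using c d u by (simp add: app_app_pt[OF pA(2)])
  qed
  then obtain a b where ab: "a \<in> carrier H" "b \<in> carrier H" "gact P a c = gact P b d"
    by (rule eq_translates[OF P(1) c(1) d(1) u u]) blast
  have "gact reg a base = gact reg b base"
    using eqvD(2)[OF P(3)] ab c d by metis
  then have "a = b" using ab reg_inj by blast
  then have "gact P (inv a) (gact P a c) = gact P (inv a) (gact P a d)" using ab(3) by metis
  then have "c = d" using act_inv(2)[OF P(1) c(1) ab(1)] act_inv(2)[OF P(1) d(1) ab(1)] by simp
  then have "gact reg g base = gact reg \<one> base" using c d by simp
  then show False using reg_inj[OF g one_closed] g1 by blast
qed

lemma finite_action_rmul: "finite_action (opposite_group H) (\<not> r) (OMap F reg) rmul"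
  unfolding finite_action_def
proof (intro conjI ballI impI)
  show "finite (OMap F reg)" using is_functorD(5)[OF F reg_base(1)] by (rule Fin.act_simps(1))
  show "rmul \<one>\<^bsub>opposite_group H\<^esub> u = u" if "u \<in> OMap F reg" for u
    using app_Id[OF reg_base(1) that] by (simp add: opposite_group_def rmul_def pt_base)
  show "rmul g u \<in> OMap F reg" if "g \<in> carrier (opposite_group H)" "u \<in> OMap F reg" for g u
    using that app_in[OF pt_arrow[of reg "gact reg g base"], of u]
      by (simp add: opposite_group_def rmul_def)
  show "rmul (g \<otimes>\<^bsub>opposite_group H\<^esub> h) u = rmul g (rmul h u)"
    if "g \<in> carrier (opposite_group H)" "h \<in> carrier (opposite_group H)" "u \<in> OMap F reg" for g h u
    using that app_pt_rmul[of reg "gact reg g base" h u]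
    by (simp add: opposite_group_def rmul_def[of g] rmul_def[of "h \<otimes> g"])
  show "g = \<one>\<^bsub>opposite_group H\<^esub>"
    if "\<not> r" "g \<in> carrier (opposite_group H)" "u \<in> OMap F reg" "rmul g u = u" for g u
    using that rmul_free by (simp add: opposite_group_def)
qed

end

section \<open>Tensor products of sets with a group action\<close>

text \<open>
  \<open>q X Y x y\<close> is the tensor \<open>x \<otimes> y\<close>. The index \<open>\<not> r\<close> says that exactly one of the two categories is
  restricted to free sets. Since \<open>actB\<close> is an action of the opposite group, it is written as a
  right action in the explanations below.
\<close>

locale tensor_pairing =
    A: gset_model H r A ptsA actA +
    B: gset_model "opposite_group H" "\<not> r" B ptsB actB +
    Fin: gset_model trivial_group False "Fin_cat :: ('c set, ('c set, 'c \<Rightarrow> 'c) arrow) cat"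
      "\<lambda>X. X" "\<lambda>X g x. x"
  for H :: "('g, 'z) monoid_scheme" and r
    and A :: "('p, ('p, 'b \<Rightarrow> 'b) arrow) cat" and ptsA actA
    and B :: "('o, ('o, 'a \<Rightarrow> 'a) arrow) cat" and ptsB actB +
  fixes P :: "('o \<times> 'p, ('o, 'a \<Rightarrow> 'a) arrow \<times> ('p, 'b \<Rightarrow> 'b) arrow,
      'c set, ('c set, 'c \<Rightarrow> 'c) arrow) ftor"
    and q :: "'o \<Rightarrow> 'p \<Rightarrow> 'a \<Rightarrow> 'b \<Rightarrow> 'c"
  assumes P: "is_functor (prod_category B A) Fin_cat P"
    and q_image: "X \<in> Obj B \<Longrightarrow> Y \<in> Obj A \<Longrightarrow>
      OMap P (X, Y) = (\<lambda>(x, y). q X Y x y) ` (ptsB X \<times> ptsA Y)"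
    and q_eq_iff: "X \<in> Obj B \<Longrightarrow> Y \<in> Obj A \<Longrightarrow> x \<in> ptsB X \<Longrightarrow> y \<in> ptsA Y \<Longrightarrow>
      x' \<in> ptsB X \<Longrightarrow> y' \<in> ptsA Y \<Longrightarrow>
      q X Y x y = q X Y x' y' \<longleftrightarrow> (\<exists>g \<in> carrier H. x = actB X g x' \<and> y' = actA Y g y)"
    and mor_q: "f \<in> arrows B X X' \<Longrightarrow> h \<in> arrows A Y Y' \<Longrightarrow> x \<in> ptsB X \<Longrightarrow> y \<in> ptsA Y \<Longrightarrow>
      mor (AMap P (f, h)) (q X Y x y) = q X' Y' (mor f x) (mor h y)"
begin

lemma actB_simps:
  assumes "X \<in> Obj B" "x \<in> ptsB X"
  shows "g \<in> carrier H \<Longrightarrow> actB X g x \<in> ptsB X" "actB X \<one>\<^bsub>H\<^esub> x = x"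
  using B.act_simps[OF assms(1)] assms(2) by (simp_all add: opposite_group_def)

lemma eqvB:
  assumes "f \<in> arrows B X X'" "x \<in> ptsB X"
  shows "mor f x \<in> ptsB X'" "g \<in> carrier H \<Longrightarrow> mor f (actB X g x) = actB X' g (mor f x)"
  using B.eqvD[OF B.arrowsD(5)[OF assms(1)] assms(2)] by (simp_all add: opposite_group_def)

lemma eqvA:
  assumes "f \<in> arrows A Y Y'" "y \<in> ptsA Y"
  shows "mor f y \<in> ptsA Y'" "g \<in> carrier H \<Longrightarrow> mor f (actA Y g y) = actA Y' g (mor f y)"
  using A.eqvD[OF A.arrowsD(5)[OF assms(1)] assms(2)] by simp_all

lemma q_in: "X \<in> Obj B \<Longrightarrow> Y \<in> Obj A \<Longrightarrow> x \<in> ptsB X \<Longrightarrow> y \<in> ptsA Y \<Longrightarrow> q X Y x y \<in> OMap P (X, Y)"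
  by (auto simp: q_image)

lemma qE:
  assumes "X \<in> Obj B" "Y \<in> Obj A" "t \<in> OMap P (X, Y)"
  obtains x y where "x \<in> ptsB X" "y \<in> ptsA Y" "t = q X Y x y"
  using assms by (auto simp: q_image)

lemma q_balanced:
  assumes "X \<in> Obj B" "Y \<in> Obj A" "x \<in> ptsB X" "y \<in> ptsA Y" "g \<in> carrier H"
  shows "q X Y (actB X g x) y = q X Y x (actA Y g y)"
  using assms actB_simps by (subst q_eq_iff) auto

text \<open>
  Together with the next lemma: \<open>x \<mapsto> x \<otimes> base\<close> is a bijection from \<open>X\<close> to \<open>X \<otimes> reg\<close>.
\<close>

lemma q_base_inj:
  assumes "X \<in> Obj B" "x \<in> ptsB X" "x' \<in> ptsB X" "q X A.reg x A.base = q X A.reg x' A.base"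
  shows "x = x'"
proof -
  obtain g where g: "g \<in> carrier H" "x = actB X g x'" "A.base = actA A.reg g A.base"
    using assms by (auto simp: q_eq_iff)
  have "actA A.reg \<one>\<^bsub>H\<^esub> A.base = actA A.reg g A.base" using g(3) by simp
  then have "\<one>\<^bsub>H\<^esub> = g" using A.reg_inj g(1) A.one_closed by blast
  with g show ?thesis using actB_simps assms by auto
qed

lemma q_baseE:
  assumes "X \<in> Obj B" "t \<in> OMap P (X, A.reg)"
  obtains x where "x \<in> ptsB X" "t = q X A.reg x A.base"
proof -
  obtain x y where xy: "x \<in> ptsB X" "y \<in> ptsA A.reg" "t = q X A.reg x y"
    by (rule qE[OF assms(1) A.reg_base(1) assms(2)])
  obtain g where g: "g \<in> carrier H" "y = actA A.reg g A.base" by (rule A.regE[OF xy(2)])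
  have "t = q X A.reg (actB X g x) A.base"
    using q_balanced[OF assms(1) A.reg_base(1) xy(1) A.reg_base(2) g(1)] xy g by simp
  then show thesis using that actB_simps(1)[OF assms(1) xy(1) g(1)] by blast
qed

abbreviation tens :: "'o \<Rightarrow> ('p, ('p, 'b \<Rightarrow> 'b) arrow, 'c set, ('c set, 'c \<Rightarrow> 'c) arrow) ftor" where
  "tens X \<equiv> fix_left B A P X"

lemma tens_q:
  assumes "X \<in> Obj B" "h \<in> arrows A Y Y'" "x \<in> ptsB X" "y \<in> ptsA Y"
  shows "mor (AMap (tens X) h) (q X Y x y) = q X Y' x (mor h y)"
proof -
  have "h \<in> Arr A" using assms(2) by (simp add: arrows_def)
  then show ?thesis
    using mor_q[OF B.Id_in_arrows[OF assms(1)] assms(2-4)] assms(1,3) by (simp add: B.Id_eq)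
qed

lemma tens_functor: "X \<in> Obj B \<Longrightarrow> is_functor A Fin_cat (tens X)"
  by (rule is_functor_fix_left[OF P B.category A.category])

lemma tens_arrow:
  assumes "X \<in> Obj B" "h \<in> arrows A Y Y'"
  shows "AMap (tens X) h \<in> arrows Fin_cat (OMap P (X, Y)) (OMap P (X, Y'))"
  using is_functor_arrows[OF tens_functor[OF assms(1)] assms(2)] A.arrowsD(1,2)[OF assms(2)] by simp

text \<open>
  Given \<open>x \<otimes> y\<close> and \<open>x' \<otimes> z\<close> with the same image in \<open>X \<otimes> W\<close>, the group element relating the images
  can be moved to \<open>y\<close>, which makes the first entries equal; then \<open>y\<close> and \<open>z\<close> have the same image and
  define a point of \<open>E\<close>. For uniqueness, two tensors with equal projections differ by group elements
  \<open>b\<close> and \<open>c\<close>, one for each projection, and freeness in one of the variables gives \<open>b = c\<close>.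
\<close>

lemma tens_pullbacks:
  assumes X: "X \<in> Obj B"
  shows "preserves_pullbacks A Fin_cat (tens X)"
  unfolding preserves_pullbacks_def
proof (intro allI impI)
  fix p1 p2 f1 f2 assume "is_pullback A p1 p2 f1 f2"
  then obtain E Y Z W p p' f g where e: "p1 = Arrow E p Y" "p2 = Arrow E p' Z" "f1 = Arrow Y f W"
    "f2 = Arrow Z g W"
    and o: "E \<in> Obj A" "Y \<in> Obj A" "Z \<in> Obj A" "W \<in> Obj A"
    and m: "A.eqv E Y p" "A.eqv E Z p'" "A.eqv Y W f" "A.eqv Z W g"
    and sp: "A.set_pullback E Y Z p p' f g"
    by (rule A.is_pullbackE)
  let ?T = "\<lambda>Y. OMap P (X, Y)"
  have ar: "p1 \<in> arrows A E Y" "p2 \<in> arrows A E Z" "f1 \<in> arrows A Y W" "f2 \<in> arrows A Z W"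
    using o m by (simp_all add: e A.arrows_iff)
  note T = tens_arrow[OF X ar(1)] tens_arrow[OF X ar(2)] tens_arrow[OF X ar(3)]
    tens_arrow[OF X ar(4)]
  note TD = Fin.arrowsD[OF T(1)] Fin.arrowsD[OF T(2)] Fin.arrowsD[OF T(3)] Fin.arrowsD[OF T(4)]
  let ?m = "\<lambda>h. mor (AMap (tens X) h)"
  note tq = tens_q[OF X ar(1), unfolded e arrow.sel] tens_q[OF X ar(2), unfolded e arrow.sel]
    tens_q[OF X ar(3), unfolded e arrow.sel] tens_q[OF X ar(4), unfolded e arrow.sel]
  note tq' = tq[folded e]
  note sp' = sp[unfolded A.set_pullback_def]
  note mE = A.eqvD[OF m(1)] A.eqvD[OF m(2)] A.eqvD[OF m(3)] A.eqvD[OF m(4)]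
  have "Fin.set_pullback (?T E) (?T Y) (?T Z) (?m p1) (?m p2) (?m f1) (?m f2)"
    unfolding Fin.set_pullback_def
  proof (intro conjI ballI impI)
    fix t assume "t \<in> ?T E"
    then obtain x w where "x \<in> ptsB X" "w \<in> ptsA E" "t = q X E x w" by (rule qE[OF X o(1)])
    then show "?m f1 (?m p1 t) = ?m f2 (?m p2 t)"
      using sp' by (simp add: tq' mE)
  next
    fix s t assume st: "s \<in> ?T Y" "t \<in> ?T Z" and eq: "?m f1 s = ?m f2 t"
    obtain x y where xy: "x \<in> ptsB X" "y \<in> ptsA Y" "s = q X Y x y" by (rule qE[OF X o(2) st(1)])
    obtain x' z where xz: "x' \<in> ptsB X" "z \<in> ptsA Z" "t = q X Z x' z" by (rule qE[OF X o(3) st(2)])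
    have "q X W x (f y) = q X W x' (g z)" using eq xy xz by (simp add: tq')
    then obtain a where a: "a \<in> carrier H" "x = actB X a x'" "g z = actA W a (f y)"
      using xy xz X o by (auto simp: q_eq_iff mE)
    have ay: "actA Y a y \<in> ptsA Y" "f (actA Y a y) = g z" using a xy o by (simp_all add: mE)
    have s': "s = q X Y x' (actA Y a y)" using q_balanced[OF X o(2) xz(1) xy(2) a(1)] xy a by simp
    obtain w where w: "w \<in> ptsA E" "p w = actA Y a y" "p' w = z"
      using sp' ay xz(2) by blast
    show "\<exists>!u. u \<in> ?T E \<and> ?m p1 u = s \<and> ?m p2 u = t"
    proof (rule ex1I[of _ "q X E x' w"])
      show "q X E x' w \<in> ?T E \<and> ?m p1 (q X E x' w) = s \<and> ?m p2 (q X E x' w) = t"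
        using w xz s' q_in[OF X o(1)] by (simp add: tq')
      fix u assume u: "u \<in> ?T E \<and> ?m p1 u = s \<and> ?m p2 u = t"
      then obtain v e' where ve: "v \<in> ptsB X" "e' \<in> ptsA E" "u = q X E v e'"
        using qE[OF X o(1)] by blast
      have "q X Y v (p e') = q X Y x' (p w)" "q X Z v (p' e') = q X Z x' (p' w)"
        using u ve w s' xz by (simp_all add: tq')
      moreover have "p e' \<in> ptsA Y" "p w \<in> ptsA Y" "p' e' \<in> ptsA Z" "p' w \<in> ptsA Z"
        using ve w ay xz by (simp_all add: mE)
      ultimately obtain b c where b: "b \<in> carrier H" "v = actB X b x'" "p w = actA Y b (p e')"
        and c: "c \<in> carrier H" "v = actB X c x'" "p' w = actA Z c (p' e')"
        using q_eq_iff[OF X o(2) ve(1) _ xz(1), of "p e'" "p w"]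
          q_eq_iff[OF X o(3) ve(1) _ xz(1), of "p' e'" "p' w"] by blast
      have bc: "b = c"
      proof (cases r)
        case True
        \<comment> \<open>The objects of \<open>A\<close> are free: compare in \<open>W\<close>, where both components have the same image.\<close>
        have W: "f (p e') \<in> ptsA W" using ve by (simp add: mE)
        have "f (p w) = g (p' w)" "f (p e') = g (p' e')" using sp' w(1) ve(2) by auto
        then have "actA W b (f (p e')) = actA W c (f (p e'))"
          using b c ve by (metis mE)
        then have "actA W (inv\<^bsub>H\<^esub> c \<otimes>\<^bsub>H\<^esub> b) (f (p e')) = f (p e')"
          using b c W o by simp
        then have "inv\<^bsub>H\<^esub> c \<otimes>\<^bsub>H\<^esub> b = \<one>\<^bsub>H\<^esub>" using A.act_free[OF o(4) W True] b c by simp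
        then show ?thesis using b c by (metis A.inv_equality A.inv_closed A.inv_inv)
      next
        case False
        \<comment> \<open>The objects of \<open>B\<close> are free, and \<open>b\<close> and \<open>c\<close> move \<open>x'\<close> to the same point of \<open>X\<close>.\<close>
        let ?G = "opposite_group H"
        have bc: "b \<in> carrier ?G" "c \<in> carrier ?G" using b c by (simp_all add: opposite_group_def)
        have "actB X (inv\<^bsub>?G\<^esub> c \<otimes>\<^bsub>?G\<^esub> b) x' = x'"
          using bc b c X xz(1) by (metis B.act_inv(2) B.act_simps(4) B.inv_closed)
        then have "inv\<^bsub>?G\<^esub> c \<otimes>\<^bsub>?G\<^esub> b = \<one>\<^bsub>?G\<^esub>" using B.act_free[OF X xz(1) False] bc by simp
        then show ?thesis using bc by (metis B.inv_equality B.inv_closed B.inv_inv)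
      qed
      have "p (actA E b e') = p w" "p' (actA E b e') = p' w" "actA E b e' \<in> ptsA E"
        using b c bc ve o by (simp_all add: mE)
      then have "actA E b e' = w" using sp' w ay xz by metis
      then show "u = q X E x' w"
        using ve b q_balanced[OF X o(1) xz(1) ve(2) b(1)] by simp
    qed
  qed
  from Fin.is_pullbackI[OF TD(1,2) TD(8) TD(14) TD(5) TD(11) TD(17) TD(23) this]
  show "is_pullback Fin_cat (AMap (tens X) p1) (AMap (tens X) p2) (AMap (tens X) f1) (AMap (tens X) f2)"
    by (simp only: TD(6) TD(12) TD(18) TD(24))
qed

lemma tens_coproducts:
  assumes X: "X \<in> Obj B"
  shows "preserves_finite_coproducts A Fin_cat (tens X)"
  unfolding preserves_finite_coproducts_def
proof (intro allI impI)
  fix I :: "nat set" and Y S \<iota> assume co: "finite I \<and> is_coproduct A I Y S \<iota>"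
  note D = A.is_coproductD[OF conjunct2[OF co]]
  have bij: "bij_betw (\<lambda>(i, y). mor (\<iota> i) y) (SIGMA i:I. ptsA (Y i)) (ptsA S)"
    using A.is_coproduct_bij co by blast
  let ?T = "\<lambda>Y. OMap P (X, Y)" and ?m = "\<lambda>h. mor (AMap (tens X) h)"
  have tq: "?m (\<iota> i) (q X (Y i) x y) = q X S x (mor (\<iota> i) y)"
    if "i \<in> I" "x \<in> ptsB X" "y \<in> ptsA (Y i)" for i x y
    using tens_q[OF X D(3)] that by blast
  have inj: "(i, s) = (j, t)"
    if i: "i \<in> I" "s \<in> ?T (Y i)" and j: "j \<in> I" "t \<in> ?T (Y j)" and eq: "?m (\<iota> i) s = ?m (\<iota> j) t"
      for i s j t
  proof -
    obtain x y where xy: "x \<in> ptsB X" "y \<in> ptsA (Y i)" "s = q X (Y i) x y"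
      by (rule qE[OF X D(2)[OF i(1)] i(2)])
    obtain x' y' where xy': "x' \<in> ptsB X" "y' \<in> ptsA (Y j)" "t = q X (Y j) x' y'"
      by (rule qE[OF X D(2)[OF j(1)] j(2)])
    have "q X S x (mor (\<iota> i) y) = q X S x' (mor (\<iota> j) y')" using eq xy xy' i j by (simp add: tq)
    then obtain g where g: "g \<in> carrier H" "x = actB X g x'" "mor (\<iota> j) y' = actA S g (mor (\<iota> i) y)"
      using q_eq_iff[OF X D(1) xy(1) _ xy'(1)] eqvA(1)[OF D(3)[OF i(1)] xy(2)]
        eqvA(1)[OF D(3)[OF j(1)] xy'(2)] by blast
    have gy: "actA (Y i) g y \<in> ptsA (Y i)" using g(1) xy(2) D(2)[OF i(1)] by simp
    have "mor (\<iota> j) y' = mor (\<iota> i) (actA (Y i) g y)"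
      using g eqvA(2)[OF D(3)[OF i(1)] xy(2) g(1)] by simp
    then have "(j, y') = (i, actA (Y i) g y)"
      using i j xy' gy by (intro inj_onD[OF bij_betw_imp_inj_on[OF bij]]) auto
    then show ?thesis
      using q_balanced[OF X D(2)[OF i(1)] xy'(1) xy(2) g(1)] g(2) xy(3) xy'(3) by auto
  qed
  have surj: "\<exists>i \<in> I. \<exists>s \<in> ?T (Y i). t = ?m (\<iota> i) s" if t: "t \<in> ?T S" for t
  proof -
    obtain x y where xy: "x \<in> ptsB X" "y \<in> ptsA S" "t = q X S x y" by (rule qE[OF X D(1) t])
    obtain i y' where i: "i \<in> I" "y' \<in> ptsA (Y i)" "y = mor (\<iota> i) y'"
      using bij xy(2) by (fastforce simp: bij_betw_def)
    have "q X (Y i) x y' \<in> ?T (Y i)" using q_in[OF X D(2)[OF i(1)] xy(1) i(2)] .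
    moreover have "t = ?m (\<iota> i) (q X (Y i) x y')" using tq[OF i(1) xy(1) i(2)] xy i by simp
    ultimately show ?thesis using i(1) by blast
  qed
  show "is_coproduct Fin_cat I (\<lambda>i. OMap (tens X) (Y i)) (OMap (tens X) S) (\<lambda>i. AMap (tens X) (\<iota> i))"
  proof (rule Fin.is_coproductI)
    show "OMap (tens X) S \<in> Obj Fin_cat" using is_functorD(5)[OF tens_functor[OF X] D(1)] .
    show ar: "AMap (tens X) (\<iota> i) \<in> arrows Fin_cat (OMap (tens X) (Y i)) (OMap (tens X) S)"
      if "i \<in> I" for i
      using is_functor_arrows[OF tens_functor[OF X] D(3)[OF that]] .
    have "?m (\<iota> i) s \<in> ?T S" if "i \<in> I" "s \<in> ?T (Y i)" for i s
      using Fin.eqvD(1)[OF Fin.arrowsD(5)[OF tens_arrow[OF X D(3)[OF that(1)]]] that(2)] .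
    then have "bij_betw (\<lambda>(i, s). ?m (\<iota> i) s) (SIGMA i:I. ?T (Y i)) (?T S)"
      using inj surj unfolding bij_betw_def inj_on_def by fast
    then show "bij_betw (\<lambda>(i, s). ?m (\<iota> i) s) (SIGMA i:I. OMap (tens X) (Y i)) (OMap (tens X) S)"
      using D(1,2) by (simp cong: Sigma_cong)
  qed
qed

lemma tens_epis:
  assumes X: "X \<in> Obj B"
  shows "preserves_epis A Fin_cat (tens X)"
  unfolding preserves_epis_def
proof (intro allI impI)
  fix h assume epi: "is_epi A h"
  then have h: "h \<in> arrows A (src h) (tgt h)" by (auto simp: is_epi_def A.Arr_iff A.arrows_iff)
  note hD = A.arrowsD(1,2)[OF h]
  have surj: "mor h ` ptsA (src h) = ptsA (tgt h)" using A.is_epi_surj[OF epi h] .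
  show "is_epi Fin_cat (AMap (tens X) h)"
  proof (rule Fin.is_epiI[OF tens_arrow[OF X h]])
    have "t \<in> mor (AMap (tens X) h) ` OMap P (X, src h)" if t: "t \<in> OMap P (X, tgt h)" for t
    proof -
      obtain x y where xy: "x \<in> ptsB X" "y \<in> ptsA (tgt h)" "t = q X (tgt h) x y"
        by (rule qE[OF X hD(2) t])
      then obtain z where z: "z \<in> ptsA (src h)" "y = mor h z" using surj by blast
      then show ?thesis
        using tens_q[OF X h xy(1) z(1)] xy q_in[OF X hD(1) xy(1) z(1)] by (metis image_eqI)
    qed
    then show "mor (AMap (tens X) h) ` OMap P (X, src h) = OMap P (X, tgt h)"
      using Fin.eqvD(1)[OF Fin.arrowsD(5)[OF tens_arrow[OF X h]]] by blast
  qed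
qed

lemma pce_tens: "X \<in> Obj B \<Longrightarrow> pce_functor A Fin_cat (tens X)"
  by (simp add: pce_functor_def tens_functor tens_pullbacks tens_coproducts tens_epis)

end

section \<open>Currying a tensor product is an equivalence\<close>

lemma arrows_Fun_pce_iff:
  "\<alpha> \<in> arrows (Fun_pce C D) F G \<longleftrightarrow> pce_functor C D F \<and> pce_functor C D G \<and>
    src \<alpha> = F \<and> tgt \<alpha> = G \<and> nat_trans C D F G (mor \<alpha>)"
  by (auto simp: arrows_def Fun_pce_def)

lemma opposite_group_simps [simp]:
  "carrier (opposite_group G) = carrier G" "\<one>\<^bsub>opposite_group G\<^esub> = \<one>\<^bsub>G\<^esub>"
  "g \<otimes>\<^bsub>opposite_group G\<^esub> h = h \<otimes>\<^bsub>G\<^esub> g"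
  by (simp_all add: opposite_group_def)

context tensor_pairing
begin

lemma curry_functor: "is_functor B (Fun_pce A Fin_cat) (curry_left B A P)"
  by (rule is_functor_curry_left[OF P B.category A.category pce_tens])

lemma curry_q:
  assumes f: "f \<in> arrows B X X'" and Y: "Y \<in> Obj A" and "x \<in> ptsB X" "y \<in> ptsA Y"
  shows "mor (mor (AMap (curry_left B A P) f) Y) (q X Y x y) = q X' Y (mor f x) y"
proof -
  have "f \<in> Arr B" using f by (simp add: arrows_def)
  then show ?thesis
    using mor_q[OF f A.Id_in_arrows[OF Y] assms(3,4)] Y assms(4) by (simp add: A.Id_eq)
qed

lemma curry_arrow:
  assumes "f \<in> arrows B X X'"
  shows "AMap (curry_left B A P) f \<in> arrows (Fun_pce A Fin_cat) (tens X) (tens X')"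
  using is_functor_arrows[OF curry_functor assms] B.arrowsD(1,2)[OF assms] by simp

lemma curry_faithful:
  assumes f: "f \<in> arrows B X X'" and f': "f' \<in> arrows B X X'"
    and eq: "AMap (curry_left B A P) f = AMap (curry_left B A P) f'"
  shows "f = f'"
proof (rule B.arrows_eqI[OF f f'])
  fix x assume x: "x \<in> ptsB X"
  have "q X' A.reg (mor f x) A.base = q X' A.reg (mor f' x) A.base"
    using curry_q[OF f A.reg_base(1) x A.reg_base(2)] curry_q[OF f' A.reg_base(1) x A.reg_base(2)]
      eq
    by simp
  then show "mor f x = mor f' x"
    using q_base_inj[OF B.arrowsD(2)[OF f]] eqvB(1)[OF f x] eqvB(1)[OF f' x] by blast
qed

text \<open>
  The component of \<open>\<alpha>\<close> at the regular set is a map \<open>m : X \<rightarrow> X'\<close> under the identification of \<open>X\<close> with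
  \<open>X \<otimes> reg\<close>. Naturality for \<open>ev Y y\<close> shows that \<open>\<alpha>\<close> sends \<open>x \<otimes> y\<close> to \<open>m x \<otimes> y\<close> for
  all \<open>Y\<close>. Taking for \<open>y\<close> a translate of the base point makes \<open>m\<close> equivariant.
\<close>

lemma curry_full:
  assumes X: "X \<in> Obj B" "X' \<in> Obj B" and \<alpha>: "\<alpha> \<in> arrows (Fun_pce A Fin_cat) (tens X) (tens X')"
  obtains f where "f \<in> arrows B X X'" "AMap (curry_left B A P) f = \<alpha>"
proof -
  define \<eta> where "\<eta> = mor \<alpha>"
  have nt: "nat_trans A Fin_cat (tens X) (tens X') \<eta>" and st: "src \<alpha> = tens X" "tgt \<alpha> = tens X'"
    using \<alpha> by (auto simp: arrows_Fun_pce_iff \<eta>_def)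
  have \<eta>_arrow: "\<eta> Y \<in> arrows Fin_cat (OMap P (X, Y)) (OMap P (X', Y))" if "Y \<in> Obj A" for Y
    using nat_transD(3-5)[OF nt that] that by (simp add: arrows_def)
  have \<eta>_in: "mor (\<eta> Y) t \<in> OMap P (X', Y)" if "Y \<in> Obj A" "t \<in> OMap P (X, Y)" for Y t
    using Fin.eqvD(1)[OF Fin.arrowsD(5)[OF \<eta>_arrow[OF that(1)]] that(2)] .
  have nat: "mor (\<eta> Y') (mor (AMap (tens X) h) t) = mor (AMap (tens X') h) (mor (\<eta> Y) t)"
    if h: "h \<in> arrows A Y Y'" and t: "t \<in> OMap P (X, Y)" for h Y Y' t
  proof -
    have "h \<in> Arr A" "Dom A h = Y" "Cod A h = Y'" using h by (auto simp: arrows_def)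
    then have "Comp Fin_cat (\<eta> Y') (AMap (tens X) h) = Comp Fin_cat (AMap (tens X') h) (\<eta> Y)"
      using nat_transD(6)[OF nt, of h] by simp
    then show ?thesis
      using Fin.mor_Comp_apply[OF tens_arrow[OF X(1) h] t]
        Fin.mor_Comp_apply[OF \<eta>_arrow[OF A.arrowsD(1)[OF h]] t]
      by metis
  qed
  have "\<forall>x \<in> ptsB X. \<exists>x'. x' \<in> ptsB X' \<and> mor (\<eta> A.reg) (q X A.reg x A.base) = q X' A.reg x' A.base"
  proof
    fix x assume "x \<in> ptsB X"
    then have "mor (\<eta> A.reg) (q X A.reg x A.base) \<in> OMap P (X', A.reg)"
      using \<eta>_in[OF A.reg_base(1)] q_in[OF X(1) A.reg_base(1) _ A.reg_base(2)] by blast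
    then show "\<exists>x'. x' \<in> ptsB X' \<and> mor (\<eta> A.reg) (q X A.reg x A.base) = q X' A.reg x' A.base"
      by (rule q_baseE[OF X(2)]) blast
  qed
  then obtain m where "\<forall>x \<in> ptsB X. m x \<in> ptsB X' \<and>
      mor (\<eta> A.reg) (q X A.reg x A.base) = q X' A.reg (m x) A.base"
    by (rule bchoice[THEN exE])
  then have m: "m x \<in> ptsB X'" "mor (\<eta> A.reg) (q X A.reg x A.base) = q X' A.reg (m x) A.base"
    if "x \<in> ptsB X" for x using that by auto
  have \<eta>_q: "mor (\<eta> Y) (q X Y x y) = q X' Y (m x) y" if Y: "Y \<in> Obj A" and x: "x \<in> ptsB X"
    and y: "y \<in> ptsA Y" for Y x y
  proof -
    note p = A.pt_arrow[OF Y y]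
    have "q X Y x y = mor (AMap (tens X) (A.pt Y y)) (q X A.reg x A.base)"
      using tens_q[OF X(1) p x A.reg_base(2)] Y y by (simp add: A.mor_pt)
    then have "mor (\<eta> Y) (q X Y x y) = mor (AMap (tens X') (A.pt Y y)) (q X' A.reg (m x) A.base)"
      using nat[OF p q_in[OF X(1) A.reg_base(1) x A.reg_base(2)]] m(2)[OF x] by simp
    also have "\<dots> = q X' Y (m x) y"
      using tens_q[OF X(2) p m(1)[OF x] A.reg_base(2)] Y y by (simp add: A.mor_pt)
    finally show ?thesis .
  qed
  have m_act: "m (actB X g x) = actB X' g (m x)" if g: "g \<in> carrier H" and x: "x \<in> ptsB X" for g x
  proof (rule q_base_inj[OF X(2)])
    note gx = actB_simps(1)[OF X(1) x g] and gm = actB_simps(1)[OF X(2) m(1)[OF x] g]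
    show "m (actB X g x) \<in> ptsB X'" "actB X' g (m x) \<in> ptsB X'" using m(1)[OF gx] gm .
    have ge: "actA A.reg g A.base \<in> ptsA A.reg" using g by simp
    have "q X' A.reg (m (actB X g x)) A.base = mor (\<eta> A.reg) (q X A.reg x (actA A.reg g A.base))"
      using m(2)[OF gx] q_balanced[OF X(1) A.reg_base(1) x A.reg_base(2) g] by simp
    also have "\<dots> = q X' A.reg (actB X' g (m x)) A.base"
      using \<eta>_q[OF A.reg_base(1) x ge] q_balanced[OF X(2) A.reg_base(1) m(1)[OF x] A.reg_base(2) g]
        by simp
    finally show "q X' A.reg (m (actB X g x)) A.base = q X' A.reg (actB X' g (m x)) A.base" .
  qed
  define f where "f = Arrow X (\<lambda>x \<in> ptsB X. m x) X'"
  have f: "f \<in> arrows B X X'"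
    using X m(1) m_act actB_simps(1)[OF X(1)]
    by (auto simp: f_def B.arrows_iff B.eqv_def)
  note cf = curry_arrow[OF f]
  have "mor (AMap (curry_left B A P) f) = \<eta>"
  proof (rule extensionalityI)
    have nc: "nat_trans A Fin_cat (tens X) (tens X') (mor (AMap (curry_left B A P) f))"
      using cf by (simp add: arrows_Fun_pce_iff)
    show "mor (AMap (curry_left B A P) f) \<in> extensional (Obj A)" "\<eta> \<in> extensional (Obj A)"
      using nat_transD(7)[OF nc] nat_transD(7)[OF nt] .
    fix Y assume Y: "Y \<in> Obj A"
    have ar: "mor (AMap (curry_left B A P) f) Y \<in> arrows Fin_cat (OMap P (X, Y)) (OMap P (X', Y))"
      using nat_transD(3-5)[OF nc Y] Y by (simp add: arrows_def)
    show "mor (AMap (curry_left B A P) f) Y = \<eta> Y"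
    proof (rule Fin.arrows_eqI[OF ar \<eta>_arrow[OF Y]])
      fix t assume "t \<in> OMap P (X, Y)"
      then obtain x y where xy: "x \<in> ptsB X" "y \<in> ptsA Y" "t = q X Y x y" by (rule qE[OF X(1) Y])
      then show "mor (mor (AMap (curry_left B A P) f) Y) t = mor (\<eta> Y) t"
        using curry_q[OF f Y xy(1,2)] \<eta>_q[OF Y xy(1,2)] by (simp add: f_def)
    qed
  qed
  then have "AMap (curry_left B A P) f = \<alpha>"
    using cf st by (intro arrow.expand) (auto simp: arrows_Fun_pce_iff \<eta>_def)
  with f show thesis by (rule that)
qed

text \<open>
  The object \<open>X\<close> is a copy of \<open>F reg\<close> with the action of right multiplications, and \<open>k\<close>
  identifies its points with elements of \<open>F reg\<close>. The isomorphism sends \<open>x \<otimes> y\<close> to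
  \<open>\<phi> Y x y = F (ev Y y) (k x)\<close>; it is well defined and injective by \<open>\<phi>_iff\<close> and onto by
  \<open>elements\<close>.
\<close>

lemma curry_essentially_surjective:
  assumes F: "pce_functor A Fin_cat F"
  shows "\<exists>X \<in> Obj B. \<exists>i \<in> arrows (Fun_pce A Fin_cat) (tens X) F. is_iso (Fun_pce A Fin_cat) i"
proof -
  interpret F: pce_functor_to_Fin H r A ptsA actA F
    by unfold_locales (rule F)
  define U where "U = OMap F A.reg"
  obtain X j where X: "X \<in> Obj B" and j: "bij_betw j U (ptsB X)"
    and j_act: "\<And>g u. g \<in> carrier (opposite_group H) \<Longrightarrow> u \<in> U \<Longrightarrow> actB X g (j u) = j (F.rmul g u)"
    by (rule B.realize_on[OF F.finite_action_rmul[folded U_def]]) (rule that; assumption)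
  define k where "k = inv_into U j"
  have k: "x \<in> ptsB X \<Longrightarrow> k x \<in> U" "x \<in> ptsB X \<Longrightarrow> j (k x) = x" "u \<in> U \<Longrightarrow> k (j u) = u"
    "u \<in> U \<Longrightarrow> j u \<in> ptsB X" for x u
    using j by (auto simp: k_def bij_betw_def inv_into_into f_inv_into_f)
  have k_act: "k (actB X g x) = F.rmul g (k x)" if g: "g \<in> carrier H" and x: "x \<in> ptsB X" for g x
  proof -
    have "F.rmul g (k x) \<in> U"
      using k(1)[OF x] g F.app_in[OF A.pt_arrow[of A.reg "actA A.reg g A.base"], of "k x"]
      by (simp add: F.rmul_def U_def)
    moreover have "actB X g x = j (F.rmul g (k x))"
      using j_act[of g "k x"] g k(1,2)[OF x] by (simp add: opposite_group_def)
    ultimately show ?thesis by (simp add: k(3))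
  qed
  define \<phi> where "\<phi> Y x y = F.app (A.pt Y y) (k x)" for Y x y
  have \<phi>_in: "\<phi> Y x y \<in> OMap F Y" if "Y \<in> Obj A" "x \<in> ptsB X" "y \<in> ptsA Y" for Y x y
    unfolding \<phi>_def using F.app_in[OF A.pt_arrow[OF that(1,3)]] k(1)[OF that(2)]
      by (simp add: U_def)
  have \<phi>_balanced: "\<phi> Y (actB X g x) y = \<phi> Y x (actA Y g y)"
    if "Y \<in> Obj A" "x \<in> ptsB X" "y \<in> ptsA Y" "g \<in> carrier H" for Y x y g
    using that k(1)[OF that(2)] F.app_pt_rmul[OF that(1,3,4), of "k x"]
      by (simp add: \<phi>_def k_act U_def)
  have \<phi>_iff: "\<phi> Y x y = \<phi> Y x' y' \<longleftrightarrow> q X Y x y = q X Y x' y'"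
    if Y: "Y \<in> Obj A" and x: "x \<in> ptsB X" "y \<in> ptsA Y" and x': "x' \<in> ptsB X" "y' \<in> ptsA Y"
      for Y x y x' y'
  proof
    assume "q X Y x y = q X Y x' y'"
    then obtain g where g: "g \<in> carrier H" "x = actB X g x'" "y' = actA Y g y"
      using q_eq_iff[OF X Y x x'] by blast
    then show "\<phi> Y x y = \<phi> Y x' y'" using \<phi>_balanced[OF Y x'(1) x(2) g(1)] by simp
  next
    assume eq: "\<phi> Y x y = \<phi> Y x' y'"
    obtain g h u where g: "g \<in> carrier H" and h: "h \<in> carrier H" and u: "u \<in> OMap F A.reg"
      and ku: "k x = F.rmul g u" "k x' = F.rmul h u" and gh: "actA Y g y = actA Y h y'"
      by (rule F.eq_translates[OF Y x(2) x'(2) _ _ eq[unfolded \<phi>_def]])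
         (use k(1)[OF x(1)] k(1)[OF x'(1)] in \<open>auto simp: U_def\<close>)
    have ju: "j u \<in> ptsB X" using k(4) u by (simp add: U_def)
    have "x = actB X g (j u)" "x' = actB X h (j u)"
      using ku k(2)[OF x(1)] k(2)[OF x'(1)] j_act[of g u] j_act[of h u] g h u
      by (simp_all add: U_def opposite_group_def)
    then show "q X Y x y = q X Y x' y'"
      using q_balanced[OF X Y ju x(2) g] q_balanced[OF X Y ju x'(2) h] gh by simp
  qed
  define w where "w Y t = (SOME w. w \<in> ptsB X \<times> ptsA Y \<and> t = q X Y (fst w) (snd w))" for Y t
  define \<eta> where "\<eta> = (\<lambda>Y \<in> Obj A. Arrow (OMap P (X, Y))
    (\<lambda>t \<in> OMap P (X, Y). \<phi> Y (fst (w Y t)) (snd (w Y t))) (OMap F Y))"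
  have \<eta>_q: "mor (\<eta> Y) (q X Y x y) = \<phi> Y x y" if Y: "Y \<in> Obj A" and x: "x \<in> ptsB X" "y \<in> ptsA Y"
    for Y x y
  proof -
    let ?w = "w Y (q X Y x y)"
    have "?w \<in> ptsB X \<times> ptsA Y \<and> q X Y x y = q X Y (fst ?w) (snd ?w)"
      unfolding w_def by (rule someI[of _ "(x, y)"]) (use x in simp)
    then have "\<phi> Y (fst ?w) (snd ?w) = \<phi> Y x y"
      using \<phi>_iff[OF Y _ _ x, of "fst ?w" "snd ?w"] by auto
    then show ?thesis using Y q_in[OF X Y x] by (simp add: \<eta>_def)
  qed
  have bij: "bij_betw (mor (\<eta> Y)) (OMap P (X, Y)) (OMap F Y)" if Y: "Y \<in> Obj A" for Y
    unfolding bij_betw_def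
  proof (intro conjI inj_onI)
    fix s t assume st: "s \<in> OMap P (X, Y)" "t \<in> OMap P (X, Y)" and eq: "mor (\<eta> Y) s = mor (\<eta> Y) t"
    obtain x y where xy: "x \<in> ptsB X" "y \<in> ptsA Y" "s = q X Y x y" by (rule qE[OF X Y st(1)])
    obtain x' y' where xy': "x' \<in> ptsB X" "y' \<in> ptsA Y" "t = q X Y x' y'" by (rule qE[OF X Y st(2)])
    show "s = t" using eq xy xy' \<phi>_iff[OF Y xy(1,2) xy'(1,2)] by (simp add: \<eta>_q[OF Y])
  next
    have "mor (\<eta> Y) t \<in> OMap F Y" if "t \<in> OMap P (X, Y)" for t
      using qE[OF X Y that] \<eta>_q[OF Y] \<phi>_in[OF Y] by metis
    moreover have "t \<in> mor (\<eta> Y) ` OMap P (X, Y)" if t: "t \<in> OMap F Y" for t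
    proof -
      obtain y u where yu: "y \<in> ptsA Y" "u \<in> OMap F A.reg" "t = F.app (A.pt Y y) u"
        by (rule F.elements[OF Y t])
      have ju: "j u \<in> ptsB X" "k (j u) = u" using k(3,4) yu by (simp_all add: U_def)
      have "t = mor (\<eta> Y) (q X Y (j u) y)"
        using \<eta>_q[OF Y ju(1) yu(1)] ju yu by (simp add: \<phi>_def)
      then show ?thesis using q_in[OF X Y ju(1) yu(1)] by blast
    qed
    ultimately show "mor (\<eta> Y) ` OMap P (X, Y) = OMap F Y" by blast
  qed
  have FO: "OMap F Y \<in> Obj Fin_cat" if "Y \<in> Obj A" for Y using is_functorD(5)[OF F.F that] .
  have TO: "OMap P (X, Y) \<in> Obj Fin_cat" if "Y \<in> Obj A" for Y
    using is_functorD(5)[OF tens_functor[OF X] that] that by simp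
  have \<eta>_eqv: "Fin.eqv (OMap P (X, Y)) (OMap F Y) (mor (\<eta> Y))" if Y: "Y \<in> Obj A" for Y
    using bij_betwE[OF bij[OF Y]] Y by (auto simp: Fin.eqv_def \<eta>_def)
  have \<eta>_st: "\<eta> Y = Arrow (OMap P (X, Y)) (mor (\<eta> Y)) (OMap F Y)" if "Y \<in> Obj A" for Y
    using that by (simp add: \<eta>_def)
  have \<eta>_arrow: "\<eta> Y \<in> arrows Fin_cat (OMap P (X, Y)) (OMap F Y)" if Y: "Y \<in> Obj A" for Y
    using \<eta>_eqv[OF Y] TO[OF Y] FO[OF Y] Y by (simp add: Fin.arrows_iff \<eta>_def)
  have iso: "is_iso Fin_cat (\<eta> Y)" if Y: "Y \<in> Obj A" for Y
    using Fin.is_isoI[OF TO[OF Y] FO[OF Y] \<eta>_eqv[OF Y] bij[OF Y]] \<eta>_st[OF Y] by simp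
  have nt: "nat_trans A Fin_cat (tens X) F \<eta>"
  proof (rule nat_transI[OF tens_functor[OF X] F.F])
    show "\<eta> \<in> extensional (Obj A)" by (simp add: \<eta>_def)
    show "\<eta> Y \<in> arrows Fin_cat (OMap (tens X) Y) (OMap F Y)" if "Y \<in> Obj A" for Y
      using \<eta>_arrow[OF that] that by simp
    fix h assume "h \<in> Arr A"
    then have h: "h \<in> arrows A (src h) (tgt h)" by (simp add: arrows_def)
    note Y = A.arrowsD(1,2)[OF h]
    have "Comp Fin_cat (\<eta> (tgt h)) (AMap (tens X) h) = Comp Fin_cat (AMap F h) (\<eta> (src h))"
    proof (rule Fin.arrows_eqI)
      show "Comp Fin_cat (\<eta> (tgt h)) (AMap (tens X) h) \<in> arrows Fin_cat (OMap P (X,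
        src h)) (OMap F (tgt h))"
        by (rule Fin.Comp_in_arrows[OF tens_arrow[OF X h] \<eta>_arrow[OF Y(2)]])
      show "Comp Fin_cat (AMap F h) (\<eta> (src h)) \<in> arrows Fin_cat (OMap P (X,
        src h)) (OMap F (tgt h))"
        by (rule Fin.Comp_in_arrows[OF \<eta>_arrow[OF Y(1)] is_functor_arrows[OF F.F h]])
      fix t assume t: "t \<in> OMap P (X, src h)"
      obtain x y where xy: "x \<in> ptsB X" "y \<in> ptsA (src h)" "t = q X (src h) x y"
        by (rule qE[OF X Y(1) t])
      have "\<phi> (tgt h) x (mor h y) = F.app h (\<phi> (src h) x y)"
        using F.app_app_pt[OF h xy(2), of "k x"] k(1)[OF xy(1)] by (simp add: \<phi>_def U_def)
      then show "mor (Comp Fin_cat (\<eta> (tgt h)) (AMap (tens X) h)) t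
        = mor (Comp Fin_cat (AMap F h) (\<eta> (src h))) t"
        unfolding Fin.mor_Comp_apply[OF tens_arrow[OF X h] t] Fin.mor_Comp_apply[OF \<eta>_arrow[OF Y(1)]
          t]
        using xy tens_q[OF X h xy(1,2)] \<eta>_q[OF Y(1) xy(1,2)] \<eta>_q[OF Y(2) xy(1) eqvA(1)[OF h xy(2)]]
        by (simp add: F.app_def)
    qed
    then show "Comp Fin_cat (\<eta> (Cod A h)) (AMap (tens X) h)
      = Comp Fin_cat (AMap F h) (\<eta> (Dom A h))" by simp
  qed
  have "Arrow (tens X) \<eta> F \<in> arrows (Fun_pce A Fin_cat) (tens X) F"
    using nt F pce_tens[OF X] by (simp add: arrows_Fun_pce_iff)
  moreover have "is_iso (Fun_pce A Fin_cat) (Arrow (tens X) \<eta> F)"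
    by (rule is_iso_Fun_pce[OF nt iso pce_tens[OF X] F])
  ultimately show ?thesis using X by blast
qed

theorem curry_equivalence: "is_equivalence B (Fun_pce A Fin_cat) (curry_left B A P)"
proof (rule fully_faithful_essentially_surjective_imp_equivalence[OF curry_functor])
  fix X X' assume X: "X \<in> Obj B" "X' \<in> Obj B"
  have "inj_on (AMap (curry_left B A P)) (arrows B X X')"
    using curry_faithful by (auto simp: inj_on_def)
  moreover have "AMap (curry_left B A P) ` arrows B X X'
    = arrows (Fun_pce A Fin_cat) (tens X) (tens X')"
  proof
    show "AMap (curry_left B A P) ` arrows B X X' \<subseteq> arrows (Fun_pce A Fin_cat) (tens X) (tens X')"
      using curry_arrow by blast
    show "arrows (Fun_pce A Fin_cat) (tens X) (tens X') \<subseteq> AMap (curry_left B A P) ` arrows B X X'"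
    proof
      fix \<alpha> assume "\<alpha> \<in> arrows (Fun_pce A Fin_cat) (tens X) (tens X')"
      then obtain f where "f \<in> arrows B X X'" "AMap (curry_left B A P) f = \<alpha>"
        by (rule curry_full[OF X])
      then show "\<alpha> \<in> AMap (curry_left B A P) ` arrows B X X'" by blast
    qed
  qed
  ultimately show "bij_betw (AMap (curry_left B A P)) (arrows B X X')
      (arrows (Fun_pce A Fin_cat) (OMap (curry_left B A P) X) (OMap (curry_left B A P) X'))"
    using X by (simp add: bij_betw_def)
next
  fix F :: "('p, ('p, 'b \<Rightarrow> 'b) arrow, 'c set, ('c set, 'c \<Rightarrow> 'c) arrow) ftor"
  assume "F \<in> Obj (Fun_pce A Fin_cat)"
  then have "pce_functor A Fin_cat F" by (simp add: Fun_pce_def)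
  from curry_essentially_surjective[OF this]
  show "\<exists>X \<in> Obj B. \<exists>i \<in> arrows (Fun_pce A Fin_cat) (OMap (curry_left B A P) X) F. is_iso (Fun_pce A Fin_cat) i"
    by auto
qed

end

section \<open>The balanced product\<close>

lemma group_opposite_group:
  assumes "group G"
  shows "group (opposite_group G)"
proof -
  interpret group G by fact
  show ?thesis
  proof (rule groupI)
    fix x assume "x \<in> carrier (opposite_group G)"
    then show "\<exists>y \<in> carrier (opposite_group G). y \<otimes>\<^bsub>opposite_group G\<^esub> x = \<one>\<^bsub>opposite_group G\<^esub>"
      by (auto intro!: bexI[of _ "inv\<^bsub>G\<^esub> x"])
  qed (auto simp: m_assoc)
qed

lemma opposite_opposite_group [simp]: "opposite_group (opposite_group G) = G"
  by (simp add: opposite_group_def)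

lemma finite_action_left_gset:
  assumes "left_gset H X" "finite (points X)" "r \<longrightarrow> free_gset H X"
  shows "finite_action H r (points X) (act X)"
  using assms left_gset_simps[OF assms(1)]
  by (auto simp: finite_action_def free_gset_def stabilizer_def)

text \<open>
  The action has to be made extensional before it is an object of the category of \<open>G\<close>-sets.
\<close>

lemma realize_gset:
  assumes "group H" and \<alpha>: "finite_action H r Z \<alpha>"
  shows "\<exists>X. finite (points X) \<and> left_gset H X \<and> (r \<longrightarrow> free_gset H X) \<and> points X = Z \<and>
    (\<forall>g \<in> carrier H. \<forall>z \<in> Z. act X g z = \<alpha> g z)"
proof -
  interpret group H by fact
  note D = \<alpha>[unfolded finite_action_def]
  define a where "a = (\<lambda>g \<in> carrier H. \<lambda>z \<in> Z. \<alpha> g z)"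
  have a: "a g z = \<alpha> g z" if "g \<in> carrier H" "z \<in> Z" for g z using that by (simp add: a_def)
  have inv: "\<alpha> (inv\<^bsub>H\<^esub> g) (\<alpha> g z) = z" "\<alpha> g (\<alpha> (inv\<^bsub>H\<^esub> g) z) = z" if "g \<in> carrier H" "z \<in> Z" for g z
    using D that by (metis l_inv r_inv inv_closed)+
  have Bij: "a g \<in> Bij Z" if g: "g \<in> carrier H" for g
  proof -
    have "bij_betw (a g) Z Z"
      by (rule bij_betw_byWitness[of _ "a (inv\<^bsub>H\<^esub> g)"]) (use g D inv in \<open>auto simp: a\<close>)
    then show ?thesis using g by (auto simp: Bij_def a_def)
  qed
  have "group_action H Z a"
    unfolding group_action_def group_hom_def group_hom_axioms_def
  proof (intro conjI)
    show "a \<in> hom H (BijGroup Z)"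
    proof (rule homI)
      show "a g \<in> carrier (BijGroup Z)" if "g \<in> carrier H" for g
        using Bij[OF that] by (simp add: BijGroup_def)
      fix g h assume gh: "g \<in> carrier H" "h \<in> carrier H"
      have "a (g \<otimes>\<^bsub>H\<^esub> h) = compose Z (a g) (a h)"
        using gh D by (auto simp: a_def compose_def intro!: restrict_ext)
      then show "a (g \<otimes>\<^bsub>H\<^esub> h) = a g \<otimes>\<^bsub>BijGroup Z\<^esub> a h"
        using Bij gh by (simp add: BijGroup_def)
    qed
  qed (simp_all add: group_BijGroup group_axioms)
  moreover have "a \<in> extensional (carrier H)" by (simp add: a_def)
  moreover have "r \<longrightarrow> free_gset H \<lparr>points = Z, act = a\<rparr>"
    using D by (auto simp: free_gset_def stabilizer_def a)
  ultimately show ?thesis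
    using D a by (intro exI[of _ "\<lparr>points = Z, act = a\<rparr>"]) (auto simp: left_gset_def)
qed

lemma gset_model_gset_category:
  assumes "group H" "finite (carrier H)" "infinite (UNIV :: 'a set)"
  shows "gset_model H r (gset_category H {X :: ('g, 'a) gset. finite (points X) \<and> left_gset H X \<and>
    (r \<longrightarrow> free_gset H X)}) points act"
proof -
  interpret group H by fact
  show ?thesis
  proof
    fix Z :: "'a set" and \<alpha> assume "finite_action H r Z \<alpha>"
    from realize_gset[OF assms(1) this]
    show "\<exists>X \<in> Obj (gset_category H {X. finite (points X) \<and> left_gset H X \<and> (r \<longrightarrow> free_gset H X)}).
       points X = Z \<and> (\<forall>g \<in> carrier H. \<forall>z \<in> Z. act X g z = \<alpha> g z)"
      by (auto simp: gset_category_def)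
  qed (auto simp: gset_category_def equivariant_def assms intro: finite_action_left_gset)
qed

lemma gset_model_Fin_free_left:
  assumes "group G" "finite (carrier G)" "infinite (UNIV :: 'b set)"
  shows "gset_model G True (Fin_free_left G :: (('g, 'b) gset, ('g, 'b) gset_arrow) cat) points act"
  using gset_model_gset_category[OF assms, of True] by (simp add: Fin_free_left_def)

lemma gset_model_Fin_right:
  assumes "group G" "finite (carrier G)" "infinite (UNIV :: 'a set)"
  shows "gset_model (opposite_group G) False
    (Fin_right G :: (('g, 'a) gset, ('g, 'a) gset_arrow) cat) points act"
proof -
  have "(Fin_right G :: (('g, 'a) gset, ('g, 'a) gset_arrow) cat) = gset_category (opposite_group G)
      {X. finite (points X) \<and> left_gset (opposite_group G) X \<and>
        (False \<longrightarrow> free_gset (opposite_group G) X)}"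
    by (simp add: Fin_right_def right_gset_def left_gset_def gset_category_def equivariant_def)
  then show ?thesis
    using gset_model_gset_category[OF group_opposite_group[OF assms(1)], of False] assms by simp
qed

definition balanced_class ::
    "('g, 'z) monoid_scheme \<Rightarrow> ('g, 'a) gset \<Rightarrow> ('g, 'b) gset \<Rightarrow> 'a \<Rightarrow> 'b \<Rightarrow> ('a \<times> 'b) set" where
  "balanced_class G X Y x y = balanced_rel G X Y `` {(x, y)}"

lemma balanced_prod_eq_image:
  "balanced_prod G X Y = (\<lambda>(x, y). balanced_class G X Y x y) ` (points X \<times> points Y)"
  by (auto simp: balanced_prod_def quotient_def balanced_class_def)

lemma balanced_class_eq_iff:
  assumes "group G" "right_gset G X" "left_gset G Y"
    and "x \<in> points X" "y \<in> points Y" "x' \<in> points X" "y' \<in> points Y"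
  shows "balanced_class G X Y x y = balanced_class G X Y x' y' \<longleftrightarrow>
    (\<exists>g \<in> carrier G. x = act X g x' \<and> y' = act Y g y)"
proof -
  have "balanced_class G X Y x y = balanced_class G X Y x' y' \<longleftrightarrow>
    ((x, y), (x', y')) \<in> balanced_rel G X Y"
    unfolding balanced_class_def
    by (rule eq_equiv_class_iff[OF equiv_balanced_rel[OF assms(1-3)]]) (use assms in auto)
  also have "\<dots> \<longleftrightarrow> (\<exists>g \<in> carrier G. x = act X g x' \<and> y' = act Y g y)"
    using assms(4-) by (auto simp: balanced_rel_def)
  finally show ?thesis .
qed

text \<open>
  The image of a class lies in a single class, so its saturation is that class.
\<close>

lemma balanced_map_class:
  assumes G: "group G" and X: "right_gset G (src f)" "right_gset G (tgt f)"
    and Y: "left_gset G (src h)" "left_gset G (tgt h)"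
    and f: "equivariant G (src f) (tgt f) (mor f)" "mor f \<in> points (src f) \<rightarrow> points (tgt f)"
    and h: "equivariant G (src h) (tgt h) (mor h)" "mor h \<in> points (src h) \<rightarrow> points (tgt h)"
    and xy: "x \<in> points (src f)" "y \<in> points (src h)"
  shows "balanced_map G f h (balanced_class G (src f) (src h) x y) =
    balanced_class G (tgt f) (tgt h) (mor f x) (mor h y)"
proof -
  let ?R = "balanced_rel G (src f) (src h)" and ?R' = "balanced_rel G (tgt f) (tgt h)"
  note eR = equiv_balanced_rel[OF G X(1) Y(1)] and eR' = equiv_balanced_rel[OF G X(2) Y(2)]
  have map: "(map_prod (mor f) (mor h) w, map_prod (mor f) (mor h) w') \<in> ?R'" if ww: "(w, w') \<in> ?R"
    for w w'
  proof -
    from ww obtain x0 g y0 where w: "w = (act (src f) g x0, y0)" "w' = (x0, act (src h) g y0)"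
      and *: "x0 \<in> points (src f)" "g \<in> carrier G" "y0 \<in> points (src h)"
      by (auto simp: balanced_rel_def)
    have "mor f (act (src f) g x0) = act (tgt f) g (mor f x0)"
      "mor h (act (src h) g y0) = act (tgt h) g (mor h y0)"
      using f(1) h(1) * by (simp_all add: equivariant_def)
    moreover have "mor f x0 \<in> points (tgt f)" "mor h y0 \<in> points (tgt h)" using f(2) h(2) * by auto
    ultimately show ?thesis using * unfolding w balanced_rel_def by auto
  qed
  have "?R' `` (map_prod (mor f) (mor h) ` (?R `` {(x, y)})) = ?R' `` {(mor f x, mor h y)}"
  proof
    show "?R' `` (map_prod (mor f) (mor h) ` (?R `` {(x, y)})) \<subseteq> ?R' `` {(mor f x, mor h y)}"
    proof
      fix v assume "v \<in> ?R' `` (map_prod (mor f) (mor h) ` (?R `` {(x, y)}))"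
      then obtain w where w: "((x, y), w) \<in> ?R" "(map_prod (mor f) (mor h) w, v) \<in> ?R'"
        by (elim ImageE imageE) simp
      have "trans ?R'" using eR' by (simp add: equiv_def)
      then have "(map_prod (mor f) (mor h) (x, y), v) \<in> ?R'" using map[OF w(1)] w(2)
        by (rule transD)
      then show "v \<in> ?R' `` {(mor f x, mor h y)}" by simp
    qed
    have "((x, y), (x, y)) \<in> ?R" using eR xy by (auto simp: equiv_def refl_on_def)
    then have "map_prod (mor f) (mor h) (x, y) \<in> map_prod (mor f) (mor h) ` (?R `` {(x, y)})"
      by (intro imageI) simp
    then show "?R' `` {(mor f x, mor h y)} \<subseteq> ?R' `` (map_prod (mor f) (mor h) ` (?R `` {(x, y)}))"
      by (intro Image_mono) simp_all
  qed
  then show ?thesis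
    using xy unfolding balanced_map_def balanced_class_def balanced_prod_eq_image
      by (auto simp: balanced_class_def)
qed

lemma Fin_right_simps:
  "X \<in> Obj (Fin_right G) \<longleftrightarrow> finite (points X) \<and> right_gset G X"
  "f \<in> Arr (Fin_right G) \<longleftrightarrow> src f \<in> Obj (Fin_right G) \<and> tgt f \<in> Obj (Fin_right G) \<and>
    mor f \<in> points (src f) \<rightarrow>\<^sub>E points (tgt f) \<and> equivariant G (src f) (tgt f) (mor f)"
  by (simp_all add: Fin_right_def gset_category_def)

lemma Fin_free_left_simps:
  "Y \<in> Obj (Fin_free_left G) \<longleftrightarrow> finite (points Y) \<and> left_gset G Y \<and> free_gset G Y"
  "h \<in> Arr (Fin_free_left G) \<longleftrightarrow> src h \<in> Obj (Fin_free_left G) \<and> tgt h \<in> Obj (Fin_free_left G) \<and>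
    mor h \<in> points (src h) \<rightarrow>\<^sub>E points (tgt h) \<and> equivariant G (src h) (tgt h) (mor h)"
  by (simp_all add: Fin_free_left_def gset_category_def)

lemma balanced_map_class_arrows:
  assumes "group G" "f \<in> Arr (Fin_right G)" "h \<in> Arr (Fin_free_left G)"
    and "x \<in> points (src f)" "y \<in> points (src h)"
  shows "balanced_map G f h (balanced_class G (src f) (src h) x y) =
    balanced_class G (tgt f) (tgt h) (mor f x) (mor h y)"
  using assms by (intro balanced_map_class) (auto simp: Fin_right_simps Fin_free_left_simps)

lemma balanced_prod_functor_simps:
  "X \<in> Obj (Fin_right G) \<Longrightarrow> Y \<in> Obj (Fin_free_left G) \<Longrightarrow>
    OMap (balanced_prod_functor G) (X, Y) = balanced_prod G X Y"
  "f \<in> Arr (Fin_right G) \<Longrightarrow> h \<in> Arr (Fin_free_left G) \<Longrightarrow> AMap (balanced_prod_functor G) (f, h) =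
    Arrow (balanced_prod G (src f) (src h)) (balanced_map G f h) (balanced_prod G (tgt f) (tgt h))"
  by (simp_all add: balanced_prod_functor_def)

lemma is_functor_balanced_prod_functor:
  fixes G :: "('g, 'z) monoid_scheme"
  assumes G: "group G" and "finite (carrier G)"
    and "infinite (UNIV :: 'a set)" and "infinite (UNIV :: 'b set)"
  shows "is_functor
    (prod_category (Fin_right G :: (('g, 'a) gset, ('g, 'a) gset_arrow) cat)
      (Fin_free_left G :: (('g, 'b) gset, ('g, 'b) gset_arrow) cat))
    Fin_cat (balanced_prod_functor G)"
proof -
  interpret R: gset_model "opposite_group G" False "Fin_right G :: (('g, 'a) gset, ('g,
    'a) gset_arrow) cat" points act
    by (rule gset_model_Fin_right[OF assms(1-3)])
  interpret L: gset_model G True "Fin_free_left G :: (('g, 'b) gset, ('g,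
    'b) gset_arrow) cat" points act
    by (rule gset_model_Fin_free_left[OF assms(1,2,4)])
  let ?R = "Fin_right G :: (('g, 'a) gset, ('g, 'a) gset_arrow) cat"
  let ?L = "Fin_free_left G :: (('g, 'b) gset, ('g, 'b) gset_arrow) cat"
  note bs = balanced_prod_functor_simps
  have obj: "balanced_prod G X Y \<in> Obj Fin_cat" if "X \<in> Obj ?R" "Y \<in> Obj ?L" for X Y
    using that by (simp add: Fin_cat_def balanced_prod_eq_image Fin_right_simps Fin_free_left_simps)
  have cls: "balanced_map G f h (balanced_class G (src f) (src h) x y) =
      balanced_class G (tgt f) (tgt h) (mor f x) (mor h y)"
    "mor f x \<in> points (tgt f)" "mor h y \<in> points (tgt h)"
    if "f \<in> Arr ?R" "h \<in> Arr ?L" "x \<in> points (src f)" "y \<in> points (src h)" for f h x y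
    using balanced_map_class_arrows[OF G that] that
    by (auto simp: Fin_right_simps(2) Fin_free_left_simps(2))
  have "infinite (UNIV :: ('a \<times> 'b) set set)"
    using assms(3) by (simp add: Finite_Set.finite_set finite_prod)
  then interpret Fin: gset_model trivial_group False
    "Fin_cat :: (('a \<times> 'b) set set, (('a \<times> 'b) set set, ('a \<times> 'b) set \<Rightarrow> ('a \<times> 'b) set) arrow) cat"
      "\<lambda>X. X" "\<lambda>X g x. x"
    by (rule gset_model_Fin_cat)
  have arr: "Arrow (balanced_prod G (src f) (src h)) (balanced_map G f h) (balanced_prod G (tgt f) (tgt h))
      \<in> arrows Fin_cat (balanced_prod G (src f) (src h)) (balanced_prod G (tgt f) (tgt h))"
    if fh: "f \<in> Arr ?R" "h \<in> Arr ?L" for f h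
  proof -
    have "balanced_map G f h \<in> balanced_prod G (src f) (src h) \<rightarrow>\<^sub>E balanced_prod G (tgt f) (tgt h)"
    proof (rule PiE_I)
      fix c assume "c \<in> balanced_prod G (src f) (src h)"
      then obtain x y where xy: "x \<in> points (src f)" "y \<in> points (src h)"
        "c = balanced_class G (src f) (src h) x y"
        by (auto simp: balanced_prod_eq_image)
      then show "balanced_map G f h c \<in> balanced_prod G (tgt f) (tgt h)"
        using cls[OF fh xy(1,2)] by (auto simp: balanced_prod_eq_image)
    qed (simp add: balanced_map_def)
    moreover have "src f \<in> Obj ?R" "tgt f \<in> Obj ?R" "src h \<in> Obj ?L" "tgt h \<in> Obj ?L"
      using fh R.Arr_iff L.Arr_iff by blast+
    ultimately show ?thesis using obj by (simp add: Fin.arrows_iff Fin.eqv_def)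
  qed
  have arrow_eq: "k = k'" if "k \<in> arrows Fin_cat (balanced_prod G X Y) Z"
    "k' \<in> arrows Fin_cat (balanced_prod G X Y) Z"
    "\<And>x y. x \<in> points X \<Longrightarrow> y \<in> points Y \<Longrightarrow>
      mor k (balanced_class G X Y x y) = mor k' (balanced_class G X Y x y)"
    for k k' Z and X :: "('g, 'a) gset" and Y :: "('g, 'b) gset"
    by (rule Fin.arrows_eqI[OF that(1,2)]) (use that(3) in \<open>auto simp: balanced_prod_eq_image\<close>)
  have cls_in: "balanced_class G X Y x y \<in> balanced_prod G X Y" if "x \<in> points X" "y \<in> points Y"
    for x y and X :: "('g, 'a) gset" and Y :: "('g, 'b) gset"
    using that by (auto simp: balanced_prod_eq_image)
  show ?thesis
    unfolding is_functor_def
  proof (intro conjI ballI impI)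
    show "category (prod_category ?R ?L)" by (rule category_prod_category[OF R.category L.category])
    show "category (Fin_cat :: (('a \<times> 'b) set set, (('a \<times> 'b) set set,
      ('a \<times> 'b) set \<Rightarrow> ('a \<times> 'b) set) arrow) cat)"
      by (rule Fin.category)
    show "OMap (balanced_prod_functor G) \<in> Obj (prod_category ?R ?L) \<rightarrow>\<^sub>E Obj Fin_cat"
      using obj by (auto simp: balanced_prod_functor_def)
    show "AMap (balanced_prod_functor G) \<in> Arr (prod_category ?R ?L) \<rightarrow>\<^sub>E Arr Fin_cat"
      using arr by (auto simp: balanced_prod_functor_def arrows_def)
  next
    fix fh assume fh: "fh \<in> Arr (prod_category ?R ?L)"
    obtain f h where e: "fh = (f, h)" by (cases fh)
    have ob: "src f \<in> Obj ?R" "tgt f \<in> Obj ?R" "src h \<in> Obj ?L" "tgt h \<in> Obj ?L"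
      using fh R.Arr_iff L.Arr_iff by (auto simp: e)
    show "Dom Fin_cat (AMap (balanced_prod_functor G) fh)
      = OMap (balanced_prod_functor G) (Dom (prod_category ?R ?L) fh)"
      "Cod Fin_cat (AMap (balanced_prod_functor G) fh)
        = OMap (balanced_prod_functor G) (Cod (prod_category ?R ?L) fh)"
      using fh ob by (auto simp: e bs)
  next
    fix XY assume XY: "XY \<in> Obj (prod_category ?R ?L)"
    obtain X Y where e: "XY = (X, Y)" by (cases XY)
    have o: "X \<in> Obj ?R" "Y \<in> Obj ?L" using XY by (auto simp: e)
    note ids = R.Id_simps(1)[OF o(1)] L.Id_simps(1)[OF o(2)]
    have "Arrow (balanced_prod G X Y) (balanced_map G (Id ?R X) (Id ?L Y)) (balanced_prod G X Y)
        = Id Fin_cat (balanced_prod G X Y)"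
    proof (rule arrow_eq)
      show "Arrow (balanced_prod G X Y) (balanced_map G (Id ?R X) (Id ?L Y)) (balanced_prod G X Y)
        \<in> arrows Fin_cat (balanced_prod G X Y) (balanced_prod G X Y)"
        using arr[OF ids] by (simp add: R.Id_eq L.Id_eq)
      show "Id Fin_cat (balanced_prod G X Y) \<in> arrows Fin_cat (balanced_prod G X Y) (balanced_prod G X Y)"
        by (rule Fin.Id_in_arrows[OF obj[OF o]])
      show "mor (Arrow (balanced_prod G X Y) (balanced_map G (Id ?R X) (Id ?L Y)) (balanced_prod G X Y))
          (balanced_class G X Y x y)
            = mor (Id Fin_cat (balanced_prod G X Y)) (balanced_class G X Y x y)"
        if "x \<in> points X" "y \<in> points Y" for x y
        using cls(1)[OF ids, of x y] that cls_in[OF that] by (simp add: R.Id_eq L.Id_eq Fin.Id_eq)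
    qed
    then show "AMap (balanced_prod_functor G) (Id (prod_category ?R ?L) XY)
      = Id Fin_cat (OMap (balanced_prod_functor G) XY)"
      using o ids by (simp add: e bs R.Id_eq L.Id_eq)
  next
    fix fh gk assume a: "fh \<in> Arr (prod_category ?R ?L)" "gk \<in> Arr (prod_category ?R ?L)"
      "Cod (prod_category ?R ?L) fh = Dom (prod_category ?R ?L) gk"
    obtain f h where e: "fh = (f, h)" by (cases fh)
    obtain g k where e': "gk = (g, k)" by (cases gk)
    have f: "f \<in> Arr ?R" "g \<in> Arr ?R" "tgt f = src g" and h: "h \<in> Arr ?L" "k \<in> Arr ?L"
      "tgt h = src k"
      using a by (auto simp: e e')
    let ?gf = "Comp ?R g f" and ?kh = "Comp ?L k h"
    have c: "?gf \<in> Arr ?R" "?kh \<in> Arr ?L" using f h by (simp_all add: R.seq_simps L.seq_simps)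
    have st: "src ?gf = src f" "tgt ?gf = tgt g" "src ?kh = src h" "tgt ?kh = tgt k"
      by (simp_all add: R.Comp_eq L.Comp_eq)
    let ?A = "\<lambda>f h. Arrow (balanced_prod G (src f) (src h)) (balanced_map G f h) (balanced_prod G (tgt f) (tgt h))"
    have A2: "?A g k \<in> arrows Fin_cat (balanced_prod G (tgt f) (tgt h)) (balanced_prod G (tgt g) (tgt k))"
      using arr[OF f(2) h(2)] by (simp add: f(3) h(3))
    have "?A ?gf ?kh = Comp Fin_cat (?A g k) (?A f h)"
    proof (rule arrow_eq)
      show "?A ?gf ?kh \<in> arrows Fin_cat (balanced_prod G (src f) (src h)) (balanced_prod G (tgt g) (tgt k))"
        using arr[OF c] by (simp only: st)
      show "Comp Fin_cat (?A g k) (?A f h) \<in> arrows Fin_cat (balanced_prod G (src f) (src h)) (balanced_prod G (tgt g) (tgt k))"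
        by (rule Fin.Comp_in_arrows[OF arr[OF f(1) h(1)] A2])
      fix x y assume xy: "x \<in> points (src f)" "y \<in> points (src h)"
      note c1 = cls[OF f(1) h(1) xy]
      have "mor (Comp Fin_cat (?A g k) (?A f h)) (balanced_class G (src f) (src h) x y)
          = balanced_map G g k (balanced_class G (src g) (src k) (mor f x) (mor h y))"
        using Fin.mor_Comp_apply[OF arr[OF f(1) h(1)] cls_in[OF xy], of "?A g k"]
          c1 f(3) h(3) by simp
      also have "\<dots> = balanced_class G (tgt g) (tgt k) (mor g (mor f x)) (mor k (mor h y))"
        using cls(1)[OF f(2) h(2)] c1 f(3) h(3) by simp
      also have "\<dots> = mor (?A ?gf ?kh) (balanced_class G (src f) (src h) x y)"
        using cls(1)[OF c, of x y] xy by (simp add: R.Comp_eq L.Comp_eq compose_eq)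
      finally show "mor (?A ?gf ?kh) (balanced_class G (src f) (src h) x y)
          = mor (Comp Fin_cat (?A g k) (?A f h)) (balanced_class G (src f) (src h) x y)" by simp
    qed
    then show "AMap (balanced_prod_functor G) (Comp (prod_category ?R ?L) gk fh)
        = Comp Fin_cat (AMap (balanced_prod_functor G) gk) (AMap (balanced_prod_functor G) fh)"
      using f h c by (simp add: e e' bs)
  qed
qed

theorem corollary4p1p0p7:
  fixes G :: "('g, 'z) monoid_scheme"
  assumes "group G" and "finite (carrier G)"
    and "infinite (UNIV :: 'a set)" and "infinite (UNIV :: 'b set)"
  shows "perfect_pairing
    (Fin_right G :: (('g, 'a) gset, ('g, 'a) gset_arrow) cat)
    (Fin_free_left G :: (('g, 'b) gset, ('g, 'b) gset_arrow) cat)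
    (balanced_prod_functor G)"
proof -
  let ?R = "Fin_right G :: (('g, 'a) gset, ('g, 'a) gset_arrow) cat"
  let ?L = "Fin_free_left G :: (('g, 'b) gset, ('g, 'b) gset_arrow) cat"
  let ?Fin = "Fin_cat :: (('a \<times> 'b) set set, (('a \<times> 'b) set set,
    ('a \<times> 'b) set \<Rightarrow> ('a \<times> 'b) set) arrow) cat"
  let ?P = "balanced_prod_functor G ::
      (('g, 'a) gset \<times> ('g, 'b) gset, ('g, 'a) gset_arrow \<times> ('g, 'b) gset_arrow,
       ('a \<times> 'b) set set, (('a \<times> 'b) set set, ('a \<times> 'b) set \<Rightarrow> ('a \<times> 'b) set) arrow) ftor"
  have R: "gset_model (opposite_group G) False ?R points act"
    by (rule gset_model_Fin_right[OF assms(1-3)])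
  have L: "gset_model G True ?L points act"
    by (rule gset_model_Fin_free_left[OF assms(1,2,4)])
  have "infinite (UNIV :: ('a \<times> 'b) set set)"
    using assms(3) by (simp add: Finite_Set.finite_set finite_prod)
  then have Fin: "gset_model trivial_group False ?Fin (\<lambda>X. X) (\<lambda>X g x. x)"
    by (rule gset_model_Fin_cat)
  interpret R: gset_model "opposite_group G" False ?R points act by (rule R)
  interpret L: gset_model G True ?L points act by (rule L)
  note P = is_functor_balanced_prod_functor[OF assms]
  note P' = is_functor_swap_functor[OF P R.category L.category]
  have image: "OMap ?P (X, Y) = (\<lambda>(x, y). balanced_class G X Y x y) ` (points X \<times> points Y)"
    if "X \<in> Obj ?R" "Y \<in> Obj ?L" for X Y
    using that by (simp add: balanced_prod_functor_simps balanced_prod_eq_image)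
  have iff: "balanced_class G X Y x y = balanced_class G X Y x' y' \<longleftrightarrow>
      (\<exists>g \<in> carrier G. x = act X g x' \<and> y' = act Y g y)"
    if "X \<in> Obj ?R" "Y \<in> Obj ?L" "x \<in> points X" "y \<in> points Y" "x' \<in> points X" "y' \<in> points Y"
      for X Y x y x' y'
    using that by (intro balanced_class_eq_iff[OF assms(1)]) (simp_all add: Fin_right_simps Fin_free_left_simps)
  have mor: "mor (AMap ?P (f, h)) (balanced_class G X Y x y)
    = balanced_class G X' Y' (mor f x) (mor h y)"
    if "f \<in> arrows ?R X X'" "h \<in> arrows ?L Y Y'" "x \<in> points X" "y \<in> points Y" for f h X X' Y Y' x y
    using that balanced_map_class_arrows[OF assms(1), of f h x y]
    by (auto simp: arrows_def balanced_prod_functor_simps)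
  interpret Fin: gset_model trivial_group False ?Fin "\<lambda>X. X" "\<lambda>X g x. x" by (rule Fin)
  \<comment> \<open>The functors \<open>X \<times>\<^sub>G -\<close> on free left \<open>G\<close>-sets, and the functors \<open>- \<times>\<^sub>G Y\<close> on all right
    \<open>G\<close>-sets. For the latter the group element relating two tensors changes sides, which amounts to
    reading the equation between the tensors backwards.\<close>
  interpret left: tensor_pairing G True ?L points act ?R points act ?P "balanced_class G"
    by (intro tensor_pairing.intro tensor_pairing_axioms.intro)
       (use R L Fin P image iff mor in simp_all)
  interpret right: tensor_pairing "opposite_group G" False ?R points act ?L points act "swap_functor ?P"
      "\<lambda>Y X y x. balanced_class G X Y x y"
  proof (intro tensor_pairing.intro tensor_pairing_axioms.intro)
    show "gset_model (opposite_group (opposite_group G)) (\<not> False) ?L points act" using L by simp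
    show "OMap (swap_functor ?P) (Y, X) = (\<lambda>(y,
      x). balanced_class G X Y x y) ` (points Y \<times> points X)"
      if "Y \<in> Obj ?L" "X \<in> Obj ?R" for X Y
      using image[OF that(2,1)] by auto
    fix X Y x y x' y'
    assume "Y \<in> Obj ?L" "X \<in> Obj ?R" "y \<in> points Y" "x \<in> points X" "y' \<in> points Y" "x' \<in> points X"
    then show "balanced_class G X Y x y = balanced_class G X Y x' y' \<longleftrightarrow>
        (\<exists>g \<in> carrier (opposite_group G). y = act Y g y' \<and> x' = act X g x)"
      using iff[of X Y x' y' x y] by auto
  qed (use R Fin P' mor in simp_all)
  show ?thesis
    unfolding perfect_pairing_def fix_right_eq_fix_left curry_right_eq_curry_left
    using R.has_pullbacks R.has_finite_coproducts L.has_pullbacks L.has_finite_coproducts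
      Fin.has_pullbacks Fin.has_finite_coproducts R.category L.category P
      left.pce_tens right.pce_tens left.curry_equivalence right.curry_equivalence
    by blast
qed

end
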